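(* Let $\Lambda=t_1\Lambda_1+t_0\Lambda_0$ ($t_0,t_1\in\mathbb{Z}_{\ge0}$) be any dominant integral weight. Then the mutually inverse maps $\mathcal{X}:\mathcal{MV}\to\mathcal{UL}$ and $\mathcal{Y}:\mathcal{UL}\to\mathcal{MV}$ restrict to mutually inverse ${\tt A}_1^{(1)}$-crystal isomorphisms $$\mathcal{X}^\Lambda: \mathcal{MV}^{\Lambda} \xrightarrow{\sim} \mathcal{UL}^\Lambda \qquad\text{and}\qquad \mathcal{Y}^\Lambda: \mathcal{UL}^{\Lambda} \xrightarrow{\sim} \mathcal{MV}^{\Lambda}.$$
   Context: Partitions: identified with Young diagrams (English convention). $p(\lambda)$ = number of nonzero rows, $c_t(\lambda)$ = length of column $t$, $c(\lambda)$ = number of nonzero columns, $n_k(\lambda)$ = number of rows of length $k$. 2-regular: no two nonzero rows of equal length. $\mathrm{double}(\lambda)$ doubles all column lengths; $\mathrm{halve}$ halves all column lengths (when even). Write $\hat i=i+1$ for $i\in\mathbb{Z}_2$. Spar tableau $\mathrm{spar}(\lambda)$: traversing columns right to left, and each column bottom to top, label each box with the smallest positive integer exceeding the labels of the boxes directly below and directly right (if any) and appearing nowhere in the column immediately to the right. $\mathrm{ord}(\lambda)$ is the unique 2-regular $\mu$ with $c_t(\mu)$ odd iff $t$ appears in the first column of $\mathrm{spar}(\lambda)$. For 2-regular $\mu$, $\mathrm{calc}(\mu)$ is the partition built thus: first column labeled by $\{t\in[1,c(\mu)]\mid c_t(\mu)\text{ odd}\}$, decreasing downward; then for later columns left to right,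 each top to bottom, place a box labeled by the largest positive integer strictly less than every entry directly above or directly left of it and appearing nowhere in the column immediately to the left; if no such integer exists, or there is no box immediately left, end the column; halt when a column receives no boxes. Root partitions: $\alpha_0,\alpha_1$ simple roots, $\delta=\alpha_0+\alpha_1$, $\alpha_{1:k}=k\alpha_1+(k-1)\alpha_0$, $\alpha_{0:k}=(k-1)\alpha_1+k\alpha_0$. $\Pi(\theta)$ is the set of triples of partitions $\pi=\{\pi^1,\pi^\delta,\pi^0\}$ with $\theta=\sum_k n_k(\pi^1)\alpha_{1:k}+|\pi^\delta|\delta+\sum_kn_k(\pi^0)\alpha_{0:k}$. Affine MV polytopes: for $\pi,\phi\in\Pi(\theta)$, $m\geq1$ put $c_m^{\uparrow}=\sum_{k=1}^m k(n_{k+1}(\phi^0)-n_k(\pi^1))$, $c_m^{\rightarrow}=\sum_{k=1}^m k(n_{k+1}(\pi^1)-n_k(\phi^0))$, $c_m^{\downarrow}=\sum_{k=1}^m k(n_{k+1}(\pi^0)-n_k(\phi^1))$, $c_m^{\leftarrow}=\sum_{k=1}^m k(n_{k+1}(\phi^1)-n_k(\pi^0))$. $(\pi|\phi)$ is an affine MV polytope of content $\theta$ if (1) for every $m\ge1$, $0\in\{c_m^\uparrow,c_m^\rightarrow\}\subseteq\mathbb{Z}_{\le0}$ and $0\in\{c_m^\downarrow,c_m^\leftarrow\}\subseteq\mathbb{Z}_{\le0}$; (2) $\pi^\delta_1\le p(\pi^1)+p(\phi^0)=p(\pi^0)+p(\phi^1)$, and $\phi^\delta$ equals $\pi^\delta$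 if $|\pi^\delta|=|\phi^\delta|$, $(\pi^\delta_2,\pi^\delta_3,\ldots)$ if $|\pi^\delta|>|\phi^\delta|$, $(p(\pi^1)+p(\phi^0),\pi^\delta_1,\pi^\delta_2,\ldots)$ if $|\pi^\delta|<|\phi^\delta|$. $\mathcal{MV}$ is the set of all of these. For each $\pi$ there is a unique $\pi_\lozenge$ with $(\pi|\pi_\lozenge)\in\mathcal{MV}$ (known), and then $(\pi_\lozenge|\pi)\in\mathcal{MV}$. Crystal structure on $\mathcal{MV}$: let $\pi_{+i}$ (resp. $\pi_{-i}$) be $\pi$ with a row of length 1 inserted into (resp. deleted from, if $n_1(\pi^i)>0$) $\pi^i$. Then $f_1(\pi|\phi)=((\phi_{+1})_\lozenge|\phi_{+1})$, $f_0(\pi|\phi)=(\pi_{+0}|(\pi_{+0})_\lozenge)$; $e_1,e_0$ are given by the same formulas with $+$ replaced by $-$, and are $0$ if respectively $n_1(\phi^1)$, $n_1(\pi^0)$ is zero. $\mathrm{wt}(\pi|\phi)=-\theta$, $\varepsilon_1=n_1(\phi^1)$, $\varepsilon_0=n_1(\pi^0)$, $\varphi_i=\varepsilon_i+\langle\mathrm{wt},\alpha_i^\vee\rangle$ (with $\langle\alpha_i,\alpha_i^\vee\rangle=2$, $\langle\alpha_{\hat i},\alpha_i^\vee\rangle=-2$). Also $\varepsilon_1^*(\pi|\phi)=n_1(\pi^1)$, $\varepsilon_0^*(\pi|\phi)=n_1(\phi^0)$. Ledge diagrams: a ledge diagram is a left-aligned arrangement of boxes with row lengths $(d_1,\ldots,d_m)\in\mathbb{Z}_{>0}^m$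 from top to bottom ($m=0$ allowed), boxes colored by $\mathbb{Z}_2$, such that for some $t$, $(d_1,\ldots,d_t)$ is weakly increasing and $(d_t,\ldots,d_m)$ weakly decreasing, each row has a single color, and colors alternate down columns. It is upper ledge if $(d_1,\ldots,d_t)$ is strictly increasing. $\mathcal{UL}$ is the set of upper ledge diagrams; content is $\#\{0\text{-boxes}\}\alpha_0+\#\{1\text{-boxes}\}\alpha_1$. An $i$-peak row is a longest $i$-colored row; an $i$-colored box is $i$-bottom (resp. $i$-top) if there is no box directly below (resp. above) it. Crystal structure on $\mathcal{UL}$: the $i$-arc arrangement $\mathsf{D}[i]$: reading right to left, whenever an $i$-top (resp. $i$-bottom) box is followed by an $\hat i$-top (resp. $\hat i$-bottom) box with no unarced top (resp. bottom) boxes between them, draw an arc; repeat until impossible. $\mathrm{wt}=-\mathrm{cont}$; $\varepsilon_i$ (resp. $\varepsilon_i^*$) is the number of unarced $i$-bottom (resp. $i$-top) boxes in $\mathsf{D}[i]$; $\varphi_i=\varepsilon_i+\langle\mathrm{wt},\alpha_i^\vee\rangle$. $e_i$ deletes the rightmost unarced $i$-bottom box, or gives $0$ if none; $f_i$ adds an $i$-colored box directly below the leftmost unarced $\hat i$-bottom box, or, if none exists, appends an $i$-colored box to the uppermost $i$-peak row (for $\varnothing$: gives the one-box diagram of color $i$). Highest weight crystals: for $B=\mathcal{MV}$ or $\mathcal{UL}$, $B^\Lambda=\{b\in B\mid\varepsilon_i^*(b)\le t_i\text{ for }i\in\mathbb{Z}_2\}$, with operators $e_i^\Lambda,f_i^\Lambda$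 inherited from $e_i,f_i$ by setting all elements not in $B^\Lambda$ equal to $0$, $\mathrm{wt}^\Lambda=\Lambda+\mathrm{wt}$, $\varepsilon_i^\Lambda=\varepsilon_i$, $\varphi_i^\Lambda=\varphi_i+t_i$. A crystal isomorphism is a bijection commuting with all operators and statistics. Maps: $\mathrm{flip}$ reflects a ledge diagram across a horizontal axis; $\mathrm{color}_i(\lambda)$ is the diagram of shape $\lambda$ with top row colored $i$ and colors alternating down columns; $\mathrm{forget}$ forgets colors of a diagram with weakly decreasing rows. For a triple of upper ledge diagrams with $\mathsf{D}_i^\uparrow$ having row lengths strictly increasing downward and bottom row of color $i$; $\mathsf{D}_i^\delta$ having weakly decreasing rows, all top boxes of color $\hat i$ and all bottom boxes of color $i$; $\mathsf{D}_i^\downarrow$ having strictly decreasing rows and top row of color $\hat i$ (each possibly empty), $\mathrm{stack}_i(\mathsf{D}^\uparrow_i,\mathsf{D}^\delta_i,\mathsf{D}^\downarrow_i)\in\mathcal{UL}$ is: place $\mathsf{D}_i^\uparrow$ directly above and $\mathsf{D}_i^\downarrow$ directly below $\mathsf{D}_i^\delta$, left columns aligned, then shift the columns of $\mathsf{D}_i^\downarrow$ upward until they meet the bottom of $\mathsf{D}_i^\delta$ or else align with its top row. Conversely $\mathrm{trip}_i(\mathsf{D})=(\mathsf{D}^\uparrow_i,\mathsf{D}^\delta_i,\mathsf{D}^\downarrow_i)$: $\mathsf{D}_i^\uparrow$ is all boxes weakly northwest of the rightmost $i$-top box (empty if none); for $\mathsf{D}_i^\downarrow$, highlight the rightmost $\hat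 i$-bottom box and then, working leftward, highlight the same number of boxes at the bottom of each successive column, increasing by one each time the bottom box color changes, and shift the highlighted columns down so they are top-aligned; $\mathsf{D}_i^\delta$ is the remaining diagram. $\mathcal{X}_i(\pi)=\mathrm{stack}_i\big(\mathrm{flip}\circ\mathrm{color}_i\circ\mathrm{ord}(\pi^i),\ \mathrm{color}_{\hat i}\circ\mathrm{double}(\pi^\delta),\ \mathrm{color}_{\hat i}\circ\mathrm{ord}(\pi^{\hat i})\big)$. $\mathcal{Y}_i(\mathsf{D})=\{\pi^1,\pi^\delta,\pi^0\}$ with $(\mathsf{D}^\uparrow_i,\mathsf{D}^\delta_i,\mathsf{D}^\downarrow_i)=\mathrm{trip}_i(\mathsf{D})$, $\pi^i=\mathrm{calc}\circ\mathrm{forget}\circ\mathrm{flip}(\mathsf{D}_i^\uparrow)$, $\pi^\delta=\mathrm{halve}\circ\mathrm{forget}(\mathsf{D}_i^\delta)$, $\pi^{\hat i}=\mathrm{calc}\circ\mathrm{forget}(\mathsf{D}_i^\downarrow)$. Finally $\mathcal{X}(\pi|\phi)=\mathcal{X}_1(\pi)=\mathcal{X}_0(\phi)$ and $\mathcal{Y}(\mathsf{D})=(\mathcal{Y}_1(\mathsf{D})|\mathcal{Y}_0(\mathsf{D}))$. *)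

theory Defs
  imports Complex_Main "HOL-Library.Z2" "HOL-Library.Function_Algebras" "HOL-Library.Product_Plus"
begin

text \<open>The index set \<open>\<int>\<^sub>2\<close> is the type \<^typ>\<open>bit\<close>, so the opposite \<open>\<hat>i\<close> of \<open>i\<close> is literally
  \<^term>\<open>i + (1 :: bit)\<close>.\<close>

section \<open>Partitions\<close>

text \<open>A partition is the weakly decreasing list of its nonzero row lengths, top row first.  Rows and
  columns of Young diagrams are numbered from 1.\<close>

definition partition :: "nat list \<Rightarrow> bool" where
  "partition \<nu> \<longleftrightarrow> sorted_wrt (\<ge>) \<nu> \<and> 0 \<notin> set \<nu>"

abbreviation rows_of_length :: "nat \<Rightarrow> nat list \<Rightarrow> nat" where
  "rows_of_length k \<nu> \<equiv> count_list \<nu> k"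

definition col :: "nat \<Rightarrow> nat list \<Rightarrow> nat" where
  "col t ds = length (filter (\<lambda>d. t \<le> d) ds)"

definition width :: "nat list \<Rightarrow> nat" where
  "width ds = Max (insert 0 (set ds))"

text \<open>The list of column lengths.  Conversely, applied to a weakly decreasing list of column
  lengths (possibly ending in zeros) this returns the partition with these columns.\<close>

definition conjugate :: "nat list \<Rightarrow> nat list" where
  "conjugate ds = map (\<lambda>t. col t ds) [1..<Suc (width ds)]"

definition double :: "nat list \<Rightarrow> nat list" where
  "double \<nu> = conjugate (map (\<lambda>h. 2 * h) (conjugate \<nu>))"

definition halve :: "nat list \<Rightarrow> nat list" where
  "halve \<nu> = conjugate (map (\<lambda>h. h div 2) (conjugate \<nu>))"

section \<open>Spar tableaux and the maps ord and calc\<close>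

text \<open>Tableaux are lists of columns from left to right, each column being read from top to bottom.
  \<open>spar_col R h k\<close> is the bottom \<open>k\<close> boxes of a column of length \<open>h\<close> whose right neighbour is
  \<open>R\<close>; the next box to be labelled is the one in the row of index \<open>h - Suc k\<close>, counted from 0.\<close>

primrec spar_col :: "nat list \<Rightarrow> nat \<Rightarrow> nat \<Rightarrow> nat list" where
  "spar_col R h 0 = []"
| "spar_col R h (Suc k) =
    (let xs = spar_col R h k; r = h - Suc k in
     (LEAST n. 0 < n \<and> (xs \<noteq> [] \<longrightarrow> hd xs < n) \<and> (r < length R \<longrightarrow> R ! r < n) \<and> n \<notin> set R) # xs)"

primrec spar_cols :: "nat list \<Rightarrow> nat list list" where
  "spar_cols [] = []"
| "spar_cols (h # hs) =
    (let T = spar_cols hs in spar_col (case T of [] \<Rightarrow> [] | R # _ \<Rightarrow> R) h h # T)"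

definition spar :: "nat list \<Rightarrow> nat list list" where
  "spar \<nu> = spar_cols (conjugate \<nu>)"

text \<open>``2-regular'' means that the nonzero row lengths are \<^const>\<open>distinct\<close>.\<close>

definition ord :: "nat list \<Rightarrow> nat list" where
  "ord \<nu> = (THE \<mu>. partition \<mu> \<and> distinct \<mu> \<and>
     (\<forall>t\<ge>1. odd (col t \<mu>) \<longleftrightarrow> t \<in> (case spar \<nu> of [] \<Rightarrow> {} | C # _ \<Rightarrow> set C)))"

text \<open>\<open>calc_col S ls a\<close> fills a column next to the boxes \<open>ls\<close> of its left neighbour (whose set of
  all entries is \<open>S\<close>), the entry just above being \<open>a\<close>, if there is one.\<close>

primrec calc_col :: "nat set \<Rightarrow> nat list \<Rightarrow> nat option \<Rightarrow> nat list" where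
  "calc_col S [] a = []"
| "calc_col S (l # ls) a =
    (let C = {n. 0 < n \<and> n < l \<and> (\<forall>x. a = Some x \<longrightarrow> n < x) \<and> n \<notin> S} in
     if C = {} then [] else Max C # calc_col S ls (Some (Max C)))"

lemma hd_calc_col_less:
  assumes "calc_col S L a \<noteq> []"
  shows "hd (calc_col S L a) < hd L"
proof (cases L)
  case Nil
  with assms show ?thesis by simp
next
  case (Cons l ls)
  let ?C = "{n. 0 < n \<and> n < l \<and> (\<forall>x. a = Some x \<longrightarrow> n < x) \<and> n \<notin> S}"
  have ne: "?C \<noteq> {}"
    using assms Cons by (auto simp: Let_def split: if_splits)
  have "finite ?C"
    by (rule finite_subset[of _ "{..<l}"]) auto
  from Max_in[OF this ne] have "Max ?C < l" by simp
  moreover have "calc_col S L a = Max ?C # calc_col S ls (Some (Max ?C))"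
    using ne by (simp only: Cons calc_col.simps Let_def if_False)
  ultimately show ?thesis using Cons by simp
qed

function calc_cols :: "nat list \<Rightarrow> nat list list" where
  "calc_cols L = (if L = [] then [] else L # calc_cols (calc_col (set L) L None))"
  by auto
termination
  by (relation "measure (\<lambda>L. if L = [] then 0 else Suc (hd L))") (auto simp: hd_calc_col_less)

declare calc_cols.simps [simp del]

definition calc :: "nat list \<Rightarrow> nat list" where
  "calc \<mu> = conjugate (map length
     (calc_cols (rev (filter (\<lambda>t. odd (col t \<mu>)) [1..<Suc (width \<mu>)]))))"

section \<open>Weights\<close>

text \<open>The weight lattice with basis \<open>\<Lambda>\<^sub>0, \<Lambda>\<^sub>1, \<delta>\<close>: first component the coefficients of the
  fundamental weights, second component the coefficient of \<open>\<delta>\<close>.\<close>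

type_synonym weight = "(bit \<Rightarrow> int) \<times> int"

definition scale :: "int \<Rightarrow> weight \<Rightarrow> weight" where
  "scale k w = (\<lambda>i. k * fst w i, k * snd w)"

definition fund_weight :: "bit \<Rightarrow> weight" where
  "fund_weight i = (\<lambda>j. if j = i then 1 else 0, 0)"

definition null_root :: weight where
  "null_root = (\<lambda>_. 0, 1)"

definition simple_root :: "bit \<Rightarrow> weight" where
  "simple_root i =
     scale 2 (fund_weight i) - scale 2 (fund_weight (i + 1)) + (if i = 0 then null_root else 0)"

definition pair_coroot :: "weight \<Rightarrow> bit \<Rightarrow> int" where
  "pair_coroot w i = fst w i"

lemma null_root_eq: "null_root = simple_root 0 + simple_root 1"
  by (auto simp: null_root_def simple_root_def scale_def fund_weight_def fun_eq_iff prod_eq_iff)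

lemma pair_simple_root_same: "pair_coroot (simple_root i) i = 2"
  and pair_simple_root_other: "pair_coroot (simple_root (i + 1)) i = - 2"
  by (cases i; simp add: pair_coroot_def null_root_def simple_root_def scale_def fund_weight_def)+

definition dominant_weight :: "(bit \<Rightarrow> nat) \<Rightarrow> weight" where
  "dominant_weight t =
     scale (int (t 1)) (fund_weight 1) + scale (int (t 0)) (fund_weight 0)"

section \<open>Crystals\<close>

text \<open>The value 0 of a crystal operator is \<^const>\<open>None\<close>.\<close>

record 'b crystal =
  elems :: "'b set"
  wt :: "'b \<Rightarrow> weight"
  eps :: "bit \<Rightarrow> 'b \<Rightarrow> nat"
  phi :: "bit \<Rightarrow> 'b \<Rightarrow> int"
  e_op :: "bit \<Rightarrow> 'b \<Rightarrow> 'b option"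
  f_op :: "bit \<Rightarrow> 'b \<Rightarrow> 'b option"

definition crystal_iso :: "'b crystal \<Rightarrow> 'c crystal \<Rightarrow> ('b \<Rightarrow> 'c) \<Rightarrow> bool" where
  "crystal_iso B C F \<longleftrightarrow>
     bij_betw F (elems B) (elems C) \<and>
     (\<forall>b\<in>elems B. wt C (F b) = wt B b \<and>
       (\<forall>i. eps C i (F b) = eps B i b \<and>
            phi C i (F b) = phi B i b \<and>
            e_op C i (F b) = map_option F (e_op B i b) \<and>
            f_op C i (F b) = map_option F (f_op B i b)))"

definition mutually_inverse_on :: "'b set \<Rightarrow> 'c set \<Rightarrow> ('b \<Rightarrow> 'c) \<Rightarrow> ('c \<Rightarrow> 'b) \<Rightarrow> bool" where
  "mutually_inverse_on A B F G \<longleftrightarrow>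
     F ` A \<subseteq> B \<and> G ` B \<subseteq> A \<and> (\<forall>a\<in>A. G (F a) = a) \<and> (\<forall>b\<in>B. F (G b) = b)"

definition hw_elems :: "(bit \<Rightarrow> nat) \<Rightarrow> (bit \<Rightarrow> 'b \<Rightarrow> nat) \<Rightarrow> 'b crystal \<Rightarrow> 'b set" where
  "hw_elems t eps_star B = {b \<in> elems B. \<forall>i. eps_star i b \<le> t i}"

definition restrict_to :: "'b set \<Rightarrow> 'b option \<Rightarrow> 'b option" where
  "restrict_to S x = (case x of None \<Rightarrow> None | Some b \<Rightarrow> if b \<in> S then Some b else None)"

definition hw_crystal :: "(bit \<Rightarrow> nat) \<Rightarrow> (bit \<Rightarrow> 'b \<Rightarrow> nat) \<Rightarrow> 'b crystal \<Rightarrow> 'b crystal" where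
  "hw_crystal t eps_star B =
    \<lparr> elems = hw_elems t eps_star B,
      wt = (\<lambda>b. dominant_weight t + wt B b),
      eps = eps B,
      phi = (\<lambda>i b. phi B i b + int (t i)),
      e_op = (\<lambda>i b. restrict_to (hw_elems t eps_star B) (e_op B i b)),
      f_op = (\<lambda>i b. restrict_to (hw_elems t eps_star B) (f_op B i b)) \<rparr>"

section \<open>Affine MV polytopes\<close>

text \<open>The triple \<open>{\<pi>\<^sup>1, \<pi>\<^sup>\<delta>, \<pi>\<^sup>0}\<close> has \<open>\<pi>\<^sup>i = part \<pi> i\<close> and \<open>\<pi>\<^sup>\<delta> = delta_part \<pi>\<close>.\<close>

record root_partition =
  part :: "bit \<Rightarrow> nat list"
  delta_part :: "nat list"

definition real_root :: "bit \<Rightarrow> nat \<Rightarrow> weight" where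
  "real_root i k = scale (int k) (simple_root i) + scale (int k - 1) (simple_root (i + 1))"

text \<open>Each row of length \<open>k\<close> of \<open>\<pi>\<^sup>i\<close> contributes \<open>\<alpha>\<^bsub>i:k\<^esub>\<close>.\<close>

definition rp_content :: "root_partition \<Rightarrow> weight" where
  "rp_content \<pi> = sum_list (map (real_root 1) (part \<pi> 1))
     + scale (int (sum_list (delta_part \<pi>))) null_root
     + sum_list (map (real_root 0) (part \<pi> 0))"

definition root_partitions :: "weight \<Rightarrow> root_partition set" where
  "root_partitions \<theta> =
     {\<pi>. (\<forall>i. partition (part \<pi> i)) \<and> partition (delta_part \<pi>) \<and> rp_content \<pi> = \<theta>}"

definition c_up :: "root_partition \<Rightarrow> root_partition \<Rightarrow> nat \<Rightarrow> int" where
  "c_up \<pi> \<phi> m = (\<Sum>k=1..m. int k *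
     (int (rows_of_length (k + 1) (part \<phi> 0)) - int (rows_of_length k (part \<pi> 1))))"

definition c_right :: "root_partition \<Rightarrow> root_partition \<Rightarrow> nat \<Rightarrow> int" where
  "c_right \<pi> \<phi> m = (\<Sum>k=1..m. int k *
     (int (rows_of_length (k + 1) (part \<pi> 1)) - int (rows_of_length k (part \<phi> 0))))"

definition c_down :: "root_partition \<Rightarrow> root_partition \<Rightarrow> nat \<Rightarrow> int" where
  "c_down \<pi> \<phi> m = (\<Sum>k=1..m. int k *
     (int (rows_of_length (k + 1) (part \<pi> 0)) - int (rows_of_length k (part \<phi> 1))))"

definition c_left :: "root_partition \<Rightarrow> root_partition \<Rightarrow> nat \<Rightarrow> int" where
  "c_left \<pi> \<phi> m = (\<Sum>k=1..m. int k *
     (int (rows_of_length (k + 1) (part \<phi> 1)) - int (rows_of_length k (part \<pi> 0))))"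

definition mv_polytope :: "weight \<Rightarrow> root_partition \<Rightarrow> root_partition \<Rightarrow> bool" where
  "mv_polytope \<theta> \<pi> \<phi> \<longleftrightarrow>
     \<pi> \<in> root_partitions \<theta> \<and> \<phi> \<in> root_partitions \<theta> \<and>
     (\<forall>m\<ge>1. 0 \<in> {c_up \<pi> \<phi> m, c_right \<pi> \<phi> m} \<and> {c_up \<pi> \<phi> m, c_right \<pi> \<phi> m} \<subseteq> {..0} \<and>
             0 \<in> {c_down \<pi> \<phi> m, c_left \<pi> \<phi> m} \<and> {c_down \<pi> \<phi> m, c_left \<pi> \<phi> m} \<subseteq> {..0}) \<and>
     (case delta_part \<pi> of [] \<Rightarrow> 0 | d # _ \<Rightarrow> d) \<le> length (part \<pi> 1) + length (part \<phi> 0) \<and>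
     length (part \<pi> 1) + length (part \<phi> 0) = length (part \<pi> 0) + length (part \<phi> 1) \<and>
     (sum_list (delta_part \<pi>) = sum_list (delta_part \<phi>) \<longrightarrow> delta_part \<phi> = delta_part \<pi>) \<and>
     (sum_list (delta_part \<pi>) > sum_list (delta_part \<phi>) \<longrightarrow> delta_part \<phi> = tl (delta_part \<pi>)) \<and>
     (sum_list (delta_part \<pi>) < sum_list (delta_part \<phi>) \<longrightarrow>
        delta_part \<phi> = (length (part \<pi> 1) + length (part \<phi> 0)) # delta_part \<pi>)"

definition MV :: "(root_partition \<times> root_partition) set" where
  "MV = {(\<pi>, \<phi>). \<exists>\<theta>. mv_polytope \<theta> \<pi> \<phi>}"

definition lozenge :: "root_partition \<Rightarrow> root_partition" where
  "lozenge \<pi> = (THE \<phi>. (\<pi>, \<phi>) \<in> MV)"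

definition add_row1 :: "bit \<Rightarrow> root_partition \<Rightarrow> root_partition" where
  "add_row1 i \<pi> = \<pi>\<lparr>part := (part \<pi>)(i := part \<pi> i @ [1])\<rparr>"

definition del_row1 :: "bit \<Rightarrow> root_partition \<Rightarrow> root_partition" where
  "del_row1 i \<pi> = \<pi>\<lparr>part := (part \<pi>)(i := remove1 1 (part \<pi> i))\<rparr>"

definition mv_wt :: "root_partition \<times> root_partition \<Rightarrow> weight" where
  "mv_wt P = - rp_content (fst P)"

definition mv_eps :: "bit \<Rightarrow> root_partition \<times> root_partition \<Rightarrow> nat" where
  "mv_eps i P = (if i = 1 then rows_of_length 1 (part (snd P) 1)
                 else rows_of_length 1 (part (fst P) 0))"

definition mv_eps_star :: "bit \<Rightarrow> root_partition \<times> root_partition \<Rightarrow> nat" where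
  "mv_eps_star i P = (if i = 1 then rows_of_length 1 (part (fst P) 1)
                      else rows_of_length 1 (part (snd P) 0))"

definition mv_f ::
  "bit \<Rightarrow> root_partition \<times> root_partition \<Rightarrow> (root_partition \<times> root_partition) option" where
  "mv_f i P = Some
     (if i = 1 then (lozenge (add_row1 1 (snd P)), add_row1 1 (snd P))
      else (add_row1 0 (fst P), lozenge (add_row1 0 (fst P))))"

definition mv_e ::
  "bit \<Rightarrow> root_partition \<times> root_partition \<Rightarrow> (root_partition \<times> root_partition) option" where
  "mv_e i P =
     (if mv_eps i P = 0 then None
      else Some
       (if i = 1 then (lozenge (del_row1 1 (snd P)), del_row1 1 (snd P))
        else (del_row1 0 (fst P), lozenge (del_row1 0 (fst P)))))"

definition MV_crystal :: "(root_partition \<times> root_partition) crystal" where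
  "MV_crystal =
    \<lparr> elems = MV, wt = mv_wt, eps = mv_eps,
      phi = (\<lambda>i P. int (mv_eps i P) + pair_coroot (mv_wt P) i),
      e_op = mv_e, f_op = mv_f \<rparr>"

section \<open>Ledge diagrams\<close>

text \<open>A diagram is the list of its rows, top row first, each given by its length and its colour.
  As all rows start in the first column and rows are monochromatic, colours alternate down all
  columns iff consecutive rows have opposite colours.\<close>

type_synonym diagram = "(nat \<times> bit) list"

definition upper_ledge :: "diagram \<Rightarrow> bool" where
  "upper_ledge D \<longleftrightarrow>
     (\<forall>x\<in>set D. 0 < fst x) \<and> successively (\<lambda>x y. snd y = snd x + 1) D \<and>
     (D = [] \<or> (\<exists>t\<in>{1..length D}. sorted_wrt (<) (take t (map fst D)) \<and>
                                     sorted_wrt (\<ge>) (drop (t - 1) (map fst D))))"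

definition UL :: "diagram set" where
  "UL = {D. upper_ledge D}"

definition dg_content :: "diagram \<Rightarrow> weight" where
  "dg_content D = sum_list (map (\<lambda>(d, k). scale (int d) (simple_root k)) D)"

text \<open>The box \<open>(r, c)\<close> lies in the row \<open>D ! r\<close>, so rows are counted from 0, and in column \<open>c\<close>,
  counted from 1.  The following two lists run through the bottom and top boxes from right to
  left.\<close>

type_synonym box = "nat \<times> nat"

definition box_color :: "diagram \<Rightarrow> box \<Rightarrow> bit" where
  "box_color D b = snd (D ! fst b)"

definition bottom_boxes :: "diagram \<Rightarrow> box list" where
  "bottom_boxes D =
     [(r, c). c \<leftarrow> rev [1..<Suc (width (map fst D))], r \<leftarrow> [0..<length D],
              c \<le> fst (D ! r) \<and> \<not> (Suc r < length D \<and> c \<le> fst (D ! Suc r))]"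

definition top_boxes :: "diagram \<Rightarrow> box list" where
  "top_boxes D =
     [(r, c). c \<leftarrow> rev [1..<Suc (width (map fst D))], r \<leftarrow> [0..<length D],
              c \<le> fst (D ! r) \<and> \<not> (0 < r \<and> c \<le> fst (D ! (r - 1)))]"

text \<open>Arcs are drawn while reading the last argument; the stack \<open>us\<close> holds the boxes read so far
  that are still unarced, the most recently read one first.  An arc joins a box of colour
  \<open>i + 1\<close> to an earlier one of colour \<open>i\<close> exactly when the latter is on top of the stack, i.e. when
  all boxes between them are already arced.  As reading is from right to left, the result lists
  the unarced boxes from left to right.\<close>

fun draw_arcs :: "(box \<Rightarrow> bit) \<Rightarrow> bit \<Rightarrow> box list \<Rightarrow> box list \<Rightarrow> box list" where
  "draw_arcs k i us [] = us"
| "draw_arcs k i us (b # bs) =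
    (if us \<noteq> [] \<and> k (hd us) = i \<and> k b = i + 1 then draw_arcs k i (tl us) bs
     else draw_arcs k i (b # us) bs)"

definition unarced_bottom :: "bit \<Rightarrow> bit \<Rightarrow> diagram \<Rightarrow> box list" where
  "unarced_bottom i j D =
     filter (\<lambda>b. box_color D b = j) (draw_arcs (box_color D) i [] (bottom_boxes D))"

definition unarced_top :: "bit \<Rightarrow> bit \<Rightarrow> diagram \<Rightarrow> box list" where
  "unarced_top i j D =
     filter (\<lambda>b. box_color D b = j) (draw_arcs (box_color D) i [] (top_boxes D))"

definition ul_wt :: "diagram \<Rightarrow> weight" where
  "ul_wt D = - dg_content D"

definition ul_eps :: "bit \<Rightarrow> diagram \<Rightarrow> nat" where
  "ul_eps i D = length (unarced_bottom i i D)"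

definition ul_eps_star :: "bit \<Rightarrow> diagram \<Rightarrow> nat" where
  "ul_eps_star i D = length (unarced_top i i D)"

text \<open>Only used for the last box of a row; a row that becomes empty disappears.\<close>

definition delete_box :: "box \<Rightarrow> diagram \<Rightarrow> diagram" where
  "delete_box b D =
     filter (\<lambda>x. 0 < fst x) (D[fst b := (fst (D ! fst b) - 1, snd (D ! fst b))])"

text \<open>The box added below \<open>(r, c)\<close> becomes the last one of row \<open>Suc r\<close>, which is a new row if
  \<open>r\<close> is the bottom row.\<close>

definition add_below :: "bit \<Rightarrow> box \<Rightarrow> diagram \<Rightarrow> diagram" where
  "add_below i b D =
     (if Suc (fst b) < length D then D[Suc (fst b) := (snd b, i)] else D @ [(snd b, i)])"

definition uppermost_peak_row :: "bit \<Rightarrow> diagram \<Rightarrow> nat" where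
  "uppermost_peak_row i D =
     (LEAST r. r < length D \<and> snd (D ! r) = i \<and>
               (\<forall>s<length D. snd (D ! s) = i \<longrightarrow> fst (D ! s) \<le> fst (D ! r)))"

definition ul_e :: "bit \<Rightarrow> diagram \<Rightarrow> diagram option" where
  "ul_e i D =
     (let bs = unarced_bottom i i D in
      if bs = [] then None else Some (delete_box (last bs) D))"

definition ul_f :: "bit \<Rightarrow> diagram \<Rightarrow> diagram option" where
  "ul_f i D = Some
     (let bs = unarced_bottom i (i + 1) D; r = uppermost_peak_row i D in
      if bs \<noteq> [] then add_below i (hd bs) D
      else if D = [] then [(1, i)]
      else D[r := (Suc (fst (D ! r)), i)])"

definition UL_crystal :: "diagram crystal" where
  "UL_crystal =
    \<lparr> elems = UL, wt = ul_wt, eps = ul_eps,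
      phi = (\<lambda>i D. int (ul_eps i D) + pair_coroot (ul_wt D) i),
      e_op = ul_e, f_op = ul_f \<rparr>"

section \<open>The maps between MV polytopes and upper ledge diagrams\<close>

definition flip :: "diagram \<Rightarrow> diagram" where
  "flip D = rev D"

primrec color :: "bit \<Rightarrow> nat list \<Rightarrow> diagram" where
  "color i [] = []"
| "color i (d # ds) = (d, i) # color (i + 1) ds"

definition forget :: "diagram \<Rightarrow> nat list" where
  "forget D = map fst D"

text \<open>Once the columns of \<open>L\<close> have been shifted, each sits directly below the corresponding (possibly
  empty) column of \<open>M\<close>, so below \<open>U\<close> the column lengths of \<open>M\<close> and \<open>L\<close> add up.  Since the columns of
  \<open>M\<close> begin with colour \<open>i + 1\<close> and end with colour \<open>i\<close>, and \<open>L\<close> has a top row of colour \<open>i + 1\<close>, the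
  rows of this lower part alternate in colour, starting with \<open>i + 1\<close>.\<close>

definition stack :: "bit \<Rightarrow> diagram \<Rightarrow> diagram \<Rightarrow> diagram \<Rightarrow> diagram" where
  "stack i U M L = U @ color (i + 1)
     (conjugate (map (\<lambda>c. col c (forget M) + col c (forget L))
                     [1..<Suc (max (width (forget M)) (width (forget L)))]))"

definition trip_up :: "bit \<Rightarrow> diagram \<Rightarrow> diagram" where
  "trip_up i D =
     (case filter (\<lambda>b. box_color D b = i) (top_boxes D) of
        [] \<Rightarrow> []
      | (r, c) # _ \<Rightarrow> map (\<lambda>(d, k). (min d c, k)) (take (Suc r) D))"

text \<open>The number of highlighted boxes in successive columns, given the bottom colours of these
  columns, and the bottom colour and number of highlighted boxes of the preceding column.\<close>

primrec highlight :: "bit \<Rightarrow> nat \<Rightarrow> bit list \<Rightarrow> nat list" where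
  "highlight k n [] = []"
| "highlight k n (x # xs) =
    (let n' = (if x = k then n else Suc n) in n' # highlight x n' xs)"

text \<open>The highlighted column lengths from left to right, ending at the column of the rightmost
  \<open>i + 1\<close>-coloured bottom box.\<close>

definition highlighted :: "bit \<Rightarrow> diagram \<Rightarrow> nat list" where
  "highlighted i D = rev (highlight (i + 1) 1
     (map (box_color D) (dropWhile (\<lambda>b. box_color D b \<noteq> i + 1) (bottom_boxes D))))"

text \<open>The topmost highlighted box of every column has colour \<open>i + 1\<close>, as the number of highlighted
  boxes changes together with the bottom colour.\<close>

definition trip_down :: "bit \<Rightarrow> diagram \<Rightarrow> diagram" where
  "trip_down i D = color (i + 1) (conjugate (highlighted i D))"

text \<open>The remaining boxes keep their place, directly below those of \<open>trip_up i D\<close>, and their colour.\<close>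

definition trip_delta :: "bit \<Rightarrow> diagram \<Rightarrow> diagram" where
  "trip_delta i D =
     zip (conjugate (map (\<lambda>c. col c (forget D) - col c (forget (trip_up i D)) -
                              (if c \<le> length (highlighted i D) then highlighted i D ! (c - 1) else 0))
                         [1..<Suc (width (forget D))]))
         (map snd (drop (length (trip_up i D)) D))"

definition calX_at :: "bit \<Rightarrow> root_partition \<Rightarrow> diagram" where
  "calX_at i \<pi> = stack i (flip (color i (ord (part \<pi> i))))
                         (color (i + 1) (double (delta_part \<pi>)))
                         (color (i + 1) (ord (part \<pi> (i + 1))))"

definition calY_at :: "bit \<Rightarrow> diagram \<Rightarrow> root_partition" where
  "calY_at i D =
    \<lparr> part = (\<lambda>j. if j = i then calc (forget (flip (trip_up i D))) else calc (forget (trip_down i D))),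
      delta_part = halve (forget (trip_delta i D)) \<rparr>"

text \<open>On \<^const>\<open>MV\<close>, the diagram \<open>calX_at 1 \<pi>\<close> is also \<open>calX_at 0 \<phi>\<close>; this is part of the claim.\<close>

definition calX :: "root_partition \<times> root_partition \<Rightarrow> diagram" where
  "calX P = calX_at 1 (fst P)"

definition calY :: "diagram \<Rightarrow> root_partition \<times> root_partition" where
  "calY D = (calY_at 1 D, calY_at 0 D)"

definition MV_hw :: "(bit \<Rightarrow> nat) \<Rightarrow> (root_partition \<times> root_partition) crystal" where
  "MV_hw t = hw_crystal t mv_eps_star MV_crystal"

definition UL_hw :: "(bit \<Rightarrow> nat) \<Rightarrow> diagram crystal" where
  "UL_hw t = hw_crystal t ul_eps_star UL_crystal"

end

theory Submission
  imports Defs "HOL-Library.Multiset"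
begin

text \<open>Encode a finite set of positive integers as a 0-1 word.  Passing from one column of a spar tableau
  to the next one is one step of a box-ball system: a carrier walks through the word from right to
  left, picks up every ball and drops one at each empty place it meets while loaded
  (\<open>advance\<close>; \<open>load\<close> is the final load).  A partition is the record of the numbers of balls in
  successive steps of the evolution of its word, so its rows of length 1 are the balls that leave in
  the first step, that is, the unmatched balls in a bracket matching of the word.

  The colours of the top boxes of an upper ledge diagram \<open>\<X>\<^sub>i(\<pi>)\<close> spell the word of
  \<open>\<pi>\<^sup>i\<close>, and those of the bottom boxes spell the word of the other partition of \<open>\<pi>\<close>.  So the
  arc rules for \<open>\<epsilon>\<close>, \<open>e\<close>, \<open>f\<close> describe rows of length 1, and
  \<open>\<X>\<^sub>1(\<pi>) = \<X>\<^sub>0(\<phi>)\<close> amounts to complementary words for \<open>\<pi>\<^sup>1, \<phi>\<^sup>0\<close> and for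
  \<open>\<pi>\<^sup>0, \<phi>\<^sup>1\<close> of a common length \<open>N\<close>, the width of the diagram, together with a relation
  between the delta parts that depends on whether \<open>N\<close> lies in each of the sets.

  The first polytope condition says exactly that two words are complementary.  This is an induction on
  the word: prepending a letter changes the sequence of numbers of leaving balls only through
  the occupation of the new first box, and two such boxes with complementary letters stay in step.
  The content then determines the delta parts, since the size of a partition is the sum of the last
  places of the blocks of balls in its word.\<close>

section \<open>The box-ball evolution of finite words and its time reversal\<close>

section \<open>Words\<close>

text \<open>A diagram has two readings, one for each colour, and each operator is simple in one of
  them: if the part above the cut ends in colour i, then \<open>e\<close> and \<open>f\<close> of
  colour \<open>i + 1\<close> change a single letter of the bottom word. The two readings differ by
  one row of length N, the width, which lies at the cut: it is the last row of the upper part in one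
  reading and the first row of the lower part in the other. Moving it flips the parity of each of
  the N columns on both sides, which is why the words become complementary. In the lower part the
  extra box in each column either is a new row of length N of the 2-regular partition or, if N is a
  row length there already, combines with that row to a row of length N in delta. This is the origin
  of the case distinction for the delta parts. A partition determines its word only up to empty
  boxes at the right end, so N cannot be read off from one partition; it is the total number of rows
  of two mates. That every partition comes from a word is seen by running the evolution
  backward.\<close>

primrec load :: "nat \<Rightarrow> bool list \<Rightarrow> nat" where
  "load c [] = c"
| "load c (b # w) = (if b then Suc (load c w) else load c w - 1)"

primrec advance :: "nat \<Rightarrow> bool list \<Rightarrow> bool list" where
  "advance c [] = []"
| "advance c (b # w) = (\<not> b \<and> 0 < load c w) # advance c w"

lemma load_append: "load c (u @ v) = load (load c v) u"
  by (induction u) auto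

lemma advance_append: "advance c (u @ v) = advance (load c v) u @ advance c v"
  by (induction u) (auto simp: load_append)

lemma length_advance [simp]: "length (advance c w) = length w"
  by (induction w) auto

lemma count_advance: "count_list (advance c w) True + load c w = count_list w True + c"
  by (induction w) auto

text \<open>One step run backward: a carrier walks from left to right, starting with the balls that
  are to leave, and picks up and drops by the same rule. \<open>residue\<close> is its final
  load.\<close>

primrec retreat :: "nat \<Rightarrow> bool list \<Rightarrow> bool list" where
  "retreat c [] = []"
| "retreat c (b # w) = (\<not> b \<and> 0 < c) # retreat (if b then Suc c else c - 1) w"

primrec residue :: "nat \<Rightarrow> bool list \<Rightarrow> nat" where
  "residue c [] = c"
| "residue c (b # w) = residue (if b then Suc c else c - 1) w"

text \<open>The local rule is symmetric under exchanging old with new letter and incoming with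
  outgoing load, so the mirrored walk undoes a step; \<open>c\<close> becomes the number of balls
  that leave.\<close>

lemma load_advance_retreat:
  "load (residue c w) (retreat c w) = c \<and> advance (residue c w) (retreat c w) = w"
proof (induction w arbitrary: c)
  case (Cons b w)
  from Cons.IH[of "if b then Suc c else c - 1"] show ?case by auto
qed auto

text \<open>Empty boxes on the right absorb what is left of the load. Enough of them make the
  residue 0, the initial load of a step of the evolution.\<close>

lemma residue_replicate: "residue c (w @ replicate m False) = residue c w - m"
proof -
  have "residue c (replicate m False) = c - m" for c m
    by (induction m arbitrary: c) auto
  then show ?thesis
    by (induction w arbitrary: c) auto
qed

lemma load_0_replicate [simp]: "load 0 (replicate m False) = 0"
  and advance_0_replicate [simp]: "advance 0 (replicate m False) = replicate m False"
  by (induction m) auto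

lemma advance_replicate: "advance 0 (w @ replicate m False) = advance 0 w @ replicate m False"
  by (simp add: advance_append)

abbreviation "orbit w j \<equiv> (advance 0 ^^ j) w"

definition exits :: "bool list \<Rightarrow> nat \<Rightarrow> nat" where
  "exits w j = load 0 (orbit w j)"

lemma length_orbit [simp]: "length (orbit w j) = length w"
  by (induction j) auto

lemma orbit_append_replicate: "orbit (w @ replicate m False) j = orbit w j @ replicate m False"
  by (induction j) (auto simp: advance_replicate)

lemma count_orbit_Suc: "count_list (orbit w (Suc j)) True + exits w j = count_list (orbit w j) True"
  using count_advance[of 0 "orbit w j"] by (simp add: exits_def)

text \<open>Each step clears the rightmost place that may still be occupied: a ball there moves away
  to the left, and an empty place there meets an empty carrier.\<close>

lemma orbit_vanish: "orbit w (length w) = replicate (length w) False"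
proof -
  have "\<exists>u. length u = length w - j \<and> orbit w j = u @ replicate j False" if "j \<le> length w" for j
    using that
  proof (induction j)
    case (Suc j)
    then obtain u where u: "length u = length w - j" "orbit w j = u @ replicate j False" by auto
    with Suc.prems obtain u' b where "u = u' @ [b]" by (cases u rule: rev_cases) auto
    with u have "orbit w (Suc j) = advance (if b then 1 else 0) u' @ replicate (Suc j) False"
      by (simp add: advance_replicate advance_append)
    with u \<open>u = u' @ [b]\<close> show ?case
      by (intro exI[of _ "advance (if b then 1 else 0) u'"]) auto
  qed auto
  from this[of "length w"] show ?thesis by auto
qed

lemma orbit_vanish_ge:
  assumes "length w \<le> j"
  shows "orbit w j = replicate (length w) False"
proof -
  have "orbit w (length w + k) = replicate (length w) False" for k
  proof (induction k)
    case (Suc k)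
    then show ?case using advance_replicate[of "[]" "length w"] by simp
  qed (simp add: orbit_vanish)
  from this[of "j - length w"] assms show ?thesis by simp
qed

lemma count_replicate_False [simp]: "count_list (replicate m False) True = 0"
  by (induction m) auto

lemma exits_vanish: "length w \<le> j \<Longrightarrow> exits w j = 0"
  by (simp add: exits_def orbit_vanish_ge)

lemma exits_zero_imp:
  assumes "\<And>j. exits w j = 0"
  shows "w = replicate (length w) False"
proof -
  have "count_list (orbit w j) True = count_list w True" for j
    using count_orbit_Suc[where w = w] assms by (induction j) auto
  from this[of "length w"] have "True \<notin> set w"
    by (simp add: orbit_vanish count_list_0_iff)
  then show ?thesis
    by (metis (full_types) replicate_length_same)
qed

subsection \<open>Pairs of complementary words\<close>

text \<open>With \<open>x j\<close> and \<open>y j\<close> the numbers of rows of length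
  \<open>j + 1\<close>, these are the sums in the first condition on polytopes.\<close>

definition csum :: "(nat \<Rightarrow> nat) \<Rightarrow> (nat \<Rightarrow> nat) \<Rightarrow> nat \<Rightarrow> int" where
  "csum x y m = (\<Sum>j<m. int (Suc j) * (int (x (Suc j)) - int (y j)))"

definition balanced :: "(nat \<Rightarrow> nat) \<Rightarrow> (nat \<Rightarrow> nat) \<Rightarrow> bool" where
  "balanced x y \<longleftrightarrow> (\<forall>m. max (csum x y m) (csum y x m) = 0)"

lemma csum_0 [simp]: "csum x y 0 = 0"
  by (simp add: csum_def)

lemma csum_Suc: "csum x y (Suc m) = csum x y m + int (Suc m) * (int (x (Suc m)) - int (y m))"
  by (simp add: csum_def)

lemma balanced_le:
  assumes "balanced x y"
  shows "csum x y m \<le> 0" "csum y x m \<le> 0"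
    and "csum x y m < 0 \<Longrightarrow> csum y x m = 0" "csum y x m < 0 \<Longrightarrow> csum x y m = 0"
  using assms unfolding balanced_def by (smt (verit))+

lemma balancedI:
  assumes "\<And>m. csum x y m \<le> 0 \<and> csum y x m \<le> 0 \<and> (csum x y m = 0 \<or> csum y x m = 0)"
  shows "balanced x y"
  unfolding balanced_def using assms by (smt (verit))

lemma balanced_sym: "balanced x y \<longleftrightarrow> balanced y x"
  unfolding balanced_def by (simp add: max.commute)

section \<open>Two first boxes, forward in time: balance of the arriving balls passes to the leaving
  balls\<close>

text \<open>\<open>h j\<close> says whether the first box is occupied at time \<open>j\<close>; \<open>x j\<close> balls reach it from the
  right and \<open>a j\<close> balls leave it to the left.\<close>

locale first_box =
  fixes x a :: "nat \<Rightarrow> nat" and h :: "nat \<Rightarrow> bool"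
  assumes h_Suc: "h (Suc j) \<longleftrightarrow> \<not> h j \<and> 0 < x j"
    and a_eq: "a j = (if h j then Suc (x j) else x j - 1)"
begin

lemma a_int: "int (a j) = int (x j) + of_bool (h j) - of_bool (h (Suc j))"
  by (auto simp: a_eq h_Suc)

text \<open>The rule of a box is reversible: it keeps its form when time is reversed and
  \<open>a\<close> is exchanged with \<open>x\<close>. The backward arguments below rest on
  this.\<close>

lemma h_back: "h j \<longleftrightarrow> \<not> h (Suc j) \<and> 0 < a j"
  by (auto simp: a_eq h_Suc)

end

locale first_boxes = X: first_box x a h + Y: first_box y b k
  for x a h y b k
begin

text \<open>Compares the occupation of one box with that of the other box one step earlier, matching
  the shift of indices in \<open>csum\<close>.\<close>

definition drift :: "nat \<Rightarrow> int" where "drift j = of_bool (h (Suc j)) - of_bool (k j)"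
definition drift' :: "nat \<Rightarrow> int" where "drift' j = of_bool (k (Suc j)) - of_bool (h j)"

text \<open>Abel summation: by conservation of balls, \<open>a (Suc j) - b j\<close> exceeds
  \<open>x (Suc j) - y j\<close> by \<open>drift j - drift (Suc j)\<close>.\<close>

lemma csum_eq: "csum a b m = csum x y m + (\<Sum>j<m. drift j) - int m * drift m"
  by (induction m) (auto simp: csum_Suc X.a_int Y.a_int drift_def algebra_simps)

lemma csum_eq': "csum b a m = csum y x m + (\<Sum>j<m. drift' j) - int m * drift' m"
  by (induction m) (auto simp: csum_Suc X.a_int Y.a_int drift'_def algebra_simps)

end

sublocale first_boxes \<subseteq> swap: first_boxes y b k x a h
  by unfold_locales

context first_boxes
begin

text \<open>The first box is occupied and the second is empty; the vanishing sums record that the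
  occupations of the two boxes have alternated since time 0.\<close>

definition active :: "nat \<Rightarrow> bool" where
  "active j \<longleftrightarrow> h j \<and> \<not> k j \<and> (j > 0 \<longrightarrow> 0 < x (j - 1)) \<and> sum drift {..<j} = 0 \<and> sum drift' {..<j} = 0"

text \<open>A pause after the first box was occupied: the second one is the next to be filled, which
  accounts for the asymmetric sums.\<close>

definition idle :: "nat \<Rightarrow> bool" where
  "idle j \<longleftrightarrow> \<not> h j \<and> \<not> k j \<and> csum x y j = 0 \<and> x j = 0 \<and>
     sum drift {..<j} = 0 \<and> sum drift' {..<j} = - 1"

end

context first_boxes
begin

lemma swap_drift: "swap.drift = drift'" "swap.drift' = drift"
  by (auto simp: fun_eq_iff drift_def drift'_def swap.drift_def swap.drift'_def)

text \<open>The occupied box empties. Suppose that no ball arrives for the other one. For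
  \<open>j > 0\<close> the arrival that filled the box makes \<open>csum y x j\<close> negative, so
  \<open>csum x y j\<close> is 0 (at \<open>j = 0\<close> it is 0 anyway), and then
  \<open>csum x y (Suc j) \<le> 0\<close> forbids an arrival \<open>x (Suc j)\<close>. So the same
  box is not refilled before the other one.\<close>

lemma fwd_active:
  assumes bal: "balanced x y" and f: "active j"
  shows "idle (Suc j) \<or> swap.active (Suc j)"
proof (cases "y j = 0")
  case True
  have f': "h j" "\<not> k j" "j > 0 \<Longrightarrow> 0 < x (j - 1)" "sum drift {..<j} = 0" "sum drift' {..<j} = 0"
    using f by (simp_all add: active_def)
  have "csum x y j = 0"
  proof (cases j)
    case (Suc l)
    have "int (Suc l) * (int (y (Suc l)) - int (x l)) < 0"
      using f'(3) True Suc by (intro mult_pos_neg) auto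
    then have "csum y x j < 0"
      unfolding Suc csum_Suc[of y x l] by (intro add_nonpos_neg balanced_le(2)[OF bal])
    then show ?thesis by (rule balanced_le(4)[OF bal])
  qed auto
  moreover from this True have "csum x y (Suc j) = int (Suc j) * int (x (Suc j))"
    by (simp add: csum_Suc)
  moreover have "csum x y (Suc j) \<le> 0" by (rule balanced_le[OF bal])
  ultimately have "x (Suc j) = 0" "csum x y (Suc j) = 0"
    by (simp_all add: mult_le_0_iff)
  with f' True show ?thesis
    by (simp add: idle_def X.h_Suc Y.h_Suc drift_def drift'_def)
next
  case False
  with f show ?thesis
    by (simp add: active_def swap.active_def swap_drift X.h_Suc Y.h_Suc drift_def drift'_def)
qed

lemma fwd_idle:
  assumes bal: "balanced x y" and f: "idle j"
  shows "idle (Suc j) \<or> swap.active (Suc j)"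
proof (cases "y j = 0")
  case True
  then have "csum x y (Suc j) = int (Suc j) * int (x (Suc j))"
    using f by (simp add: csum_Suc idle_def)
  moreover have "csum x y (Suc j) \<le> 0" by (rule balanced_le[OF bal])
  ultimately have "x (Suc j) = 0" "csum x y (Suc j) = 0"
    by (simp_all add: mult_le_0_iff)
  with f True show ?thesis
    by (simp add: idle_def X.h_Suc Y.h_Suc drift_def drift'_def)
next
  case False
  with f show ?thesis
    by (simp add: idle_def swap.active_def swap_drift X.h_Suc Y.h_Suc drift_def drift'_def)
qed

text \<open>\<open>csum a b m\<close> equals \<open>csum x y m\<close>, while
  \<open>csum b a m\<close> may exceed \<open>csum y x m\<close> by \<open>m\<close>. This happens
  only when no ball arrives for the second box, and then the arrival that filled the first one has
  pushed \<open>csum y x m\<close> down to \<open>- m\<close> or lower.\<close>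

lemma active_csum:
  assumes bal: "balanced x y" and f: "active m"
  shows "csum a b m \<le> 0 \<and> csum b a m \<le> 0 \<and> (csum a b m = 0 \<or> csum b a m = 0)"
proof -
  note le = balanced_le[OF bal, of m]
  have f': "h m" "\<not> k m" "m > 0 \<Longrightarrow> 0 < x (m - 1)" "sum drift {..<m} = 0" "sum drift' {..<m} = 0"
    using f by (simp_all add: active_def)
  then have A: "csum a b m = csum x y m"
    by (simp add: csum_eq drift_def X.h_Suc)
  show ?thesis
  proof (cases "m = 0 \<or> y m > 0")
    case True
    then have "csum b a m = csum y x m"
      using f' by (auto simp: csum_eq' drift'_def Y.h_Suc)
    with A le show ?thesis by auto
  next
    case False
    then obtain l where l: "m = Suc l" by (cases m) auto
    have B: "csum b a m = csum y x m + int m"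
      using f' False by (simp add: csum_eq' drift'_def Y.h_Suc)
    have "1 \<le> int (x l)" using f' l by simp
    then have "int m * 1 \<le> int m * int (x l)"
      by (intro mult_left_mono) auto
    then have "csum y x m \<le> - int m"
      using csum_Suc[of y x l] balanced_le(2)[OF bal, of l] False l by (simp add: algebra_simps)
    with A B le l show ?thesis by auto
  qed
qed

lemma idle_csum:
  assumes bal: "balanced x y" and f: "idle m"
  shows "csum a b m \<le> 0 \<and> csum b a m \<le> 0 \<and> (csum a b m = 0 \<or> csum b a m = 0)"
proof -
  have "csum a b m = 0"
    using f by (simp add: csum_eq drift_def X.h_Suc idle_def)
  moreover have "csum b a m \<le> 0"
    using f balanced_le[OF bal, of m] by (simp add: csum_eq' drift'_def Y.h_Suc idle_def)
  ultimately show ?thesis by auto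
qed

end

context first_boxes
begin

text \<open>At all times either exactly one box is occupied, or both are empty and it is known which
  of them is to be filled next.\<close>

lemma balanced_fwd:
  assumes bal: "balanced x y" and 0: "h 0 \<noteq> k 0"
  shows "balanced a b"
proof -
  have bal': "balanced y x" using bal by (simp add: balanced_sym)
  have "active j \<or> idle j \<or> swap.active j \<or> swap.idle j" for j
  proof (induction j)
    case 0
    then show ?case using assms(2) by (auto simp: active_def swap.active_def)
  next
    case (Suc j)
    then show ?case
      using fwd_active[OF bal] fwd_idle[OF bal] swap.fwd_active[OF bal'] swap.fwd_idle[OF bal']
      by blast
  qed
  then show ?thesis
    using active_csum[OF bal] idle_csum[OF bal] swap.active_csum[OF bal'] swap.idle_csum[OF bal']
    by (intro balancedI) blast
qed

section \<open>Two first boxes, backward in time: from the leaving balls to the occupations and the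
  arriving balls\<close>

definition vacant :: "nat \<Rightarrow> bool" where
  "vacant j \<longleftrightarrow> (\<forall>i\<ge>j. a i = 0 \<and> b i = 0 \<and> \<not> h i \<and> \<not> k i)"

definition filled :: "nat \<Rightarrow> bool" where
  "filled j \<longleftrightarrow> h j \<and> \<not> k j"

text \<open>Both boxes are empty and the first one is to be filled next. The past being unknown, a
  sign of \<open>csum\<close> takes the place of the drift sums of \<open>idle\<close>;
  \<open>\<not> vacant j\<close> separates a pause from the final rest.\<close>

definition pausing :: "nat \<Rightarrow> bool" where
  "pausing j \<longleftrightarrow> \<not> h j \<and> \<not> k j \<and> csum a b j < 0 \<and> csum b a j = 0 \<and> b j = 0 \<and> \<not> vacant j"

end

context first_boxes
begin

text \<open>Balls leaving both boxes just before the rest would make both sums negative at the next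
  time, so at most one box was occupied.\<close>

lemma bwd_vacant:
  assumes bal: "balanced a b" and v: "vacant (Suc j)"
  shows "vacant j \<or> filled j \<or> swap.filled j"
proof -
  have v': "a (Suc j) = 0" "b (Suc j) = 0" "\<not> h (Suc j)" "\<not> k (Suc j)"
    using v by (auto simp: vacant_def)
  have "\<not> (0 < a j \<and> 0 < b j)"
  proof
    assume pos: "0 < a j \<and> 0 < b j"
    have "csum a b (Suc j) = csum a b j - int (Suc j) * int (b j)"
      "csum b a (Suc j) = csum b a j - int (Suc j) * int (a j)"
      by (simp_all add: csum_Suc v' algebra_simps)
    moreover have "0 < int (Suc j) * int (b j)" "0 < int (Suc j) * int (a j)"
      using pos by (simp_all add: zero_less_mult_iff)
    ultimately have "csum a b (Suc j) < 0" "csum b a (Suc j) < 0"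
      using balanced_le(1,2)[OF bal, of j] by linarith+
    then show False using balanced_le(3)[OF bal] by simp
  qed
  moreover have "vacant j" if "a j = 0" "b j = 0"
    unfolding vacant_def
  proof (intro allI impI)
    fix i assume "j \<le> i"
    with v that show "a i = 0 \<and> b i = 0 \<and> \<not> h i \<and> \<not> k i"
      by (cases "i = j") (auto simp: vacant_def X.h_back[of j] Y.h_back[of j])
  qed
  ultimately show ?thesis
    using v' X.h_back[of j] Y.h_back[of j] by (auto simp: filled_def swap.filled_def)
qed

text \<open>A box occupied at time \<open>Suc j\<close> lets balls out then. If nothing left the
  other box at time \<open>j\<close>, this term is positive, so \<open>csum a b j\<close> is
  negative and balance makes \<open>csum b a j\<close> vanish: a pause.\<close>

lemma bwd_filled:
  assumes bal: "balanced a b" and f: "filled (Suc j)"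
  shows "swap.filled j \<or> pausing j"
proof (cases "b j = 0")
  case True
  have "0 < a (Suc j)" using f X.h_back[of "Suc j"] by (auto simp: filled_def)
  then have "0 < int (Suc j) * (int (a (Suc j)) - int (b j))"
    using True by (intro mult_pos_pos) auto
  then have "csum a b j < 0"
    using csum_Suc[of a b j] balanced_le(1)[OF bal, of "Suc j"] by (simp del: of_nat_Suc)
  moreover have "\<not> vacant j"
    using f unfolding filled_def vacant_def by (meson le_SucI order_refl)
  ultimately show ?thesis
    using True f balanced_le(3)[OF bal, of j] X.h_back[of j] Y.h_back[of j]
    unfolding filled_def pausing_def by simp
next
  case False
  with f show ?thesis
    using X.h_back[of j] Y.h_back[of j] by (auto simp: filled_def swap.filled_def)
qed

text \<open>\<open>csum b a (Suc j) = 0\<close> and \<open>b (Suc j) = 0\<close> leave no room for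
  \<open>a j > 0\<close>, so the first box was empty at time \<open>j\<close> as well.\<close>

lemma bwd_pausing:
  assumes bal: "balanced a b" and f: "pausing (Suc j)"
  shows "swap.filled j \<or> pausing j"
proof -
  have f': "csum a b (Suc j) < 0" "csum b a (Suc j) = 0" "b (Suc j) = 0" "\<not> h (Suc j)" "\<not> k (Suc j)"
    using f by (auto simp: pausing_def)
  have "csum b a j = int (Suc j) * int (a j)"
    using f'(2,3) by (simp add: csum_Suc)
  with balanced_le(2)[OF bal, of j] have "a j = 0" "csum b a j = 0"
    by (simp_all add: mult_le_0_iff)
  moreover have "csum a b j < 0" if "b j = 0"
  proof -
    have "0 \<le> int (Suc j) * int (a (Suc j))" by simp
    moreover have "csum a b (Suc j) = csum a b j + int (Suc j) * int (a (Suc j))"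
      using that by (simp add: csum_Suc)
    ultimately show ?thesis using f'(1) by linarith
  qed
  moreover have "\<not> vacant j"
    using f unfolding pausing_def vacant_def by (meson Suc_leD)
  ultimately show ?thesis
    using f' X.h_back[of j] Y.h_back[of j] unfolding swap.filled_def pausing_def by auto
qed

definition stage :: "nat \<Rightarrow> bool" where
  "stage j \<longleftrightarrow> vacant j \<or> filled j \<or> swap.filled j \<or> pausing j \<or> swap.pausing j"

end

context first_boxes
begin

lemma bwd_stage:
  assumes bal: "balanced a b" and K: "\<forall>j\<ge>K. a j = 0 \<and> b j = 0"
  shows "stage j"
proof -
  have K': "stage i" if "K \<le> i" for i
  proof -
    have "a l = 0 \<and> b l = 0 \<and> \<not> h l \<and> \<not> k l" if "i \<le> l" for l
      using K \<open>K \<le> i\<close> that X.h_back[of l] Y.h_back[of l] by auto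
    then show ?thesis by (simp add: stage_def vacant_def)
  qed
  show ?thesis
  proof (cases "K \<le> j")
    case True
    then show ?thesis by (rule K')
  next
  case False
  then have "j \<le> K" by simp
  then show ?thesis
  proof (induction j rule: inc_induct)
    case base
    show ?case by (rule K') simp
  next
    case (step j)
    have bal': "balanced b a" using bal by (simp add: balanced_sym)
    from step.IH show ?case
      using bwd_vacant[OF bal] bwd_filled[OF bal] bwd_pausing[OF bal]
        swap.bwd_filled[OF bal'] swap.bwd_pausing[OF bal']
      unfolding stage_def by blast
  qed
  qed
qed

text \<open>A pause requires a negative \<open>csum\<close>, which is impossible at time 0.\<close>

lemma stage_0: "stage 0 \<Longrightarrow> h 0 \<noteq> k 0 \<or> (\<forall>j. a j = 0 \<and> b j = 0 \<and> \<not> h j \<and> \<not> k j)"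
  unfolding stage_def vacant_def filled_def swap.filled_def pausing_def swap.pausing_def by auto

text \<open>A stage together with its history since time 0 in the form of drift sums, which is what
  solving \<open>csum_eq\<close> for \<open>x\<close> and \<open>y\<close> requires. In the third
  case the first box was the last one to be occupied.\<close>

definition settled :: "nat \<Rightarrow> bool" where
  "settled j \<longleftrightarrow> (filled j \<and> sum drift {..<j} = 0 \<and> sum drift' {..<j} = 0) \<or>
     (pausing j \<and> sum drift {..<j} = - 1 \<and> sum drift' {..<j} = 0) \<or>
     (vacant j \<and> csum a b j = 0 \<and> csum b a j < 0 \<and> sum drift {..<j} = 0 \<and> sum drift' {..<j} = - 1)"

end

context first_boxes
begin

lemma filled_Suc:
  assumes bal: "balanced a b" and f: "filled j" and st: "stage (Suc j)"
  shows "swap.filled (Suc j) \<or> swap.pausing (Suc j) \<or>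
    vacant (Suc j) \<and> csum b a (Suc j) < 0 \<and> csum a b (Suc j) = 0"
proof -
  have a: "0 < a j" "\<not> h (Suc j)" using f X.h_back[of j] by (auto simp: filled_def)
  then have b: "\<not> filled (Suc j)" by (auto simp: filled_def)
  have "\<not> pausing (Suc j)"
    using bwd_pausing[OF bal, of j] f unfolding filled_def swap.filled_def pausing_def by blast
  moreover have "csum b a (Suc j) < 0" if "b (Suc j) = 0"
    unfolding csum_Suc that by (intro add_nonpos_neg balanced_le[OF bal] mult_pos_neg) (use a in auto)
  ultimately show ?thesis
    using st b balanced_le(4)[OF bal, of "Suc j"] unfolding stage_def
    by (metis vacant_def order_refl)
qed

lemma pausing_Suc:
  assumes bal: "balanced a b" and f: "pausing j" and st: "stage (Suc j)"
  shows "filled (Suc j) \<or> pausing (Suc j)"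
proof -
  have bal': "balanced b a" using bal by (simp add: balanced_sym)
  have f': "\<not> h j" "\<not> k j" "csum a b j < 0" "csum b a j = 0" "b j = 0"
    using f by (auto simp: pausing_def)
  have "\<not> filled j" "\<not> swap.pausing j"
    using f' by (simp_all add: filled_def swap.pausing_def)
  then have "\<not> swap.filled (Suc j)" "\<not> swap.pausing (Suc j)"
    using swap.bwd_filled[OF bal', of j] swap.bwd_pausing[OF bal', of j] by blast+
  moreover have "\<not> vacant (Suc j)"
  proof
    assume v: "vacant (Suc j)"
    then have "a j = 0" using f' X.h_back[of j] by (auto simp: vacant_def)
    with v f' have "vacant j"
      unfolding vacant_def by (metis le_antisym not_less_eq_eq)
    with f show False by (simp add: pausing_def)
  qed
  ultimately show ?thesis using st unfolding stage_def by blast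
qed

end

context first_boxes
begin

lemma settled_filled:
  assumes bal: "balanced a b" and f: "filled j" "sum drift {..<j} = 0" "sum drift' {..<j} = 0"
    and st: "stage (Suc j)"
  shows "settled (Suc j) \<or> swap.settled (Suc j)"
proof -
  have s: "h j" "\<not> k j" "\<not> h (Suc j)" using f X.h_Suc[of j] by (auto simp: filled_def)
  have k': "k (Suc j)" if "swap.filled (Suc j)"
    using that by (simp add: swap.filled_def)
  have k'': "\<not> k (Suc j)" if "swap.pausing (Suc j) \<or> vacant (Suc j)"
    using that by (auto simp: swap.pausing_def vacant_def)
  have "sum drift {..<Suc j} = 0" "sum drift' {..<Suc j} = of_bool (k (Suc j)) - 1"
    using f s by (simp_all add: drift_def drift'_def)
  with filled_Suc[OF bal f(1) st] k' k'' show ?thesis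
    unfolding settled_def swap.settled_def swap_drift by auto
qed

lemma settled_pausing:
  assumes bal: "balanced a b" and f: "pausing j" "sum drift {..<j} = - 1" "sum drift' {..<j} = 0"
    and st: "stage (Suc j)"
  shows "settled (Suc j)"
proof -
  have s: "\<not> h j" "\<not> k j" using f by (auto simp: pausing_def)
  have "\<not> k (Suc j)" "h (Suc j) \<longleftrightarrow> filled (Suc j)" "filled (Suc j) \<or> pausing (Suc j)"
    using pausing_Suc[OF bal f(1) st] by (auto simp: filled_def pausing_def)
  moreover have "sum drift {..<Suc j} = of_bool (h (Suc j)) - 1" "sum drift' {..<Suc j} = of_bool (k (Suc j))"
    using f s by (simp_all add: drift_def drift'_def)
  ultimately show ?thesis
    unfolding settled_def by (auto simp: pausing_def)
qed

lemma settled_vacant: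
  assumes f: "vacant j" "csum a b j = 0" "csum b a j < 0" "sum drift {..<j} = 0" "sum drift' {..<j} = - 1"
  shows "settled (Suc j)"
proof -
  have s: "\<not> h j" "\<not> k j" "\<not> h (Suc j)" "\<not> k (Suc j)" "vacant (Suc j)"
    "a j = 0" "b j = 0" "a (Suc j) = 0" "b (Suc j) = 0"
    using f(1) by (auto simp: vacant_def)
  with f show ?thesis
    unfolding settled_def by (simp add: csum_Suc drift_def drift'_def)
qed

lemma settled_Suc:
  assumes bal: "balanced a b" and "settled j" and st: "stage (Suc j)"
  shows "settled (Suc j) \<or> swap.settled (Suc j)"
  using assms(2) settled_filled[OF bal _ _ _ st] settled_pausing[OF bal _ _ _ st] settled_vacant[of j]
  unfolding settled_def[of j] by blast

text \<open>Passing from the leaving to the arriving balls raises a sum only in a pause or at rest.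
  A rise by 1 is harmless because the sum was a negative integer. A rise by \<open>Suc m\<close>
  occurs if the first box is filled next; the ball that leaves it at time \<open>Suc m\<close> then
  forces \<open>csum a b m\<close> to be at most \<open>- Suc m\<close>.\<close>

lemma settled_csum:
  assumes bal: "balanced a b" and st: "settled m" and st': "stage (Suc m)"
  shows "csum x y m \<le> 0 \<and> csum y x m \<le> 0 \<and> (csum x y m = 0 \<or> csum y x m = 0)"
proof -
  note le = balanced_le[OF bal, of m]
  consider "filled m" "sum drift {..<m} = 0" "sum drift' {..<m} = 0"
    | "pausing m" "sum drift {..<m} = - 1" "sum drift' {..<m} = 0"
    | "vacant m" "csum a b m = 0" "csum b a m < 0" "sum drift {..<m} = 0" "sum drift' {..<m} = - 1"
    using st unfolding settled_def by blast
  then show ?thesis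
  proof cases
    case 1
    have s: "h m" "\<not> k m" "\<not> h (Suc m)" using 1(1) X.h_Suc[of m] by (auto simp: filled_def)
    have xy: "csum x y m = csum a b m"
      using 1 s csum_eq[of m] by (simp add: drift_def)
    show ?thesis
    proof (cases "k (Suc m)")
      case True
      then have "csum y x m = csum b a m"
        using 1 s csum_eq'[of m] by (simp add: drift'_def)
      with xy le show ?thesis by auto
    next
      case False
      then have yx: "csum y x m = csum b a m - int m"
        using 1 s csum_eq'[of m] by (simp add: drift'_def)
      have z: "csum a b (Suc m) = 0" "a (Suc m) = 0"
        using filled_Suc[OF bal 1(1) st'] False
        by (auto simp: swap.filled_def swap.pausing_def vacant_def)
      have "csum a b m = int (Suc m) * int (b m)"
        using csum_Suc[of a b m] z by (simp add: algebra_simps)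
      then have "0 \<le> csum a b m" by simp
      with xy yx le show ?thesis by auto
    qed
  next
    case 2
    have s: "\<not> h m" "\<not> k m" "csum a b m < 0" "csum b a m = 0" "b m = 0" "\<not> k (Suc m)"
      using 2(1) pausing_Suc[OF bal 2(1) st'] by (auto simp: pausing_def filled_def)
    have yx: "csum y x m = 0"
      using 2 s csum_eq'[of m] by (simp add: drift'_def)
    have xy: "csum x y m = csum a b m + 1 + int m * of_bool (h (Suc m))"
      using 2 s csum_eq[of m] by (simp add: drift_def)
    have "csum x y m \<le> 0"
    proof (cases "h (Suc m)")
      case True
      then have "0 < a (Suc m)" using X.h_back[of "Suc m"] by simp
      define p where "p = int (Suc m) * int (a (Suc m))"
      have "int (Suc m) * 1 \<le> p"
        unfolding p_def using \<open>0 < a (Suc m)\<close> by (intro mult_left_mono) auto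
      moreover have "csum a b (Suc m) = csum a b m + p"
        using s by (simp add: csum_Suc p_def)
      moreover have "csum x y m = csum a b m + int (Suc m)"
        using xy True by simp
      ultimately show ?thesis using balanced_le(1)[OF bal, of "Suc m"] by simp
    qed (use xy s in simp)
    with yx show ?thesis by auto
  next
    case 3
    have s: "\<not> h m" "\<not> k m" "\<not> h (Suc m)" "\<not> k (Suc m)"
      using 3(1) by (auto simp: vacant_def)
    with 3 have "csum x y m = 0" "csum y x m \<le> 0"
      using csum_eq[of m] csum_eq'[of m] by (simp_all add: drift_def drift'_def)
    then show ?thesis by auto
  qed
qed

end

context first_boxes
begin

text \<open>The case of complete rest corresponds to a common tail of empty boxes at the end of two
  words.\<close>

lemma balanced_bwd:
  assumes bal: "balanced a b" and fin: "\<forall>j\<ge>K. a j = 0 \<and> b j = 0"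
  shows "(h 0 \<noteq> k 0 \<or> (\<forall>j. a j = 0 \<and> b j = 0 \<and> \<not> h j \<and> \<not> k j)) \<and> balanced x y"
proof -
  have bal': "balanced b a" using bal by (simp add: balanced_sym)
  have st: "stage j" for j by (rule bwd_stage[OF bal fin])
  have st': "swap.stage j" for j using fin by (intro swap.bwd_stage[OF bal', of K]) auto
  have "balanced x y" if ne: "h 0 \<noteq> k 0"
  proof -
    have "settled j \<or> swap.settled j" for j
    proof (induction j)
      case 0
      then show ?case using ne by (auto simp: settled_def swap.settled_def filled_def swap.filled_def)
    next
      case (Suc j)
      then show ?case
        using settled_Suc[OF bal _ st] swap.settled_Suc[OF bal' _ st'] by blast
    qed
    then show ?thesis
      using settled_csum[OF bal _ st] swap.settled_csum[OF bal' _ st'] by (intro balancedI) blast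
  qed
  moreover have "balanced x y" if z: "\<forall>j. a j = 0 \<and> b j = 0 \<and> \<not> h j \<and> \<not> k j"
  proof -
    have "x j = 0 \<and> y j = 0" for j
      using z X.h_Suc[of j] Y.h_Suc[of j] by auto
    then show ?thesis by (intro balancedI) (simp add: csum_def)
  qed
  ultimately show ?thesis using stage_0[OF st] by blast
qed

end

subsection \<open>Application to words\<close>

text \<open>The carrier comes from the right, so a letter put in front never influences the
  others.\<close>

lemma orbit_Cons:
  "orbit (c # w) j = (case orbit (c # w) j of [] \<Rightarrow> False | d # _ \<Rightarrow> d) # orbit w j"
  by (induction j) (auto split: list.splits)

lemma first_box_Cons:
  "first_box (exits w) (exits (c # w)) (\<lambda>j. case orbit (c # w) j of [] \<Rightarrow> False | d # _ \<Rightarrow> d)"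
proof
  fix j
  obtain d where d: "orbit (c # w) j = d # orbit w j" using orbit_Cons by metis
  then show "(case orbit (c # w) (Suc j) of [] \<Rightarrow> False | d # _ \<Rightarrow> d) =
      (\<not> (case orbit (c # w) j of [] \<Rightarrow> False | d # _ \<Rightarrow> d) \<and> 0 < exits w j)"
    "exits (c # w) j = (if (case orbit (c # w) j of [] \<Rightarrow> False | d # _ \<Rightarrow> d)
       then Suc (exits w j) else exits w j - 1)"
    by (auto simp: exits_def)
qed

lemma balanced_complement: "balanced (exits w) (exits (map Not w))"
proof (induction w)
  case Nil
  have "exits [] j = 0" for j by (rule exits_vanish) simp
  then show ?case by (intro balancedI) (simp add: csum_def)
next
  case (Cons c w)
  interpret first_boxes "exits w" "exits (c # w)" "\<lambda>j. case orbit (c # w) j of [] \<Rightarrow> False | d # _ \<Rightarrow> d"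
    "exits (map Not w)" "exits (map Not (c # w))"
    "\<lambda>j. case orbit (map Not (c # w)) j of [] \<Rightarrow> False | d # _ \<Rightarrow> d"
    using first_box_Cons[of w c] first_box_Cons[of "map Not w" "\<not> c"]
    by (auto simp: first_boxes_def)
  show ?case by (rule balanced_fwd[OF Cons.IH]) simp
qed

text \<open>First letters are peeled off: balance passes to the tails, and equal first letters are
  possible only if nothing ever leaves, that is, if both words consist of empty boxes.\<close>

lemma balanced_imp_complement:
  assumes "length w = length w'" "balanced (exits w) (exits w')"
  obtains u m where "w = u @ replicate m False" "w' = map Not u @ replicate m False"
proof -
  have "\<exists>u m. w = u @ replicate m False \<and> w' = map Not u @ replicate m False"
    using assms
  proof (induction w w' rule: list_induct2)
    case Nil
    then show ?case by auto
  next
    case (Cons c w c' w')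
    interpret first_boxes "exits w" "exits (c # w)" "\<lambda>j. case orbit (c # w) j of [] \<Rightarrow> False | d # _ \<Rightarrow> d"
      "exits w'" "exits (c' # w')"
      "\<lambda>j. case orbit (c' # w') j of [] \<Rightarrow> False | d # _ \<Rightarrow> d"
      using first_box_Cons[of w c] first_box_Cons[of w' c'] by (auto simp: first_boxes_def)
    have fin: "\<forall>j\<ge>Suc (length w). exits (c # w) j = 0 \<and> exits (c' # w') j = 0"
      using Cons.hyps by (auto intro!: exits_vanish)
    note * = balanced_bwd[OF Cons.prems fin]
    show ?case
    proof (cases "c = c'")
      case True
      then have z: "\<And>j. exits (c # w) j = 0" "\<And>j. exits (c' # w') j = 0" using * by auto
      then have "c # w = replicate (Suc (length w)) False" "c' # w' = replicate (Suc (length w)) False"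
        using exits_zero_imp[of "c # w"] exits_zero_imp[of "c' # w'"] Cons.hyps by auto
      then show ?thesis by (intro exI[of _ "[]"] exI[of _ "Suc (length w)"]) simp
    next
      case False
      from Cons.IH * obtain u m where "w = u @ replicate m False" "w' = map Not u @ replicate m False"
        by blast
      with False show ?thesis by (intro exI[of _ "c # u"] exI[of _ m]) auto
    qed
  qed
  then show ?thesis using that by blast
qed

section \<open>Dictionary between words, partitions and 2-regular partitions\<close>

section \<open>Partitions and words\<close>

subsection \<open>Columns and conjugates\<close>

lemma col_Nil [simp]: "col t [] = 0"
  and col_Cons: "col t (d # ds) = of_bool (t \<le> d) + col t ds"
  and col_append: "col t (xs @ ys) = col t xs + col t ys"
  and col_rev: "col t (rev xs) = col t xs"
  by (simp_all add: col_def rev_filter[symmetric])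

lemma col_Suc: "col t ds = col (Suc t) ds + count_list ds t"
  by (induction ds) (auto simp: col_Cons)

lemma col_antimono: "s \<le> t \<Longrightarrow> col t ds \<le> col s ds"
  by (induction ds) (auto simp: col_Cons)

lemma col_le_length: "col t ds \<le> length ds"
  by (simp add: col_def)

lemma le_width: "d \<in> set ds \<Longrightarrow> d \<le> width ds"
  unfolding width_def by simp

lemma width_le: "width ds \<le> n \<longleftrightarrow> (\<forall>d\<in>set ds. d \<le> n)"
  unfolding width_def by auto

lemma col_eq_0: "width ds < t \<Longrightarrow> col t ds = 0"
  using le_width[of _ ds] by (fastforce simp: col_def filter_empty_conv)

lemma col_pos_iff: "1 \<le> t \<Longrightarrow> 0 < col t ds \<longleftrightarrow> t \<le> width ds"
proof
  assume "1 \<le> t" "t \<le> width ds"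
  moreover have "width ds \<in> insert 0 (set ds)"
    unfolding width_def by (rule Max_in) auto
  ultimately show "0 < col t ds" by (auto simp: col_def filter_empty_conv)
qed (use col_eq_0[of ds t] in \<open>cases "t \<le> width ds"; simp\<close>)

lemma width_eqI: "(\<And>t. 1 \<le> t \<Longrightarrow> 0 < col t ds \<longleftrightarrow> t \<le> n) \<Longrightarrow> width ds = n"
  using col_pos_iff[of "width ds" ds] col_pos_iff[of n ds]
  by (metis One_nat_def Suc_leI le_antisym le_refl neq0_conv zero_le)

lemma width_Nil [simp]: "width [] = 0"
  by (simp add: width_def)

lemma partition_Nil [simp]: "partition []"
  by (simp add: partition_def)

lemma partition_Cons: "partition (d # ds) \<longleftrightarrow> 0 < d \<and> width ds \<le> d \<and> partition ds"
  by (auto simp: partition_def width_le)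

lemma partition_width: "partition (d # ds) \<Longrightarrow> width (d # ds) = d"
  by (intro antisym) (auto simp: partition_Cons width_le intro: le_width)

lemma length_eq_col: "partition ds \<Longrightarrow> length ds = col 1 ds"
  by (induction ds) (auto simp: partition_Cons col_Cons)

lemma partition_eqI:
  assumes "partition \<kappa>" "partition \<mu>" "\<And>t. 1 \<le> t \<Longrightarrow> col t \<kappa> = col t \<mu>"
  shows "\<kappa> = \<mu>"
proof -
  have "count_list \<kappa> t = count_list \<mu> t" for t
  proof (cases "t = 0")
    case True
    with assms(1,2) show ?thesis by (simp add: partition_def count_list_0_iff)
  next
    case False
    then show ?thesis using col_Suc[of t \<kappa>] col_Suc[of t \<mu>] assms(3)[of t] assms(3)[of "Suc t"] by simp
  qed
  then have "mset (rev \<kappa>) = mset (rev \<mu>)"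
    by (intro multiset_eqI) (simp add: count_mset count_list_eq_length_filter)
  moreover have "sorted (rev \<kappa>)" "sorted (rev \<mu>)"
    using assms(1,2) by (simp_all add: partition_def sorted_wrt_rev)
  ultimately show ?thesis
    using properties_for_sort[of "rev \<kappa>" "rev \<mu>"] sorted_sort_id[of "rev \<mu>"] by auto
qed

text \<open>In a weakly decreasing list the entries that are at least \<open>s\<close> form an
  initial segment, whose length is \<open>col s hs\<close>.\<close>

lemma nth_ge_iff_col:
  assumes "sorted_wrt (\<ge>) hs" "i < length hs"
  shows "s \<le> hs ! i \<longleftrightarrow> i < col s hs"
  using assms
proof (induction hs arbitrary: i)
  case (Cons h hs)
  have "col s hs = 0" if "\<not> s \<le> h"
    using Cons.prems that by (auto simp: col_def filter_empty_conv)
  with Cons show ?case by (cases "s \<le> h"; cases i) (auto simp: col_Cons)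
qed simp

lemma partition_conjugate: "partition (conjugate hs)"
proof -
  have "0 < col t hs" if "1 \<le> t" "t \<le> width hs" for t
    using that by (simp add: col_pos_iff)
  then show ?thesis
    unfolding partition_def conjugate_def
    by (fastforce simp: col_antimono sorted_wrt_iff_nth_less less_Suc_eq_le simp del: upt_Suc)
qed

lemma col_conjugate:
  assumes "sorted_wrt (\<ge>) hs"
  shows "col (Suc i) (conjugate hs) = (if i < length hs then hs ! i else 0)"
proof -
  have c: "col (Suc i) (conjugate hs) = length (filter (\<lambda>s. i < col s hs) [1..<Suc (width hs)])"
    by (simp add: col_def conjugate_def filter_map comp_def Suc_le_eq)
  show ?thesis
  proof (cases "i < length hs")
    case True
    have "filter (\<lambda>s. i < col s hs) [1..<Suc (width hs)] = filter (\<lambda>s. s \<le> hs ! i) [1..<Suc (width hs)]"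
      using nth_ge_iff_col[OF assms True] by simp
    moreover have "set (filter (\<lambda>s. s \<le> hs ! i) [1..<Suc (width hs)]) = {1..hs ! i}"
      using le_width[of "hs ! i" hs] True by (auto simp: le_less_trans less_Suc_eq_le)
    ultimately show ?thesis
      using c True distinct_card[of "filter (\<lambda>s. s \<le> hs ! i) [1..<Suc (width hs)]"] by simp
  next
    case False
    then have "\<not> i < col s hs" for s
      using col_le_length[of s hs] by simp
    with c False show ?thesis by simp
  qed
qed

lemma col_conjugate_map:
  assumes "\<And>s t. 1 \<le> s \<Longrightarrow> s \<le> t \<Longrightarrow> t \<le> n \<Longrightarrow> f t \<le> f s" "1 \<le> t"
  shows "col t (conjugate (map f [1..<Suc n])) = (if t \<le> n then f t else 0)"
proof -
  have "sorted_wrt (\<ge>) (map f [1..<Suc n])"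
    using assms(1) by (auto simp: sorted_wrt_iff_nth_less simp del: upt_Suc)
  from col_conjugate[OF this, of "t - 1"] assms(2) show ?thesis by (auto simp del: upt_Suc)
qed

lemma conjugate_conjugate_map:
  "map g (conjugate ds) = map (\<lambda>t. g (col t ds)) [1..<Suc (width ds)]"
  by (simp add: conjugate_def)

lemma partition_double: "partition (double ds)"
  and partition_halve: "partition (halve ds)"
  by (simp_all add: double_def halve_def partition_conjugate)

lemma col_double: "1 \<le> t \<Longrightarrow> col t (double ds) = 2 * col t ds"
  unfolding double_def conjugate_conjugate_map
  by (subst col_conjugate_map) (auto simp: col_antimono col_eq_0)

lemma col_halve: "1 \<le> t \<Longrightarrow> col t (halve ds) = col t ds div 2"
  unfolding halve_def conjugate_conjugate_map
  by (subst col_conjugate_map) (auto simp: col_antimono div_le_mono col_eq_0)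

lemma halve_double: "partition ds \<Longrightarrow> halve (double ds) = ds"
  by (intro partition_eqI) (auto simp: partition_halve col_halve col_double)

lemma sum_list_col: "width ds \<le> n \<Longrightarrow> sum_list ds = (\<Sum>t=1..n. col t ds)"
proof (induction ds)
  case (Cons d ds)
  have "(\<Sum>t=1..n. of_bool (t \<le> d)) = (\<Sum>t\<in>{1..d}. 1 :: nat)"
    using Cons.prems by (intro sum.mono_neutral_cong_right) (auto simp: width_le)
  with Cons show ?case by (simp add: col_Cons sum.distrib width_le)
qed simp

subsection \<open>Places of a word\<close>

primrec places :: "nat \<Rightarrow> bool list \<Rightarrow> nat list" where
  "places n [] = []"
| "places n (b # w) = places (Suc n) w @ (if b then [n] else [])"

lemma places_append: "places n (u @ v) = places (n + length u) v @ places n u"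
  by (induction u arbitrary: n) auto

lemma length_places: "length (places n w) = count_list w True"
  by (induction w arbitrary: n) auto

lemma set_places: "set (places n w) = {n + i | i. i < length w \<and> w ! i}"
proof (induction w arbitrary: n)
  case (Cons b w)
  have "{n + i | i. i < length (b # w) \<and> (b # w) ! i} =
      (if b then {n} else {}) \<union> {Suc n + i | i. i < length w \<and> w ! i}"
    by (auto simp: less_Suc_eq_0_disj)
  with Cons show ?case by auto
qed auto

lemma mem_places_1: "t \<in> set (places 1 w) \<longleftrightarrow> 1 \<le> t \<and> t \<le> length w \<and> w ! (t - 1)"
  by (auto simp: set_places intro!: exI[of _ "t - 1"])

lemma places_bounds: "t \<in> set (places n w) \<Longrightarrow> n \<le> t \<and> t < n + length w"
  by (auto simp: set_places)

lemma sorted_places: "sorted_wrt (>) (places n w)"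
  by (induction w arbitrary: n) (auto simp: sorted_wrt_append dest!: places_bounds)

lemma partition_places: "1 \<le> n \<Longrightarrow> partition (places n w)"
proof -
  have "sorted_wrt (\<ge>) (places n w)"
    by (rule sorted_wrt_mono_rel[OF _ sorted_places]) auto
  then show "1 \<le> n \<Longrightarrow> partition (places n w)"
    by (auto simp: partition_def dest: places_bounds)
qed

lemma distinct_places: "distinct (places n w)"
proof -
  have "sorted_wrt (<) (rev (places n w))"
    using sorted_places[of n w] by (simp add: sorted_wrt_rev)
  then show ?thesis by (simp add: strict_sorted_iff)
qed

lemma places_replicate [simp]: "places n (replicate m False) = []"
  by (induction m arbitrary: n) auto

lemma places_map_upt: "n \<le> m \<Longrightarrow> places n (map P [n..<m]) = rev (filter P [n..<m])"
  by (induction m rule: dec_induct) (auto simp: places_append)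

subsection \<open>Words and 2-regular partitions\<close>

text \<open>Marks the places whose letter differs from the next one, an empty box being assumed
  after the end. When letters are column parities, these places are the row lengths of the 2-regular
  partition.\<close>

primrec edges :: "bool list \<Rightarrow> bool list" where
  "edges [] = []"
| "edges (b # w) = (b \<noteq> (w \<noteq> [] \<and> hd w)) # edges w"

lemma length_edges [simp]: "length (edges w) = length w"
  by (induction w) auto

lemma odd_col_edges: "odd (col (n + i) (places n (edges w))) \<longleftrightarrow> i < length w \<and> w ! i"
proof (induction w arbitrary: n i)
  case (Cons b w)
  have "filter (\<lambda>d. m \<le> d) (places (Suc n) (edges w)) = places (Suc n) (edges w)" if "m \<le> Suc n" for m
    using places_bounds[of _ "Suc n" "edges w"] that by (intro filter_True) force
  then have *: "col n (places (Suc n) (edges w)) = col (Suc n) (places (Suc n) (edges w))"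
    by (simp add: col_def)
  show ?case
  proof (cases i)
    case 0
    then show ?thesis using Cons.IH[of "Suc n" 0] * by (cases w) (auto simp: col_append col_Cons)
  next
    case (Suc j)
    then show ?thesis using Cons.IH[of "Suc n" j] by (auto simp: col_append col_Cons)
  qed
qed simp

definition strict_of :: "bool list \<Rightarrow> nat list" where
  "strict_of w = places 1 (edges w)"

definition odd_word :: "nat list \<Rightarrow> bool list" where
  "odd_word \<mu> = map (\<lambda>t. odd (col t \<mu>)) [1..<Suc (width \<mu>)]"

lemma partition_strict_of: "partition (strict_of w)"
  and distinct_strict_of: "distinct (strict_of w)"
  by (simp_all add: strict_of_def partition_places distinct_places)

lemma odd_col_strict_of: "1 \<le> t \<Longrightarrow> odd (col t (strict_of w)) \<longleftrightarrow> t \<le> length w \<and> w ! (t - 1)"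
  using odd_col_edges[of 1 "t - 1" w] by (auto simp: strict_of_def)

lemma count_list_distinct: "distinct xs \<Longrightarrow> count_list xs x = of_bool (x \<in> set xs)"
  by (induction xs) auto

text \<open>As no row length is repeated, \<open>t\<close> is a row length iff the columns
  \<open>t\<close> and \<open>t + 1\<close> have different parities.\<close>

lemma strict_eqI:
  assumes "partition \<kappa>" "distinct \<kappa>" "partition \<mu>" "distinct \<mu>"
    and "\<And>t. 1 \<le> t \<Longrightarrow> odd (col t \<kappa>) = odd (col t \<mu>)"
  shows "\<kappa> = \<mu>"
proof (rule partition_eqI)
  have m: "t \<in> set \<nu> \<longleftrightarrow> odd (col t \<nu>) \<noteq> odd (col (Suc t) \<nu>)" if "distinct \<nu>" for t \<nu>
    using col_Suc[of t \<nu>] count_list_distinct[OF that, of t] by auto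
  have "set \<kappa> = set \<mu>"
  proof (rule set_eqI)
    fix t
    show "t \<in> set \<kappa> \<longleftrightarrow> t \<in> set \<mu>"
    proof (cases "t = 0")
      case True
      with assms show ?thesis by (auto simp: partition_def)
    next
      case False
      with m[of \<kappa> t] m[of \<mu> t] assms(2,4) assms(5)[of t] assms(5)[of "Suc t"] show ?thesis by simp
    qed
  qed
  with assms(2,4) have "mset \<kappa> = mset \<mu>" by (simp add: set_eq_iff_mset_eq_distinct)
  then show "col t \<kappa> = col t \<mu>" for t
    unfolding col_def by (metis mset_filter size_mset)
qed (use assms in auto)

lemma strict_of_odd_word:
  assumes "partition \<mu>" "distinct \<mu>"
  shows "strict_of (odd_word \<mu>) = \<mu>"
proof (rule strict_eqI)
  fix t :: nat assume "1 \<le> t"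
  then show "odd (col t (strict_of (odd_word \<mu>))) = odd (col t \<mu>)"
    by (cases "t \<le> width \<mu>") (auto simp: odd_col_strict_of odd_word_def col_eq_0 simp del: upt_Suc)
qed (use assms in \<open>auto simp: partition_strict_of distinct_strict_of\<close>)

lemma width_strict_of: "width (strict_of w) \<le> length w"
  by (auto simp: width_le strict_of_def dest: places_bounds)

lemma odd_word_strict_of: "w = odd_word (strict_of w) @ replicate (length w - width (strict_of w)) False"
proof (rule nth_equalityI)
  show "length w = length (odd_word (strict_of w) @ replicate (length w - width (strict_of w)) False)"
    using width_strict_of[of w] by (simp add: odd_word_def del: upt_Suc)
  fix i assume "i < length w"
  then show "w ! i = (odd_word (strict_of w) @ replicate (length w - width (strict_of w)) False) ! i"
    using odd_col_strict_of[of "Suc i" w] col_eq_0[of "strict_of w" "Suc i"]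
    by (auto simp: odd_word_def nth_append simp del: upt_Suc)
qed

text \<open>Negation keeps every change of letter inside the word; only the change at the right end,
  against the empty box assumed there, is lost.\<close>

lemma strict_of_complement:
  assumes "w \<noteq> []" "last w"
  shows "strict_of w = length w # strict_of (map Not w)"
proof -
  have "places n (edges w) = (n + length w - 1) # places n (edges (map Not w))" for n
    using assms
  proof (induction w arbitrary: n)
    case (Cons b w)
    then show ?case by (cases w) (auto split: if_splits)
  qed simp
  from this[of 1] show ?thesis by (simp add: strict_of_def)
qed

subsection \<open>The partition of a word\<close>

definition wpart :: "bool list \<Rightarrow> nat list" where
  "wpart w = conjugate (map (\<lambda>j. count_list (orbit w j) True) [0..<length w])"

lemma partition_wpart: "partition (wpart w)"
  by (simp add: wpart_def partition_conjugate)

lemma count_orbit_antimono: "i \<le> j \<Longrightarrow> count_list (orbit w j) True \<le> count_list (orbit w i) True"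
proof (rule lift_Suc_antimono_le[where f = "\<lambda>j. count_list (orbit w j) True"])
  fix n show "count_list (orbit w (Suc n)) True \<le> count_list (orbit w n) True"
    using count_orbit_Suc[of n w] by simp
qed

lemma col_wpart: "col (Suc j) (wpart w) = count_list (orbit w j) True"
proof -
  have "sorted_wrt (\<ge>) (map (\<lambda>j. count_list (orbit w j) True) [0..<length w])"
    using count_orbit_antimono[of _ _ w] by (auto simp: sorted_wrt_iff_nth_less simp del: funpow.simps)
  from col_conjugate[OF this, of j] show ?thesis
    unfolding wpart_def using orbit_vanish_ge[of w j] by auto
qed

lemma count_wpart: "count_list (wpart w) (Suc j) = exits w j"
  using col_Suc[of "Suc j" "wpart w"] count_orbit_Suc[of j w] by (simp only: col_wpart)

lemma length_wpart: "length (wpart w) = count_list w True"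
  using length_eq_col[OF partition_wpart, of w] col_wpart[of 0 w] by simp

lemma wpart_eqI: "partition \<kappa> \<Longrightarrow> (\<And>j. col (Suc j) \<kappa> = count_list (orbit w j) True) \<Longrightarrow> wpart w = \<kappa>"
  by (rule partition_eqI) (auto simp: partition_wpart col_wpart dest!: Suc_le_D)

lemma wpart_append_replicate: "wpart (w @ replicate m False) = wpart w"
  by (rule wpart_eqI) (auto simp: partition_wpart col_wpart orbit_append_replicate)

lemma orbit_advance: "orbit (advance 0 w) j = orbit w (Suc j)"
  by (simp add: funpow_swap1)

text \<open>A further column on the left is a further time step at the beginning: one backward step
  from a word for the remaining columns, in which the missing balls enter from the left.\<close>

lemma ex_word_heights:
  assumes "sorted_wrt (\<ge>) hs"
  shows "\<exists>w. \<forall>j. count_list (orbit w j) True = (if j < length hs then hs ! j else 0)"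
  using assms
proof (induction hs)
  case Nil
  have "orbit [] j = []" for j by (induction j) auto
  then show ?case by (intro exI[of _ "[]"]) auto
next
  case (Cons h hs)
  then obtain w where w: "count_list (orbit w j) True = (if j < length hs then hs ! j else 0)" for j
    by auto
  have le: "count_list w True \<le> h" using w[of 0] Cons.prems by (auto split: if_splits)
  define c where "c = h - count_list w True"
  define w' where "w' = w @ replicate (residue c w) False"
  have "residue c w' = 0" by (simp add: w'_def residue_replicate)
  then have r: "load 0 (retreat c w') = c" "advance 0 (retreat c w') = w'"
    using load_advance_retreat[of c w'] by auto
  then have "count_list (retreat c w') True = h"
    using count_advance[of 0 "retreat c w'"] le by (simp add: w'_def c_def)
  moreover have "orbit (retreat c w') (Suc j) = orbit w' j" for j
    using orbit_advance[of j "retreat c w'"] r by simp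
  ultimately have "count_list (orbit (retreat c w') j) True = (if j < length (h # hs) then (h # hs) ! j else 0)" for j
    using w by (cases j) (auto simp: w'_def orbit_append_replicate simp del: funpow.simps(2))
  then show ?case by blast
qed

lemma ex_wpart:
  assumes "partition \<kappa>"
  obtains w where "wpart w = \<kappa>"
proof -
  have "sorted_wrt (\<ge>) (conjugate \<kappa>)"
    using partition_conjugate by (simp add: partition_def)
  from ex_word_heights[OF this] obtain w where
    w: "count_list (orbit w j) True = (if j < length (conjugate \<kappa>) then conjugate \<kappa> ! j else 0)" for j
    by blast
  have "col (Suc j) \<kappa> = (if j < length (conjugate \<kappa>) then conjugate \<kappa> ! j else 0)" for j
    using col_eq_0[of \<kappa> "Suc j"] by (auto simp: conjugate_def simp del: upt_Suc)
  with w have "wpart w = \<kappa>" by (intro wpart_eqI assms) simp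
  then show ?thesis by (rule that)
qed

subsection \<open>Evaluation of calc\<close>

text \<open>The queue \<open>Q\<close> is the cargo of the carrier: entries of the left column that
  have been passed and whose rows have no box in the new column yet. An occupied place joins the
  queue, an empty one becomes the box next to the head of the queue. The last premise says that no
  admissible label remains between the current place and that head; hence the column ends when the
  places run out, and the queue left over is what leaves.\<close>

lemma calc_col_queue:
  assumes "\<And>n. n < length u \<Longrightarrow> Suc n \<in> S \<longleftrightarrow> u ! n"
    and "\<And>q. q \<in> set Q \<Longrightarrow> length u < q"
    and "\<And>x. a = Some x \<Longrightarrow> length u < x"
    and "\<And>n. Q \<noteq> [] \<Longrightarrow> length u < n \<Longrightarrow> n < hd Q \<Longrightarrow> (\<And>x. a = Some x \<Longrightarrow> n < x) \<Longrightarrow> n \<in> S"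
  shows "calc_col S (Q @ places 1 u) a = places 1 (advance (length Q) u)"
  using assms
proof (induction u arbitrary: Q a rule: rev_induct)
  case Nil
  show ?case
  proof (cases Q)
    case (Cons q Q')
    have "{n. 0 < n \<and> n < q \<and> (\<forall>x. a = Some x \<longrightarrow> n < x) \<and> n \<notin> S} = {}"
      using Nil.prems(4) Cons by auto
    then show ?thesis unfolding Cons by (simp only: append_Cons calc_col.simps Let_def) simp
  qed simp
next
  case (snoc b u)
  let ?n = "Suc (length u)"
  have S: "Suc n \<in> S \<longleftrightarrow> u ! n" if "n < length u" for n
    using snoc.prems(1)[of n] that by (simp add: nth_append)
  have Sn: "?n \<in> S \<longleftrightarrow> b" using snoc.prems(1)[of "length u"] by simp
  show ?case
  proof (cases b)
    case True
    have "calc_col S ((Q @ [?n]) @ places 1 u) a = places 1 (advance (length (Q @ [?n])) u)"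
    proof (rule snoc.IH)
      fix n assume n: "length u < n" "n < hd (Q @ [?n])" "\<And>x. a = Some x \<Longrightarrow> n < x"
      then have "Q \<noteq> []" by (cases Q) auto
      with n snoc.prems(4)[of n] Sn True show "n \<in> S" by (cases "n = ?n") auto
    qed (use S snoc.prems in \<open>auto dest: Suc_lessD\<close>)
    then show ?thesis using True by (simp add: places_append advance_append)
  next
    case False
    show ?thesis
    proof (cases Q)
      case Nil
      have "calc_col S ([] @ places 1 u) a = places 1 (advance (length ([] :: nat list)) u)"
        using S snoc.prems by (intro snoc.IH) (auto dest: Suc_lessD)
      then show ?thesis using False Nil by (simp add: places_append advance_append)
    next
      case (Cons q Q')
      let ?C = "{n. 0 < n \<and> n < q \<and> (\<forall>x. a = Some x \<longrightarrow> n < x) \<and> n \<notin> S}"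
      have "?n \<in> ?C" using snoc.prems(2)[of q] snoc.prems(3) Sn False Cons by auto
      moreover have "n \<le> ?n" if "n \<in> ?C" for n
        using snoc.prems(4)[of n] that Cons by (cases "Suc (length u) < n") auto
      ultimately have M: "Max ?C = ?n" "?C \<noteq> {}"
        by (auto intro!: Max_eqI finite_subset[of ?C "{..<q}"])
      have "calc_col S (Q' @ places 1 u) (Some ?n) = places 1 (advance (length Q') u)"
        using S snoc.prems(2) Cons by (intro snoc.IH) (auto dest: Suc_lessD)
      moreover have "calc_col S (Q @ places 1 u) a = ?n # calc_col S (Q' @ places 1 u) (Some ?n)"
        using M unfolding Cons append_Cons calc_col.simps Let_def by simp
      ultimately show ?thesis using False Cons by (simp add: places_append advance_append)
    qed
  qed
qed

lemma calc_col_places: "calc_col (set (places 1 w)) (places 1 w) None = places 1 (advance 0 w)"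
  using calc_col_queue[of w "set (places 1 w)" "[]" None] by (simp add: mem_places_1 del: One_nat_def)

lemma calc_cols_places:
  "map length (calc_cols (places 1 w)) = map (\<lambda>j. count_list (orbit w j) True) [0..<length (calc_cols (places 1 w))] \<and>
   (\<forall>j\<ge>length (calc_cols (places 1 w)). count_list (orbit w j) True = 0)"
proof (induction "places 1 w" arbitrary: w rule: calc_cols.induct)
  case 1
  show ?case
  proof (cases "places 1 w = []")
    case True
    then have "count_list w True = 0" using length_places[of 1 w] by simp
    then have "count_list (orbit w j) True = 0" for j
      using count_orbit_antimono[of 0 j w] by simp
    with True show ?thesis by (simp add: calc_cols.simps[of "[]"])
  next
    case False
    have IH: "map length (calc_cols (places 1 (advance 0 w))) =
        map (\<lambda>j. count_list (orbit w (Suc j)) True) [0..<length (calc_cols (places 1 (advance 0 w)))]"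
      "\<And>j. j \<ge> length (calc_cols (places 1 (advance 0 w))) \<Longrightarrow> count_list (orbit w (Suc j)) True = 0"
      using 1[OF False, of "advance 0 w"] by (simp_all only: calc_col_places orbit_advance simp_thms)
    have c: "calc_cols (places 1 w) = places 1 w # calc_cols (places 1 (advance 0 w))"
      using False by (subst calc_cols.simps) (simp only: if_False calc_col_places)
    have "map length (calc_cols (places 1 w)) = map (\<lambda>j. count_list (orbit w j) True) [0..<length (calc_cols (places 1 w))]"
      unfolding c by (simp add: IH(1) length_places map_upt_Suc del: upt_Suc funpow.simps(2) One_nat_def)
    moreover have "count_list (orbit w j) True = 0" if "j \<ge> length (calc_cols (places 1 w))" for j
      using IH(2)[of "j - 1"] that unfolding c by (cases j) (auto simp del: funpow.simps(2))
    ultimately show ?thesis by blast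
  qed
qed

lemma calc_odd_word: "calc \<mu> = wpart (odd_word \<mu>)"
proof -
  have "sorted_wrt (\<ge>) (map length (calc_cols (places 1 (odd_word \<mu>))))"
    using calc_cols_places[of "odd_word \<mu>"] count_orbit_antimono[of _ _ "odd_word \<mu>"]
    by (auto simp: sorted_wrt_iff_nth_less simp del: funpow.simps)
  moreover have "calc \<mu> = conjugate (map length (calc_cols (places 1 (odd_word \<mu>))))"
    using places_map_upt[of 1 "Suc (width \<mu>)" "\<lambda>t. odd (col t \<mu>)"] by (simp add: calc_def odd_word_def)
  ultimately show ?thesis
    using calc_cols_places[of "odd_word \<mu>"]
    by (intro wpart_eqI[symmetric]) (auto simp: partition_conjugate col_conjugate)
qed

lemma calc_strict_of: "calc (strict_of w) = wpart w"
  using wpart_append_replicate[of "odd_word (strict_of w)"] odd_word_strict_of[of w]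
  by (metis calc_odd_word)

subsection \<open>Evaluation of ord\<close>

lemma nth_advance: "i < length w \<Longrightarrow> advance 0 w ! i \<longleftrightarrow> \<not> w ! i \<and> 0 < load 0 (drop (Suc i) w)"
  by (induction w arbitrary: i) (auto simp: less_Suc_eq_0_disj)

text \<open>Conservation of balls in the first \<open>m\<close> boxes, which
  \<open>load 0 (drop m w)\<close> balls enter and \<open>load 0 w\<close> balls leave.\<close>

lemma count_take_advance:
  "count_list (take m (advance 0 w)) True + load 0 w = count_list (take m w) True + load 0 (drop m w)"
proof -
  have "advance 0 w = advance (load 0 (drop m w)) (take m w) @ advance 0 (drop m w)"
    using advance_append[of 0 "take m w" "drop m w"] by simp
  then have "take m (advance 0 w) = advance (load 0 (drop m w)) (take m w)"
    by (cases "m \<le> length w") auto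
  moreover have "load 0 w = load (load 0 (drop m w)) (take m w)"
    using load_append[of 0 "take m w" "drop m w"] by simp
  ultimately show ?thesis
    using count_advance[of "load 0 (drop m w)" "take m w"] by simp
qed

text \<open>The list is decreasing, so entry \<open>r\<close> is at most \<open>m\<close> iff at
  most \<open>r\<close> balls lie beyond box \<open>m\<close>.\<close>

lemma places_nth_less_iff:
  assumes "r < count_list z True" "m \<le> length z"
  shows "places 1 z ! r \<le> m \<longleftrightarrow> count_list z True \<le> r + count_list (take m z) True"
proof -
  have p: "places 1 z = places (Suc m) (drop m z) @ places 1 (take m z)"
    using places_append[of 1 "take m z" "drop m z"] assms(2) by simp
  have "count_list (take m z @ drop m z) True = count_list (take m z) True + count_list (drop m z) True"
    by (rule count_list_append)
  then have c: "count_list z True = count_list (take m z) True + count_list (drop m z) True"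
    by simp
  have l: "length (places (Suc m) (drop m z)) = count_list (drop m z) True"
    "length (places 1 (take m z)) = count_list (take m z) True"
    by (rule length_places)+
  show ?thesis
  proof (cases "r < count_list (drop m z) True")
    case True
    then have "places 1 z ! r \<in> set (places (Suc m) (drop m z))"
      unfolding p using l by (simp add: nth_append)
    with True c show ?thesis by (auto dest!: places_bounds)
  next
    case False
    then have "places 1 z ! r \<in> set (places 1 (take m z))"
      unfolding p using l assms(1) c by (simp add: nth_append del: One_nat_def)
    with False c show ?thesis by (auto dest!: places_bounds)
  qed
qed

text \<open>\<open>xs\<close> are the labels below the new box and \<open>R\<close> is the column to
  its right. A smaller admissible label would be an empty box that is still empty after the step, so
  the carrier reaches it empty. Counting balls then shows that \<open>R\<close> has a box in row
  \<open>r\<close> and that its label is too large.\<close>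

lemma spar_label:
  assumes i: "i < length w" "w ! i"
    and k: "k = count_list (take i w) True" "r = count_list w True - Suc k"
    and R: "R = places 1 (advance 0 w)" and xs: "xs = places 1 (take i w)"
  shows "(LEAST n. 0 < n \<and> (xs \<noteq> [] \<longrightarrow> hd xs < n) \<and> (r < length R \<longrightarrow> R ! r < n) \<and> n \<notin> set R) = Suc i"
proof (rule Least_equality)
  have tot: "count_list (advance 0 w) True + load 0 w = count_list w True"
    using count_advance[of 0 w] by simp
  have lenR: "length R = count_list (advance 0 w) True"
    by (simp add: R length_places)
  have d: "drop i w = True # drop (Suc i) w" using i by (metis Cons_nth_drop_Suc)
  have "count_list w True = count_list (take i w) True + count_list (drop i w) True"
    using count_list_append[of "take i w" "drop i w" True] by (simp only: append_take_drop_id)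
  then have kh: "Suc k \<le> count_list w True" unfolding k(1) d by simp
  show "0 < Suc i \<and> (xs \<noteq> [] \<longrightarrow> hd xs < Suc i) \<and> (r < length R \<longrightarrow> R ! r < Suc i) \<and> Suc i \<notin> set R"
  proof (intro conjI impI)
    assume "xs \<noteq> []"
    then have "hd xs \<in> set (places 1 (take i w))" using xs by simp
    with i show "hd xs < Suc i" by (auto dest!: places_bounds)
  next
    assume "r < length R"
    then show "R ! r < Suc i"
      using places_nth_less_iff[of r "advance 0 w" i] count_take_advance[of i w] i d tot kh k lenR R
      by (simp add: less_Suc_eq_le)
  next
    show "Suc i \<notin> set R"
      using i nth_advance[of i w] by (auto simp: R mem_places_1 simp del: One_nat_def)
  qed simp
  fix n assume n: "0 < n \<and> (xs \<noteq> [] \<longrightarrow> hd xs < n) \<and> (r < length R \<longrightarrow> R ! r < n) \<and> n \<notin> set R"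
  show "Suc i \<le> n"
  proof (rule ccontr)
    assume "\<not> Suc i \<le> n"
    then obtain m where m: "n = Suc m" "m < i" using n by (cases n) auto
    \<comment> \<open>The boxes from the candidate up to, but not including, the ball at index
      \<open>i\<close>; a ball among them would be a label in \<open>xs\<close> that is at least
      \<open>n\<close>.\<close>
    define v where "v = drop m (take i w)"
    have "take m (take i w) = take m w" using m by simp
    then have tw: "take i w = take m w @ v"
      unfolding v_def by (metis append_take_drop_id)
    have "True \<notin> set v"
    proof
      assume "True \<in> set v"
      then have "places n v \<noteq> []"
        using length_places[of n v] by (metis count_list_0_iff list.size(3))
      moreover have "xs = places n v @ places 1 (take m w)"
        using places_append[of 1 "take m w" v] tw m i by (simp add: xs)
      ultimately have "hd xs \<in> set (places n v)" "xs \<noteq> []" by auto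
      with n show False by (auto dest!: places_bounds)
    qed
    then have v0: "count_list v True = 0" by (simp add: count_list_0_iff)
    have "v \<noteq> []" "hd v = w ! m"
      using m i by (auto simp: v_def hd_drop_conv_nth)
    then have wm: "\<not> w ! m" using \<open>True \<notin> set v\<close> hd_in_set[of v] by metis
    moreover have "\<not> advance 0 w ! m"
      using n m i by (auto simp: R mem_places_1 simp del: One_nat_def)
    ultimately have "load 0 (drop (Suc m) w) = 0" using nth_advance[of m w] m i by simp
    moreover have "drop m w = False # drop (Suc m) w"
      using Cons_nth_drop_Suc[of m w] wm m i by (cases "w ! m") auto
    ultimately have "load 0 (drop m w) = 0" by simp
    with count_take_advance[of m w] tw v0 k
    have c: "count_list (take m (advance 0 w)) True + load 0 w = k" by simp
    show False
    proof (cases "r < length R")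
      case True
      then show False
        using places_nth_less_iff[of r "advance 0 w" m] n m i c tot kh k lenR R by simp
    next
      case False
      then show False using c tot kh k lenR by simp
    qed
  qed
qed

text \<open>The word is scanned from the left: every ball supplies the next box of the column from
  the bottom.\<close>

lemma spar_col_places:
  "spar_col (places 1 (advance 0 w)) (count_list w True) (count_list w True) = places 1 w"
proof -
  have "spar_col (places 1 (advance 0 w)) (count_list w True) (count_list (take i w) True) = places 1 (take i w)"
    if "i \<le> length w" for i
    using that
  proof (induction i)
    case (Suc i)
    have t: "take (Suc i) w = take i w @ [w ! i]"
      using Suc.prems by (simp add: take_Suc_conv_app_nth)
    show ?case
    proof (cases "w ! i")
      case True
      let ?L = "LEAST n. 0 < n \<and> (places 1 (take i w) \<noteq> [] \<longrightarrow> hd (places 1 (take i w)) < n) \<and>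
        (count_list w True - Suc (count_list (take i w) True) < length (places 1 (advance 0 w)) \<longrightarrow>
         places 1 (advance 0 w) ! (count_list w True - Suc (count_list (take i w) True)) < n) \<and>
         n \<notin> set (places 1 (advance 0 w))"
      have "?L = Suc i"
        using Suc.prems True by (intro spar_label[of i w]) auto
      moreover have "count_list (take (Suc i) w) True = Suc (count_list (take i w) True)"
        using True by (simp add: t)
      ultimately have "spar_col (places 1 (advance 0 w)) (count_list w True) (count_list (take (Suc i) w) True) =
          Suc i # places 1 (take i w)"
        using Suc by (simp only: spar_col.simps Let_def)
      then show ?thesis using True Suc.prems by (simp add: t places_append min_def)
    next
      case False
      with Suc show ?thesis by (simp add: t places_append)
    qed
  qed simp
  from this[of "length w"] show ?thesis by simp
qed

text \<open>Dropping the first column is the same as starting one step later, so the right neighbour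
  consists of the places of \<open>advance 0 w\<close>.\<close>

lemma spar_cols_heights:
  assumes "count_list (orbit w k) True = 0"
  shows "(case spar_cols (map (\<lambda>j. count_list (orbit w j) True) [0..<k]) of [] \<Rightarrow> [] | R # _ \<Rightarrow> R) = places 1 w"
  using assms
proof (induction k arbitrary: w)
  case 0
  then show ?case using length_places[of 1 w] by simp
next
  case (Suc k)
  have m: "map (\<lambda>j. count_list (orbit w j) True) [0..<Suc k] =
    count_list w True # map (\<lambda>j. count_list (orbit (advance 0 w) j) True) [0..<k]"
    by (simp add: map_upt_Suc orbit_advance del: upt_Suc funpow.simps(2))
  have "count_list (orbit (advance 0 w) k) True = 0"
    using Suc.prems by (simp only: orbit_advance)
  from Suc.IH[OF this] show ?case
    unfolding m spar_cols.simps Let_def list.case by (simp only: spar_col_places)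
qed

lemma spar_wpart: "(case spar (wpart w) of [] \<Rightarrow> {} | C # _ \<Rightarrow> set C) = set (places 1 w)"
proof -
  have "conjugate (wpart w) = map (\<lambda>j. count_list (orbit w j) True) [0..<width (wpart w)]"
    unfolding conjugate_def by (rule nth_equalityI) (simp_all add: col_wpart del: upt_Suc funpow.simps)
  moreover have "count_list (orbit w (width (wpart w))) True = 0"
    using col_wpart[of "width (wpart w)" w] col_eq_0[of "wpart w" "Suc (width (wpart w))"] by simp
  ultimately have "(case spar (wpart w) of [] \<Rightarrow> [] | R # _ \<Rightarrow> R) = places 1 w"
    using spar_cols_heights[of "width (wpart w)" w] by (simp only: spar_def)
  then show ?thesis by (auto split: list.splits)
qed

lemma ord_wpart: "ord (wpart w) = strict_of w"
  unfolding ord_def spar_wpart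
proof (rule the_equality)
  show "partition (strict_of w) \<and> distinct (strict_of w) \<and>
    (\<forall>t\<ge>1. odd (col t (strict_of w)) \<longleftrightarrow> t \<in> set (places 1 w))"
    by (simp add: partition_strict_of distinct_strict_of odd_col_strict_of mem_places_1 del: One_nat_def)
  fix \<mu> assume "partition \<mu> \<and> distinct \<mu> \<and> (\<forall>t\<ge>1. odd (col t \<mu>) \<longleftrightarrow> t \<in> set (places 1 w))"
  then show "\<mu> = strict_of w"
    by (intro strict_eqI)
      (auto simp: partition_strict_of distinct_strict_of odd_col_strict_of mem_places_1 simp del: One_nat_def)
qed

lemma calc_ord: "partition \<kappa> \<Longrightarrow> calc (ord \<kappa>) = \<kappa>"
  by (metis ex_wpart ord_wpart calc_strict_of)

lemma ord_calc: "partition \<mu> \<Longrightarrow> distinct \<mu> \<Longrightarrow> ord (calc \<mu>) = \<mu>"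
  by (simp add: calc_odd_word ord_wpart strict_of_odd_word)

lemma partition_ord: "partition \<kappa> \<Longrightarrow> partition (ord \<kappa>)"
  and distinct_ord: "partition \<kappa> \<Longrightarrow> distinct (ord \<kappa>)"
  by (metis ex_wpart ord_wpart partition_strict_of, metis ex_wpart ord_wpart distinct_strict_of)

lemma partition_calc: "partition (calc \<mu>)"
  by (simp add: calc_odd_word partition_wpart)

section \<open>Sizes of partitions, and numbers of boxes of either colour\<close>

subsection \<open>Sizes\<close>

text \<open>Sums of the rows in odd and in even position: the numbers of boxes of the two colours
  once the rows are coloured alternately.\<close>

primrec alt_sums :: "nat list \<Rightarrow> nat \<times> nat" where
  "alt_sums [] = (0, 0)"
| "alt_sums (d # ds) = (d + snd (alt_sums ds), fst (alt_sums ds))"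

lemma alt_sums_snoc:
  "alt_sums (ds @ [d]) = (if even (length ds) then (fst (alt_sums ds) + d, snd (alt_sums ds))
     else (fst (alt_sums ds), snd (alt_sums ds) + d))"
  by (induction ds) auto

primrec tops :: "nat \<Rightarrow> bool list \<Rightarrow> nat" where
  "tops n [] = 0"
| "tops n (b # w) = (if b \<and> \<not> (w \<noteq> [] \<and> hd w) then n else 0) + tops (Suc n) w"

text \<open>One less than the first places of the blocks of \<^const>\<open>True\<close>; a block at the very beginning of
  the word is skipped, and contributes 0 at \<open>n = 1\<close> anyway.\<close>

primrec starts :: "nat \<Rightarrow> bool list \<Rightarrow> nat" where
  "starts n [] = 0"
| "starts n (b # w) = (if \<not> b \<and> w \<noteq> [] \<and> hd w then n else 0) + starts (Suc n) w"

lemma odd_length_edges: "odd (length (places n (edges w))) \<longleftrightarrow> w \<noteq> [] \<and> hd w"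
  by (induction w arbitrary: n) auto

text \<open>From right to left, the last places of blocks alternate with the places just before
  blocks, beginning with a last place.\<close>

lemma alt_sums_edges: "alt_sums (places n (edges w)) = (tops n w, starts n w)"
proof (induction w arbitrary: n)
  case (Cons b w)
  then show ?case using odd_length_edges[of "Suc n" w] by (auto simp: alt_sums_snoc)
qed simp

lemma alt_sums_strict_of: "alt_sums (strict_of w) = (tops 1 w, starts 1 w)"
  by (simp only: strict_of_def alt_sums_edges)

text \<open>The length of a block is its last place minus the place before its first one; the final
  summand treats a block at the very beginning, which \<open>starts\<close> skips.\<close>

lemma tops_eq_starts: "1 \<le> n \<Longrightarrow> tops n w = starts n w + count_list w True + (if w \<noteq> [] \<and> hd w then n - 1 else 0)"
  by (induction w arbitrary: n) auto

lemma hd_advance: "hd w \<Longrightarrow> w \<noteq> [] \<Longrightarrow> 0 < load 0 w \<and> \<not> hd (advance 0 w)"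
  "\<not> hd w \<Longrightarrow> w \<noteq> [] \<Longrightarrow> 0 < load 0 w \<Longrightarrow> hd (advance 0 w)"
  by (cases w; auto)+

text \<open>After a step, blocks end exactly at the places just before the old blocks: such a place
  is empty, meets a loaded carrier, and its right neighbour has just been vacated.\<close>

lemma tops_advance: "tops n (advance 0 w) = starts n w"
proof (induction w arbitrary: n)
  case (Cons b w)
  have "advance 0 w = [] \<longleftrightarrow> w = []" by (metis length_0_conv length_advance)
  then show ?case using Cons.IH[of "Suc n"] hd_advance[of w] by (cases "w = []"; cases "hd w") auto
qed simp

text \<open>Telescoping: each step lowers \<open>tops 1\<close> by the number of balls
  present.\<close>

lemma sum_count_orbit: "(\<Sum>j<k. count_list (orbit w j) True) + tops 1 (orbit w k) = tops 1 w"
proof (induction k)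
  case (Suc k)
  have "tops 1 (orbit w k) = count_list (orbit w k) True + tops 1 (orbit w (Suc k))"
    using tops_eq_starts[of 1 "orbit w k"] tops_advance[of 1 "orbit w k"] by simp
  with Suc show ?case by simp
qed simp

lemma sum_list_wpart: "sum_list (wpart w) = tops 1 w"
proof -
  have "width (wpart w) \<le> length w"
  proof (rule ccontr)
    assume "\<not> width (wpart w) \<le> length w"
    then have "0 < col (width (wpart w)) (wpart w)" "length w \<le> width (wpart w) - 1"
      by (simp_all add: col_pos_iff)
    with \<open>\<not> width (wpart w) \<le> length w\<close> show False
      using col_wpart[of "width (wpart w) - 1" w] orbit_vanish_ge[of w "width (wpart w) - 1"] by simp
  qed
  then have "sum_list (wpart w) = (\<Sum>t=1..length w. col t (wpart w))"
    by (rule sum_list_col)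
  also have "\<dots> = (\<Sum>j<length w. col (Suc j) (wpart w))"
    by (rule sum.reindex_bij_witness[of _ Suc "\<lambda>t. t - 1"]) auto
  also have "\<dots> = (\<Sum>j<length w. count_list (orbit w j) True)"
    by (simp only: col_wpart)
  moreover have "tops n (replicate m False) = 0" for n m
    by (induction m arbitrary: n) auto
  ultimately show ?thesis
    using sum_count_orbit[where k = "length w" and w = w] by (simp add: orbit_vanish)
qed

lemma alt_sums_ord:
  assumes "partition \<kappa>"
  shows "fst (alt_sums (ord \<kappa>)) = sum_list \<kappa>"
    and "snd (alt_sums (ord \<kappa>)) + length \<kappa> = sum_list \<kappa>"
proof -
  obtain w where w: "wpart w = \<kappa>" using ex_wpart[OF assms] .
  have "ord \<kappa> = strict_of w" "sum_list \<kappa> = tops 1 w" "length \<kappa> = count_list w True"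
    unfolding w[symmetric] by (rule ord_wpart sum_list_wpart length_wpart)+
  then show "fst (alt_sums (ord \<kappa>)) = sum_list \<kappa>" "snd (alt_sums (ord \<kappa>)) + length \<kappa> = sum_list \<kappa>"
    using alt_sums_strict_of[of w] tops_eq_starts[of 1 w] by auto
qed

subsection \<open>Adding a row of length 1\<close>

text \<open>Every empty box meets a loaded carrier even if the carrier starts empty, so an
  additional ball coming from the right passes through and leaves.\<close>

primrec all_matched :: "bool list \<Rightarrow> bool" where
  "all_matched [] = True"
| "all_matched (b # w) = ((b \<or> 0 < load 0 w) \<and> all_matched w)"

lemma all_matched_load:
  assumes "all_matched u"
  shows "load (Suc c) u = Suc (load c u)" "advance (Suc c) u = advance c u"
proof -
  have *: "load c u = load 0 u + c \<and> advance c u = advance 0 u" for c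
    using assms by (induction u) auto
  from *[of c] *[of "Suc c"] show "load (Suc c) u = Suc (load c u)" "advance (Suc c) u = advance c u"
    by auto
qed

text \<open>The carrier reaches the box in question with load 0, so after one step this box is empty
  in either case, and a ball from it is carried through \<open>u\<close> and leaves. From then on
  the two evolutions agree.\<close>

lemma wpart_fill:
  assumes "all_matched u" "load 0 v = 0"
  shows "wpart (u @ True # v) = wpart (u @ False # v) @ [1]"
proof (rule wpart_eqI)
  show "partition (wpart (u @ False # v) @ [1])"
    using partition_wpart[of "u @ False # v"]
    by (auto simp: partition_def sorted_wrt_append Suc_le_eq intro: gr0I)
  have "advance 0 (u @ True # v) = advance 0 (u @ False # v)"
    using assms by (simp add: advance_append all_matched_load)
  then have "orbit (u @ True # v) (Suc j) = orbit (u @ False # v) (Suc j)" for j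
    by (metis orbit_advance)
  then show "col (Suc j) (wpart (u @ False # v) @ [1]) = count_list (orbit (u @ True # v) j) True" for j
    by (cases j) (simp_all add: col_append col_Cons col_wpart del: funpow.simps(2))
qed

section \<open>Polytopes as pairs of complementary words with a rule for the delta parts\<close>

section \<open>Affine MV polytopes in terms of words\<close>

subsection \<open>Weights\<close>

lemma scale_add: "scale (a + b) w = scale a w + scale b w"
  and scale_diff: "scale (a - b) w = scale a w - scale b w"
  and scale_add_right: "scale a (w + w') = scale a w + scale a w'"
  and scale_0 [simp]: "scale 0 w = 0"
  by (simp_all add: scale_def fun_eq_iff prod_eq_iff algebra_simps)

lemma bit_add_1_1 [simp]: "(i :: bit) + 1 + 1 = i"
  by (cases i) auto

lemma bit_neq_iff: "(i :: bit) \<noteq> j \<longleftrightarrow> i = j + 1"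
  by (cases i; cases j) auto

definition root_sum :: "int \<Rightarrow> int \<Rightarrow> weight" where
  "root_sum a b = scale a (simple_root 1) + scale b (simple_root 0)"

lemma root_sum_inject: "root_sum a b = root_sum a' b' \<longleftrightarrow> a = a' \<and> b = b'"
proof
  assume eq: "root_sum a b = root_sum a' b'"
  have s: "snd (root_sum x y) = y" "fst (root_sum x y) 1 = 2 * x - 2 * y" for x y
    by (simp_all add: root_sum_def scale_def simple_root_def fund_weight_def null_root_def)
  show "a = a' \<and> b = b'" using arg_cong[OF eq, of snd] arg_cong[OF eq, of "\<lambda>w. fst w 1"] unfolding s by simp
qed simp

lemma sum_real_root:
  "sum_list (map (real_root i) ks) =
     scale (int (sum_list ks)) (simple_root i) +
     scale (int (sum_list ks) - int (length ks)) (simple_root (i + 1))"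
  by (induction ks) (simp_all add: real_root_def scale_def fun_eq_iff prod_eq_iff algebra_simps)

text \<open>The coefficient of \<open>simple_root i\<close> in the content: a row of length k counts
  k in \<open>part \<pi> i\<close> and \<open>k - 1\<close> in the other part.\<close>

definition multiplicity :: "bit \<Rightarrow> root_partition \<Rightarrow> int" where
  "multiplicity i \<pi> = int (sum_list (part \<pi> i)) + int (sum_list (delta_part \<pi>)) +
     (int (sum_list (part \<pi> (i + 1))) - int (length (part \<pi> (i + 1))))"

lemma rp_content_eq: "rp_content \<pi> = root_sum (multiplicity 1 \<pi>) (multiplicity 0 \<pi>)"
  unfolding rp_content_def sum_real_root null_root_eq root_sum_def multiplicity_def
  by (simp add: scale_add scale_diff scale_add_right algebra_simps)

subsection \<open>Mates\<close>

definition mates :: "nat \<Rightarrow> nat list \<Rightarrow> nat list \<Rightarrow> bool" where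
  "mates N \<alpha> \<beta> \<longleftrightarrow> (\<exists>v. length v = N \<and> \<alpha> = wpart v \<and> \<beta> = wpart (map Not v))"

abbreviation row_counts :: "nat list \<Rightarrow> nat \<Rightarrow> nat" where
  "row_counts \<kappa> j \<equiv> count_list \<kappa> (Suc j)"

lemma row_counts_wpart: "row_counts (wpart w) = exits w"
  by (simp add: fun_eq_iff count_wpart)

lemma map_Not_Not [simp]: "map (Not \<circ> Not) v = v"
  by (simp add: comp_def)

lemma mates_sym: "mates N \<alpha> \<beta> \<Longrightarrow> mates N \<beta> \<alpha>"
  unfolding mates_def by (metis length_map map_map map_Not_Not)

lemma count_Not: "count_list v True + count_list (map Not v) True = length v"
  by (induction v) auto

text \<open>For the converse, words of the two partitions are padded to equal length and the common
  empty tail is cut off again. The numbers of balls in a word and in its complement add up to the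
  length, which is therefore \<open>N\<close>.\<close>

lemma mates_iff:
  assumes "partition \<alpha>" "partition \<beta>"
  shows "mates N \<alpha> \<beta> \<longleftrightarrow> balanced (row_counts \<alpha>) (row_counts \<beta>) \<and> N = length \<alpha> + length \<beta>"
proof
  assume "mates N \<alpha> \<beta>"
  then show "balanced (row_counts \<alpha>) (row_counts \<beta>) \<and> N = length \<alpha> + length \<beta>"
    using count_Not balanced_complement by (auto simp: mates_def row_counts_wpart length_wpart)
next
  assume *: "balanced (row_counts \<alpha>) (row_counts \<beta>) \<and> N = length \<alpha> + length \<beta>"
  obtain w w' where w: "wpart w = \<alpha>" "wpart w' = \<beta>"
    using ex_wpart assms by metis
  define W where "W = w @ replicate (length w' - length w) False"
  define W' where "W' = w' @ replicate (length w - length w') False"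
  have W: "wpart W = \<alpha>" "wpart W' = \<beta>"
    by (simp_all add: W_def W'_def wpart_append_replicate w)
  have "length W = length W'" by (simp add: W_def W'_def)
  moreover have "balanced (exits W) (exits W')"
    using * W by (simp flip: row_counts_wpart)
  ultimately obtain u m where u: "W = u @ replicate m False" "W' = map Not u @ replicate m False"
    by (rule balanced_imp_complement)
  have "\<alpha> = wpart u" "\<beta> = wpart (map Not u)"
    unfolding W[symmetric] u by (rule wpart_append_replicate)+
  moreover from this have "N = length u"
    using * count_Not[of u] by (simp add: length_wpart)
  ultimately show "mates N \<alpha> \<beta>" by (auto simp: mates_def)
qed

lemma mates_partition: "mates N \<alpha> \<beta> \<Longrightarrow> partition \<alpha> \<and> partition \<beta>"
  by (auto simp: mates_def partition_wpart)

lemma mates_ord_width: "mates N \<alpha> \<beta> \<Longrightarrow> width (ord \<alpha>) \<le> N \<and> width (ord \<beta>) \<le> N"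
  by (auto simp: mates_def ord_wpart) (metis length_map width_strict_of)+

text \<open>For the partition of a word of length \<open>N > 0\<close> this says that the last
  letter is a ball.\<close>

definition leading :: "nat \<Rightarrow> nat list \<Rightarrow> bool" where
  "leading N \<alpha> \<longleftrightarrow> ord \<alpha> \<noteq> [] \<and> hd (ord \<alpha>) = N"

lemma mates_0: "mates 0 \<alpha> \<beta> \<Longrightarrow> \<alpha> = [] \<and> \<beta> = []"
  by (auto simp: mates_def wpart_def conjugate_def)

lemma mates_leading:
  assumes "mates N \<alpha> \<beta>" "0 < N"
  shows "leading N \<alpha> \<and> \<not> leading N \<beta> \<and> ord \<alpha> = N # ord \<beta> \<or>
         leading N \<beta> \<and> \<not> leading N \<alpha> \<and> ord \<beta> = N # ord \<alpha>"
proof -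
  have *: "leading N \<alpha> \<and> \<not> leading N \<beta> \<and> ord \<alpha> = N # ord \<beta>"
    if v: "length v = N" "\<alpha> = wpart v" "\<beta> = wpart (map Not v)" "last v" for v \<alpha> \<beta>
  proof -
    have "v \<noteq> []" using v assms(2) by auto
    then have eq: "ord \<alpha> = N # ord \<beta>"
      unfolding v(2,3) ord_wpart using strict_of_complement[of v] v by simp
    moreover have "distinct (ord \<alpha>)" unfolding v(2) by (intro distinct_ord partition_wpart)
    ultimately show ?thesis by (auto simp: leading_def)
  qed
  obtain v where v: "length v = N" "\<alpha> = wpart v" "\<beta> = wpart (map Not v)"
    using assms(1) by (auto simp: mates_def)
  have "v \<noteq> []" using v assms(2) by auto
  show ?thesis
  proof (cases "last v")
    case True
    with * v show ?thesis by blast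
  next
    case False
    with \<open>v \<noteq> []\<close> have "last (map Not v)" by (simp add: last_map)
    with *[of "map Not v" \<beta> \<alpha>] v show ?thesis by simp
  qed
qed

lemma mates_leading_iff: "mates N \<alpha> \<beta> \<Longrightarrow> 0 < N \<Longrightarrow> leading N \<beta> \<longleftrightarrow> \<not> leading N \<alpha>"
  using mates_leading by blast

lemma mates_exists:
  assumes "partition \<alpha>" "width (ord \<alpha>) \<le> N"
  obtains \<beta> where "mates N \<alpha> \<beta>"
proof -
  define v where "v = odd_word (ord \<alpha>) @ replicate (N - width (ord \<alpha>)) False"
  have "wpart v = \<alpha>"
    using calc_ord[OF assms(1)] by (simp add: v_def wpart_append_replicate calc_odd_word)
  moreover have "length v = N"
    using assms(2) by (simp add: v_def odd_word_def del: upt_Suc)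
  ultimately show ?thesis using that by (auto simp: mates_def)
qed

lemma leading_width:
  assumes "partition \<alpha>"
  shows "leading N \<alpha> \<longleftrightarrow> 0 < N \<and> width (ord \<alpha>) = N"
  using partition_ord[OF assms] partition_width[of "hd (ord \<alpha>)" "tl (ord \<alpha>)"]
  by (cases "ord \<alpha>") (auto simp: leading_def partition_Cons)

subsection \<open>The relation defining MV polytopes\<close>

definition triple :: "root_partition \<Rightarrow> bool" where
  "triple \<pi> \<longleftrightarrow> (\<forall>i. partition (part \<pi> i)) \<and> partition (delta_part \<pi>)"

text \<open>The rule for the delta parts is restricted to \<open>0 < N\<close> because for
  \<open>N = 0\<close> all six partitions are empty.\<close>

definition mv_related :: "nat \<Rightarrow> root_partition \<Rightarrow> root_partition \<Rightarrow> bool" where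
  "mv_related N \<pi> \<phi> \<longleftrightarrow> triple \<pi> \<and> triple \<phi> \<and>
     mates N (part \<pi> 1) (part \<phi> 0) \<and> mates N (part \<pi> 0) (part \<phi> 1) \<and>
     width (delta_part \<pi>) \<le> N \<and> width (delta_part \<phi>) \<le> N \<and>
     (0 < N \<longrightarrow>
       (if leading N (part \<pi> 1) \<and> leading N (part \<pi> 0) then delta_part \<phi> = N # delta_part \<pi>
        else if \<not> leading N (part \<pi> 1) \<and> \<not> leading N (part \<pi> 0) then delta_part \<pi> = N # delta_part \<phi>
        else delta_part \<pi> = delta_part \<phi>))"

lemma mv_relatedD:
  assumes "mv_related N \<pi> \<phi>"
  shows "triple \<pi>" "triple \<phi>" "mates N (part \<pi> 1) (part \<phi> 0)" "mates N (part \<pi> 0) (part \<phi> 1)"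
    "width (delta_part \<pi>) \<le> N" "width (delta_part \<phi>) \<le> N"
  using assms by (simp_all add: mv_related_def)

lemma mv_related_delta:
  assumes "mv_related N \<pi> \<phi>" "0 < N"
  shows "leading N (part \<pi> 1) \<Longrightarrow> leading N (part \<pi> 0) \<Longrightarrow> delta_part \<phi> = N # delta_part \<pi>"
    "\<not> leading N (part \<pi> 1) \<Longrightarrow> \<not> leading N (part \<pi> 0) \<Longrightarrow> delta_part \<pi> = N # delta_part \<phi>"
    "leading N (part \<pi> 1) \<noteq> leading N (part \<pi> 0) \<Longrightarrow> delta_part \<pi> = delta_part \<phi>"
  using assms by (simp_all add: mv_related_def split: if_splits)

lemma mv_relatedI:
  assumes "triple \<pi>" "triple \<phi>" "mates N (part \<pi> 1) (part \<phi> 0)" "mates N (part \<pi> 0) (part \<phi> 1)"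
    "width (delta_part \<pi>) \<le> N" "width (delta_part \<phi>) \<le> N" "0 < N"
    "leading N (part \<pi> 1) \<Longrightarrow> leading N (part \<pi> 0) \<Longrightarrow> delta_part \<phi> = N # delta_part \<pi>"
    "\<not> leading N (part \<pi> 1) \<Longrightarrow> \<not> leading N (part \<pi> 0) \<Longrightarrow> delta_part \<pi> = N # delta_part \<phi>"
    "leading N (part \<pi> 1) \<noteq> leading N (part \<pi> 0) \<Longrightarrow> delta_part \<pi> = delta_part \<phi>"
  shows "mv_related N \<pi> \<phi>"
  using assms unfolding mv_related_def by simp

lemma mv_related_sym: "mv_related N \<pi> \<phi> \<Longrightarrow> mv_related N \<phi> \<pi>"
proof -
  assume r: "mv_related N \<pi> \<phi>"
  note d = mv_relatedD[OF r]
  show ?thesis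
  proof (cases "N = 0")
    case True
    with d mates_sym show ?thesis by (simp add: mv_related_def)
  next
    case False
    then have N: "0 < N" by simp
    note l = mates_leading_iff[OF d(3) N] mates_leading_iff[OF d(4) N]
    show ?thesis
    proof (rule mv_relatedI[OF d(2,1) mates_sym[OF d(4)] mates_sym[OF d(3)] d(6,5) N])
      show "delta_part \<pi> = N # delta_part \<phi>" if "leading N (part \<phi> 1)" "leading N (part \<phi> 0)"
        using that l by (intro mv_related_delta(2)[OF r N]) auto
      show "delta_part \<phi> = N # delta_part \<pi>" if "\<not> leading N (part \<phi> 1)" "\<not> leading N (part \<phi> 0)"
        using that l by (intro mv_related_delta(1)[OF r N]) auto
      show "delta_part \<phi> = delta_part \<pi>" if "leading N (part \<phi> 1) \<noteq> leading N (part \<phi> 0)"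
        using that l by (intro mv_related_delta(3)[OF r N, symmetric]) auto
    qed
  qed
qed

lemma width_0_imp: "partition \<kappa> \<Longrightarrow> width \<kappa> \<le> 0 \<Longrightarrow> \<kappa> = []"
  using partition_width by (cases \<kappa>) (auto simp: partition_Cons)

lemma multiplicity_ord:
  assumes "triple \<pi>"
  shows "multiplicity i \<pi> = int (fst (alt_sums (ord (part \<pi> i)))) + int (sum_list (delta_part \<pi>)) +
    int (snd (alt_sums (ord (part \<pi> (i + 1)))))"
  using assms alt_sums_ord[of "part \<pi> i"] alt_sums_ord[of "part \<pi> (i + 1)"]
  by (simp add: triple_def multiplicity_def)

text \<open>The two 2-regular partitions differ by a first row of length \<open>N\<close>, and
  removing a first row exchanges odd and even positions.\<close>

lemma mates_alt_sums:
  assumes "mates N \<alpha> \<beta>"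
  shows "int (fst (alt_sums (ord \<alpha>))) = int (snd (alt_sums (ord \<beta>))) + of_bool (leading N \<alpha>) * int N"
    and "int (snd (alt_sums (ord \<alpha>))) = int (fst (alt_sums (ord \<beta>))) - of_bool (leading N \<beta>) * int N"
proof -
  have "alt_sums (ord \<alpha>) = alt_sums (ord \<beta>)  \<and> alt_sums (ord \<beta>) = (0, 0)" if "N = 0"
    using mates_ord_width[OF assms] mates_partition[OF assms] that
    by (auto dest!: width_0_imp[OF partition_ord])
  then have "fst (alt_sums (ord \<alpha>)) = snd (alt_sums (ord \<beta>)) + of_bool (leading N \<alpha>) * N \<and>
    snd (alt_sums (ord \<alpha>)) + of_bool (leading N \<beta>) * N = fst (alt_sums (ord \<beta>))"
    using mates_leading[OF assms] by (cases "N = 0") auto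
  then show "int (fst (alt_sums (ord \<alpha>))) = int (snd (alt_sums (ord \<beta>))) + of_bool (leading N \<alpha>) * int N"
    "int (snd (alt_sums (ord \<alpha>))) = int (fst (alt_sums (ord \<beta>))) - of_bool (leading N \<beta>) * int N"
    by auto
qed

text \<open>Equal contents thus fix the difference of the sizes of the delta parts as
  \<open>N\<close>, 0 or \<open>- N\<close>, according to which sets contain \<open>N\<close>. This
  converts the comparison of sizes in the definition of polytopes into the rule of
  \<open>mv_related\<close>.\<close>

lemma multiplicity_diff:
  assumes "triple \<pi>" "triple \<phi>" "mates N (part \<pi> 1) (part \<phi> 0)" "mates N (part \<pi> 0) (part \<phi> 1)"
  shows "multiplicity 1 \<pi> - multiplicity 1 \<phi> = int (sum_list (delta_part \<pi>)) - int (sum_list (delta_part \<phi>)) +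
      (of_bool (leading N (part \<pi> 1)) - of_bool (leading N (part \<phi> 1))) * int N"
    and "multiplicity 0 \<pi> - multiplicity 0 \<phi> = int (sum_list (delta_part \<pi>)) - int (sum_list (delta_part \<phi>)) +
      (of_bool (leading N (part \<pi> 0)) - of_bool (leading N (part \<phi> 0))) * int N"
  using multiplicity_ord[OF assms(1), of 1] multiplicity_ord[OF assms(2), of 1]
    multiplicity_ord[OF assms(1), of 0] multiplicity_ord[OF assms(2), of 0]
    mates_alt_sums[OF assms(3)] mates_alt_sums[OF assms(4)]
  by (simp_all add: algebra_simps)

lemma csum_c:
  "c_up \<pi> \<phi> m = csum (row_counts (part \<phi> 0)) (row_counts (part \<pi> 1)) m"
  "c_right \<pi> \<phi> m = csum (row_counts (part \<pi> 1)) (row_counts (part \<phi> 0)) m"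
  "c_down \<pi> \<phi> m = csum (row_counts (part \<pi> 0)) (row_counts (part \<phi> 1)) m"
  "c_left \<pi> \<phi> m = csum (row_counts (part \<phi> 1)) (row_counts (part \<pi> 0)) m"
  unfolding c_up_def c_right_def c_down_def c_left_def csum_def
  by (rule sum.reindex_bij_witness[of _ Suc "\<lambda>k. k - 1"]; auto)+

lemma balanced_iff:
  "balanced x y \<longleftrightarrow> (\<forall>m\<ge>1. 0 \<in> {csum y x m, csum x y m} \<and> {csum y x m, csum x y m} \<subseteq> {..0})"
proof -
  have "max (csum x y m) (csum y x m) = 0 \<longleftrightarrow>
      0 \<in> {csum y x m, csum x y m} \<and> {csum y x m, csum x y m} \<subseteq> {..0}" for m
    by (auto simp: max_def)
  moreover have "max (csum x y 0) (csum y x 0) = 0" by simp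
  ultimately show ?thesis
    unfolding balanced_def by (metis One_nat_def Suc_leI neq0_conv)
qed

lemma hd_width: "partition \<kappa> \<Longrightarrow> (case \<kappa> of [] \<Rightarrow> 0 | d # _ \<Rightarrow> d) = width \<kappa>"
  by (cases \<kappa>) (simp_all add: partition_width)

lemma MV_iff:
  "(\<pi>, \<phi>) \<in> MV \<longleftrightarrow> triple \<pi> \<and> triple \<phi> \<and> rp_content \<pi> = rp_content \<phi> \<and>
     (\<exists>N. mates N (part \<pi> 1) (part \<phi> 0) \<and> mates N (part \<pi> 0) (part \<phi> 1) \<and> width (delta_part \<pi>) \<le> N \<and>
       (sum_list (delta_part \<pi>) = sum_list (delta_part \<phi>) \<longrightarrow> delta_part \<phi> = delta_part \<pi>) \<and>
       (sum_list (delta_part \<pi>) > sum_list (delta_part \<phi>) \<longrightarrow> delta_part \<phi> = tl (delta_part \<pi>)) \<and>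
       (sum_list (delta_part \<pi>) < sum_list (delta_part \<phi>) \<longrightarrow> delta_part \<phi> = N # delta_part \<pi>))"
proof (cases "triple \<pi> \<and> triple \<phi>")
  case False
  then show ?thesis by (auto simp: MV_def mv_polytope_def root_partitions_def triple_def)
next
  case True
  then have p: "partition (part \<pi> 1)" "partition (part \<phi> 0)" "partition (part \<pi> 0)" "partition (part \<phi> 1)"
    "partition (delta_part \<pi>)"
    by (auto simp: triple_def)
  have "(\<pi>, \<phi>) \<in> MV \<longleftrightarrow> rp_content \<pi> = rp_content \<phi> \<and>
     balanced (row_counts (part \<pi> 1)) (row_counts (part \<phi> 0)) \<and>
     balanced (row_counts (part \<pi> 0)) (row_counts (part \<phi> 1)) \<and>
     length (part \<pi> 1) + length (part \<phi> 0) = length (part \<pi> 0) + length (part \<phi> 1) \<and>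
     width (delta_part \<pi>) \<le> length (part \<pi> 1) + length (part \<phi> 0) \<and>
     (sum_list (delta_part \<pi>) = sum_list (delta_part \<phi>) \<longrightarrow> delta_part \<phi> = delta_part \<pi>) \<and>
     (sum_list (delta_part \<pi>) > sum_list (delta_part \<phi>) \<longrightarrow> delta_part \<phi> = tl (delta_part \<pi>)) \<and>
     (sum_list (delta_part \<pi>) < sum_list (delta_part \<phi>) \<longrightarrow>
        delta_part \<phi> = (length (part \<pi> 1) + length (part \<phi> 0)) # delta_part \<pi>)"
  proof -
    have bal: "(\<forall>m\<ge>1. 0 \<in> {csum y x m, csum x y m} \<and> {csum y x m, csum x y m} \<subseteq> {..0} \<and>
          0 \<in> {csum x' y' m, csum y' x' m} \<and> {csum x' y' m, csum y' x' m} \<subseteq> {..0}) \<longleftrightarrow>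
        balanced x y \<and> balanced x' y'" for x y x' y'
      unfolding balanced_iff[of x y] balanced_sym[of x' y'] balanced_iff[of y' x'] by blast
    have content: "(\<exists>\<theta>. \<pi> \<in> root_partitions \<theta> \<and> \<phi> \<in> root_partitions \<theta> \<and> P) \<longleftrightarrow>
        rp_content \<pi> = rp_content \<phi> \<and> P" for P
      using True by (auto simp: root_partitions_def triple_def)
    show ?thesis
      unfolding MV_def mv_polytope_def csum_c mem_Collect_eq case_prod_conv hd_width[OF p(5)] bal content
      by (simp only: conj_ac)
  qed
  moreover have "(\<exists>N. mates N (part \<pi> 1) (part \<phi> 0) \<and> mates N (part \<pi> 0) (part \<phi> 1) \<and> P N) \<longleftrightarrow>
     balanced (row_counts (part \<pi> 1)) (row_counts (part \<phi> 0)) \<and>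
     balanced (row_counts (part \<pi> 0)) (row_counts (part \<phi> 1)) \<and>
     length (part \<pi> 1) + length (part \<phi> 0) = length (part \<pi> 0) + length (part \<phi> 1) \<and>
     P (length (part \<pi> 1) + length (part \<phi> 0))" for P
    unfolding mates_iff[OF p(1,2)] mates_iff[OF p(3,4)] by auto
  ultimately show ?thesis using True by (simp only: simp_thms)
qed

lemma MV_imp_related:
  assumes "(\<pi>, \<phi>) \<in> MV"
  obtains N where "mv_related N \<pi> \<phi>"
proof -
  from assms obtain N where t: "triple \<pi>" "triple \<phi>" and c: "rp_content \<pi> = rp_content \<phi>"
    and m: "mates N (part \<pi> 1) (part \<phi> 0)" "mates N (part \<pi> 0) (part \<phi> 1)"
    and w: "width (delta_part \<pi>) \<le> N"
    and d: "sum_list (delta_part \<pi>) = sum_list (delta_part \<phi>) \<Longrightarrow> delta_part \<phi> = delta_part \<pi>"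
      "sum_list (delta_part \<pi>) > sum_list (delta_part \<phi>) \<Longrightarrow> delta_part \<phi> = tl (delta_part \<pi>)"
      "sum_list (delta_part \<pi>) < sum_list (delta_part \<phi>) \<Longrightarrow> delta_part \<phi> = N # delta_part \<pi>"
    unfolding MV_iff by blast
  have "multiplicity 1 \<pi> = multiplicity 1 \<phi>" "multiplicity 0 \<pi> = multiplicity 0 \<phi>"
    using c unfolding rp_content_eq root_sum_inject by auto
  with multiplicity_diff[OF t m] have
    s: "int (sum_list (delta_part \<phi>)) = int (sum_list (delta_part \<pi>)) +
      (of_bool (leading N (part \<pi> 1)) - of_bool (leading N (part \<phi> 1))) * int N"
    "int (sum_list (delta_part \<phi>)) = int (sum_list (delta_part \<pi>)) +
      (of_bool (leading N (part \<pi> 0)) - of_bool (leading N (part \<phi> 0))) * int N"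
    by simp_all
  have "mv_related N \<pi> \<phi>"
  proof (cases "N = 0")
    case True
    then have "delta_part \<pi> = []" using w t by (intro width_0_imp) (auto simp: triple_def)
    moreover have "delta_part \<phi> = delta_part \<pi>" using s True by (intro d) simp
    ultimately show ?thesis
      using t m True by (auto simp: mv_related_def triple_def leading_width)
  next
    case False
    then have "0 < N" by simp
    note l = mates_leading_iff[OF m(1) this] mates_leading_iff[OF m(2) this]
    have d1: "delta_part \<phi> = N # delta_part \<pi>" if "leading N (part \<pi> 1)" "leading N (part \<pi> 0)"
      using s \<open>0 < N\<close> l that by (intro d) simp
    have d2: "delta_part \<pi> = N # delta_part \<phi>" if "\<not> leading N (part \<pi> 1)" "\<not> leading N (part \<pi> 0)"
    proof -
      \<comment> \<open>The sizes differ by \<open>N\<close>, so the row removed by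
        \<open>tl\<close> is recovered as \<open>N\<close>.\<close>
      have e: "delta_part \<phi> = tl (delta_part \<pi>)" "sum_list (delta_part \<pi>) = N + sum_list (delta_part \<phi>)"
        using s \<open>0 < N\<close> d(2) l that by auto
      with \<open>0 < N\<close> show ?thesis by (cases "delta_part \<pi>") auto
    qed
    have d3: "delta_part \<pi> = delta_part \<phi>" if "leading N (part \<pi> 1) \<noteq> leading N (part \<pi> 0)"
      using s d(1) l that by (cases "leading N (part \<pi> 1)") auto
    have "width (delta_part \<phi>) \<le> N"
    proof (cases "leading N (part \<pi> 1) = leading N (part \<pi> 0)")
      case True
      then have "delta_part \<phi> = N # delta_part \<pi> \<or> delta_part \<pi> = N # delta_part \<phi>"
        using d1 d2 by (cases "leading N (part \<pi> 1)") simp_all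
      then show ?thesis using w by (auto simp: width_le)
    qed (use w d3 in simp)
    with t m w show ?thesis using \<open>0 < N\<close> d1 d2 d3 by (rule mv_relatedI)
  qed
  then show ?thesis by (rule that)
qed

lemma related_imp_MV:
  assumes "mv_related N \<pi> \<phi>"
  shows "(\<pi>, \<phi>) \<in> MV"
proof -
  note t = mv_relatedD(1,2)[OF assms] and m = mv_relatedD(3,4)[OF assms]
  have z: "delta_part \<pi> = []" "delta_part \<phi> = []" "\<not> leading N \<alpha>" if "N = 0" "partition \<alpha>" for \<alpha>
    using mv_relatedD[OF assms] that by (auto simp: triple_def leading_width intro: width_0_imp)
  have "multiplicity 1 \<pi> = multiplicity 1 \<phi> \<and> multiplicity 0 \<pi> = multiplicity 0 \<phi> \<and>
       (sum_list (delta_part \<pi>) = sum_list (delta_part \<phi>) \<longrightarrow> delta_part \<phi> = delta_part \<pi>) \<and>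
       (sum_list (delta_part \<pi>) > sum_list (delta_part \<phi>) \<longrightarrow> delta_part \<phi> = tl (delta_part \<pi>)) \<and>
       (sum_list (delta_part \<pi>) < sum_list (delta_part \<phi>) \<longrightarrow> delta_part \<phi> = N # delta_part \<pi>)"
  proof (cases "N = 0")
    case True
    then show ?thesis using multiplicity_diff[OF t m] z[OF _ partition_Nil] by simp
  next
    case False
    then have N: "0 < N" by simp
    note l = mates_leading_iff[OF m(1) N] mates_leading_iff[OF m(2) N]
    note d = mv_related_delta[OF assms N]
    show ?thesis
    proof (cases "leading N (part \<pi> 1)"; cases "leading N (part \<pi> 0)")
      assume a: "leading N (part \<pi> 1)" "leading N (part \<pi> 0)"
      from d(1)[OF this] show ?thesis using multiplicity_diff[OF t m] a l N by simp
    next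
      assume a: "\<not> leading N (part \<pi> 1)" "\<not> leading N (part \<pi> 0)"
      from d(2)[OF this] show ?thesis using multiplicity_diff[OF t m] a l N by simp
    next
      assume a: "leading N (part \<pi> 1)" "\<not> leading N (part \<pi> 0)"
      from d(3) a show ?thesis using multiplicity_diff[OF t m] a l N by simp
    next
      assume a: "\<not> leading N (part \<pi> 1)" "leading N (part \<pi> 0)"
      from d(3) a show ?thesis using multiplicity_diff[OF t m] a l N by simp
    qed
  qed
  then show ?thesis
    using mv_relatedD[OF assms] unfolding MV_iff rp_content_eq by auto
qed

text \<open>\<open>N\<close> must be at least all three widths, and the maximum works: if neither
  set contains \<open>N\<close>, then \<open>N\<close> is the first row of the delta part and can be
  removed.\<close>

lemma related_exists:
  assumes t: "triple \<pi>"
  obtains N \<phi> where "mv_related N \<pi> \<phi>"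
proof -
  have p: "partition (part \<pi> 1)" "partition (part \<pi> 0)" "partition (delta_part \<pi>)"
    using t by (auto simp: triple_def)
  define N where "N = max (max (width (ord (part \<pi> 1))) (width (ord (part \<pi> 0)))) (width (delta_part \<pi>))"
  obtain \<beta> where \<beta>: "mates N (part \<pi> 1) \<beta>"
    by (rule mates_exists[OF p(1), of N]) (simp_all add: N_def)
  obtain \<beta>' where \<beta>': "mates N (part \<pi> 0) \<beta>'"
    by (rule mates_exists[OF p(2), of N]) (simp_all add: N_def)
  define d where "d = (if leading N (part \<pi> 1) \<and> leading N (part \<pi> 0) then N # delta_part \<pi>
    else if leading N (part \<pi> 1) \<or> leading N (part \<pi> 0) then delta_part \<pi> else tl (delta_part \<pi>))"
  define \<phi> where "\<phi> = \<lparr>part = (\<lambda>i. if i = 0 then \<beta> else \<beta>'), delta_part = d\<rparr>"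
  have wd: "width (delta_part \<pi>) \<le> N" by (simp add: N_def)
  have dp: "delta_part \<pi> = N # tl (delta_part \<pi>)"
    if "\<not> leading N (part \<pi> 1)" "\<not> leading N (part \<pi> 0)" "0 < N"
  proof -
    have "width (ord (part \<pi> 1)) \<noteq> N" "width (ord (part \<pi> 0)) \<noteq> N"
      using that p by (auto simp: leading_width)
    then have "width (delta_part \<pi>) = N" by (simp add: N_def max_def split: if_splits)
    with p(3) that(3) show ?thesis by (cases "delta_part \<pi>") (auto simp: partition_width)
  qed
  have d: "partition d \<and> width d \<le> N"
    using p(3) wd by (cases "delta_part \<pi>") (auto simp: d_def partition_Cons width_le leading_width p(1,2))
  have "mv_related N \<pi> \<phi>"
  proof (cases "N = 0")
    case True
    then have "delta_part \<pi> = []" "d = []"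
      using d wd p width_0_imp by auto
    with True show ?thesis
      using t \<beta> \<beta>' mates_partition[OF \<beta>] mates_partition[OF \<beta>']
      by (auto simp: mv_related_def triple_def \<phi>_def leading_width)
  next
    case False
    have l: "leading N \<beta> \<longleftrightarrow> \<not> leading N (part \<pi> 1)" "leading N \<beta>' \<longleftrightarrow> \<not> leading N (part \<pi> 0)"
      using mates_leading[OF \<beta>] mates_leading[OF \<beta>'] False by auto
    have "triple \<phi>"
      using mates_partition[OF \<beta>] mates_partition[OF \<beta>'] d by (auto simp: triple_def \<phi>_def)
    then show ?thesis
      using t \<beta> \<beta>' wd d dp False by (intro mv_relatedI) (simp_all add: \<phi>_def l d_def)
  qed
  then show ?thesis by (rule that)
qed

section \<open>Upper ledge diagrams cut into a 2-regular upper part and a lower partition\<close>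

section \<open>Ledge diagrams\<close>

lemma forget_color [simp]: "map fst (color i ds) = ds"
  by (induction ds arbitrary: i) auto

lemma length_color [simp]: "length (color i ds) = length ds"
  by (induction ds arbitrary: i) auto

lemma nth_color: "r < length ds \<Longrightarrow> color i ds ! r = (ds ! r, if even r then i else i + 1)"
  by (induction ds arbitrary: i r) (auto simp: less_Suc_eq_0_disj)

definition regular2 :: "nat list \<Rightarrow> bool" where
  "regular2 \<mu> \<longleftrightarrow> partition \<mu> \<and> distinct \<mu>"

lemma regular2_rev: "regular2 U \<longleftrightarrow> sorted_wrt (<) (rev U) \<and> 0 \<notin> set U"
  unfolding strict_sorted_iff by (auto simp: regular2_def partition_def sorted_wrt_rev)

text \<open>\<open>U\<close> lists the rows above the cut from the cut upward, and the row next to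
  the cut has colour \<open>i\<close>. The colour of a row is thus determined by its distance from
  the cut.\<close>

definition ledge :: "bit \<Rightarrow> nat list \<Rightarrow> nat list \<Rightarrow> diagram" where
  "ledge i U M = rev (color i U) @ color (i + 1) M"

lemma length_ledge [simp]: "length (ledge i U M) = length U + length M"
  by (simp add: ledge_def)

lemma forget_ledge [simp]: "map fst (ledge i U M) = rev U @ M"
  by (simp add: ledge_def rev_map[symmetric])

lemma snd_ledge:
  assumes "r < length U + length M"
  shows "snd (ledge i U M ! r) = (if odd (r + length U) then i else i + 1)"
proof (cases "r < length U")
  case True
  then have "even (length U - Suc r) \<longleftrightarrow> odd (r + length U)" by auto
  with True show ?thesis by (simp add: ledge_def nth_append rev_nth nth_color)
qed (use assms in \<open>simp add: ledge_def nth_append nth_color\<close>)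

lemma fst_ledge: "r < length U + length M \<Longrightarrow> fst (ledge i U M ! r) = (rev U @ M) ! r"
  by (metis forget_ledge length_ledge nth_map)

lemma ledge_UL:
  assumes U: "regular2 U" and M: "partition M"
  shows "ledge i U M \<in> UL"
proof -
  have "successively (\<lambda>x y. snd y = snd x + 1) (ledge i U M)"
    unfolding successively_conv_nth by (auto simp: snd_ledge)
  moreover have "0 < fst x" if "x \<in> set (ledge i U M)" for x
  proof -
    have "fst x \<in> set (rev U @ M)" using that by (metis forget_ledge imageI list.set_map)
    with U M show ?thesis by (auto simp: regular2_def partition_def intro: gr0I)
  qed
  moreover have "ledge i U M = [] \<or> (\<exists>t\<in>{1..length (ledge i U M)}. sorted_wrt (<) (take t (map fst (ledge i U M))) \<and>
      sorted_wrt (\<ge>) (drop (t - 1) (map fst (ledge i U M))))"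
  proof -
    have sU: "sorted_wrt (<) (rev U)"
      using U by (simp add: regular2_rev)
    have sM: "sorted_wrt (\<ge>) M" using M by (simp add: partition_def)
    consider "U = []" "M = []" | "U \<noteq> []" "M = [] \<or> hd M \<le> hd U" | "M \<noteq> []" "U = [] \<or> hd U < hd M"
      by (cases "U = []"; cases "M = []"; cases "hd M \<le> hd U") auto
    then show ?thesis
    proof cases
      case 1
      then show ?thesis by (simp add: ledge_def)
    next
      case 2
      then obtain u U' where u: "U = u # U'" by (cases U) auto
      have "drop (length U - 1) (rev U @ M) = u # M" by (simp add: u)
      moreover have "sorted_wrt (\<ge>) (u # M)"
        using 2 sM u M by (cases M) (auto intro: order.trans)
      ultimately show ?thesis
        using sU 2 by (intro disjI2 bexI[of _ "length U"]) (auto simp: Suc_le_eq)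
    next
      case 3
      then obtain m M' where m: "M = m # M'" by (cases M) auto
      have "\<forall>u\<in>set U. u < m"
        using 3 m U by (cases U) (auto simp: regular2_def partition_def)
      then have "sorted_wrt (<) (take (Suc (length U)) (rev U @ M))"
        using sU by (simp add: m sorted_wrt_append)
      with sM show ?thesis
        using 3 by (intro disjI2 bexI[of _ "Suc (length U)"]) (auto simp: Suc_le_eq)
    qed
  qed
  ultimately show ?thesis by (simp add: UL_def upper_ledge_def)
qed

lemma successively_snd:
  assumes "successively (\<lambda>x y. snd y = snd x + (1 :: bit)) D" "r < length D"
  shows "snd (D ! r) = (if even r then snd (D ! 0) else snd (D ! 0) + 1)"
  using assms(2)
proof (induction r)
  case (Suc r)
  then have "snd (D ! Suc r) = snd (D ! r) + 1"
    using assms(1) unfolding successively_conv_nth by auto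
  with Suc show ?case by auto
qed simp

lemma UL_ledge:
  assumes "D \<in> UL"
  obtains U M where "regular2 U" "partition M" "D = ledge i U M"
proof (cases "D = []")
  case True
  then have "D = ledge i [] []" "regular2 []" "partition []"
    by (simp_all add: ledge_def regular2_def)
  with that show thesis by blast
next
  case False
    from assms False obtain t where
      pos: "\<And>x. x \<in> set D \<Longrightarrow> 0 < fst x" and alt: "successively (\<lambda>x y. snd y = snd x + 1) D"
      and t: "t \<in> {1..length D}" and inc: "sorted_wrt (<) (take t (map fst D))"
      and dec: "sorted_wrt (\<ge>) (drop (t - 1) (map fst D))"
      unfolding UL_def upper_ledge_def by auto
    have pos': "0 \<notin> set (map fst D)" using pos by fastforce
    \<comment> \<open>The cut lies below the peak row if that row has colour \<open>i\<close>, and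
      above it otherwise; either cut leaves strictly increasing rows above and weakly decreasing
      rows below.\<close>
    define s where "s = (if snd (D ! (t - 1)) = i then t else t - 1)"
    have s: "s \<le> t" "t - 1 \<le> s" "s \<le> length D" "t = s \<or> t = Suc s" using t by (auto simp: s_def)
    define U where "U = rev (take s (map fst D))"
    define M where "M = drop s (map fst D)"
    have "sorted_wrt (<) (take s (map fst D))"
      using inc s by (metis min_def take_take sorted_wrt_take)
    then have "regular2 U"
      using pos' by (auto simp: regular2_rev U_def dest: in_set_takeD)
    moreover have "sorted_wrt (\<ge>) M"
      using sorted_wrt_drop[OF dec, of "s - (t - 1)"] s by (simp add: M_def)
    then have "partition M"
      using pos' by (auto simp: partition_def M_def dest: in_set_dropD)
    moreover have "D = ledge i U M"
    proof (rule nth_equalityI)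
      show len: "length D = length (ledge i U M)" using s by (simp add: U_def M_def)
      fix r assume r: "r < length D"
      have lU: "length U = s" using s by (simp add: U_def)
      have r': "r < length U + length M" using len r by simp
      have "rev U @ M = map fst D" by (simp add: U_def M_def)
      then have "fst (D ! r) = fst (ledge i U M ! r)" using r r' by (simp add: fst_ledge)
      moreover have "snd (D ! r) = snd (ledge i U M ! r)"
      proof -
        have "snd (D ! (t - 1)) = i + (if s = t then 0 else 1)"
          using t bit_neq_iff[of "snd (D ! (t - 1))" i] by (auto simp: s_def)
        moreover have t': "t - 1 < length D" and "even (t - 1) \<longleftrightarrow> odd t" using t by auto
        ultimately show ?thesis
          using successively_snd[OF alt r] successively_snd[OF alt t'] t s(4)
            bit_neq_iff[of "snd (D ! 0)" i]
          unfolding snd_ledge[OF r'] lU by (auto split: if_splits)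
      qed
      ultimately show "D ! r = ledge i U M ! r" by (simp add: prod_eq_iff)
    qed
    ultimately show thesis by (rule that)
qed

subsection \<open>Top and bottom boxes\<close>

text \<open>Each column is an unbroken run of boxes, \<open>col c U\<close> above the cut and
  \<open>col c M\<close> below it. The parities of these numbers are therefore the colours of its
  top and bottom boxes.\<close>

lemma column_ledge:
  assumes "regular2 U" "partition M" "r < length U + length M"
  shows "c \<le> fst (ledge i U M ! r) \<longleftrightarrow> length U - col c U \<le> r \<and> r < length U + col c M"
proof -
  have s: "sorted_wrt (\<ge>) U" "sorted_wrt (\<ge>) M" using assms by (auto simp: regular2_def partition_def)
  show ?thesis
  proof (cases "r < length U")
    case True
    then have "c \<le> U ! (length U - Suc r) \<longleftrightarrow> length U - Suc r < col c U"
      using s by (intro nth_ge_iff_col) auto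
    with True show ?thesis using assms by (auto simp: fst_ledge nth_append rev_nth)
  next
    case False
    then have "c \<le> M ! (r - length U) \<longleftrightarrow> r - length U < col c M"
      using s assms(3) by (intro nth_ge_iff_col) auto
    with False show ?thesis using assms by (auto simp: fst_ledge nth_append)
  qed
qed

lemma concat_map_singleton:
  "concat (map (\<lambda>r. if P r then [f r] else []) xs) = map f (filter P xs)"
  by (induction xs) auto

lemma filter_upt_unique:
  assumes "r0 < n" "\<And>r. r < n \<Longrightarrow> P r \<longleftrightarrow> r = r0"
  shows "filter P [0..<n] = [r0]"
proof -
  have "filter P [0..<n] = filter (\<lambda>r. r = r0) [0..<n]" using assms(2) by (intro filter_cong) auto
  also have "\<dots> = [r0]" using assms(1) by (induction n) (auto simp: less_Suc_eq)
  finally show ?thesis .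
qed

lemma width_append: "width (rev U @ M) = max (width U) (width M)"
  by (intro width_eqI) (auto simp: col_append col_rev col_pos_iff less_max_iff_disj le_max_iff_disj)

lemma col_pos_ledge:
  assumes "1 \<le> c" "c \<le> width (rev U @ M)"
  shows "0 < col c U + col c M"
  using assms col_pos_iff[of c U] col_pos_iff[of c M] by (auto simp: width_append le_max_iff_disj)

lemma top_boxes_ledge:
  assumes UM: "regular2 U" "partition M"
  shows "top_boxes (ledge i U M) =
    map (\<lambda>c. (length U - col c U, c)) (rev [1..<Suc (width (rev U @ M))])"
proof -
  have "filter (\<lambda>r. c \<le> fst (ledge i U M ! r) \<and> \<not> (0 < r \<and> c \<le> fst (ledge i U M ! (r - 1))))
      [0..<length (ledge i U M)] = [length U - col c U]"
    if "1 \<le> c" "c \<le> width (rev U @ M)" for c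
    using col_pos_ledge[OF that] col_le_length[of c U] col_le_length[of c M]
    by (intro filter_upt_unique) (auto simp: column_ledge[OF UM])
  then have "concat (map (\<lambda>r. if c \<le> fst (ledge i U M ! r) \<and> \<not> (0 < r \<and> c \<le> fst (ledge i U M ! (r - 1))) then [(r, c)] else [])
      [0..<length (ledge i U M)]) = [(length U - col c U, c)]"
    if "c \<in> set (rev [1..<Suc (width (rev U @ M))])" for c
    using that unfolding concat_map_singleton by (simp add: less_Suc_eq_le del: upt_Suc)
  then have "top_boxes (ledge i U M) = concat (map (\<lambda>c. [(length U - col c U, c)]) (rev [1..<Suc (width (rev U @ M))]))"
    unfolding top_boxes_def forget_ledge by (intro arg_cong[of _ _ concat] map_cong refl)
  then show ?thesis
    using concat_map_singleton[of "\<lambda>_. True" "\<lambda>c. (length U - col c U, c)"] by (simp del: upt_Suc)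
qed

lemma bottom_boxes_ledge:
  assumes UM: "regular2 U" "partition M"
  shows "bottom_boxes (ledge i U M) =
    map (\<lambda>c. (length U + col c M - 1, c)) (rev [1..<Suc (width (rev U @ M))])"
proof -
  have "filter (\<lambda>r. c \<le> fst (ledge i U M ! r) \<and> \<not> (Suc r < length (ledge i U M) \<and> c \<le> fst (ledge i U M ! Suc r)))
      [0..<length (ledge i U M)] = [length U + col c M - 1]"
    if "1 \<le> c" "c \<le> width (rev U @ M)" for c
    using col_pos_ledge[OF that] col_le_length[of c U] col_le_length[of c M]
    by (intro filter_upt_unique) (auto simp: column_ledge[OF UM])
  then have "concat (map (\<lambda>r. if c \<le> fst (ledge i U M ! r) \<and> \<not> (Suc r < length (ledge i U M) \<and> c \<le> fst (ledge i U M ! Suc r)) then [(r, c)] else [])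
      [0..<length (ledge i U M)]) = [(length U + col c M - 1, c)]"
    if "c \<in> set (rev [1..<Suc (width (rev U @ M))])" for c
    using that unfolding concat_map_singleton by (simp add: less_Suc_eq_le del: upt_Suc)
  then have "bottom_boxes (ledge i U M) = concat (map (\<lambda>c. [(length U + col c M - 1, c)]) (rev [1..<Suc (width (rev U @ M))]))"
    unfolding bottom_boxes_def forget_ledge by (intro arg_cong[of _ _ concat] map_cong refl)
  then show ?thesis
    using concat_map_singleton[of "\<lambda>_. True" "\<lambda>c. (length U + col c M - 1, c)"] by (simp del: upt_Suc)
qed

lemma box_color_top:
  assumes "1 \<le> c" "c \<le> width (rev U @ M)"
  shows "box_color (ledge i U M) (length U - col c U, c) = (if odd (col c U) then i else i + 1)"
proof -
  have "length U - col c U < length U + length M" "col c U \<le> length U"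
    using col_pos_ledge[OF assms] col_le_length[of c U] col_le_length[of c M] by auto
  moreover from this have "odd (length U - col c U + length U) \<longleftrightarrow> odd (col c U)" by simp
  ultimately show ?thesis unfolding box_color_def fst_conv by (simp only: snd_ledge)
qed

lemma box_color_bottom:
  assumes "1 \<le> c" "c \<le> width (rev U @ M)"
  shows "box_color (ledge i U M) (length U + col c M - 1, c) = (if odd (col c M) then i + 1 else i)"
proof -
  have parity: "odd (a + b - 1 + a) \<longleftrightarrow> even b" if "0 < a + b" for a b :: nat
    using that by presburger
  have "length U + col c M - 1 < length U + length M" "0 < length U + col c M"
    using col_pos_ledge[OF assms] col_le_length[of c U] col_le_length[of c M] by auto
  then show ?thesis
    unfolding box_color_def fst_conv by (simp only: snd_ledge parity) simp
qed

section \<open>Recovering the three pieces of a stacked diagram from column parities\<close>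

subsection \<open>Inverting the stacking map\<close>

lemma regular2_col:
  assumes "regular2 \<nu>"
  shows "col c \<nu> = col (Suc c) \<nu> + of_bool (odd (col c \<nu>) \<noteq> odd (col (Suc c) \<nu>))"
  using assms col_Suc[of c \<nu>] count_list_distinct[of \<nu> c] by (auto simp: regular2_def)

lemma regular2_col_width: "regular2 \<nu> \<Longrightarrow> \<nu> \<noteq> [] \<Longrightarrow> col (width \<nu>) \<nu> = 1"
  using partition_width[of "hd \<nu>" "tl \<nu>"] count_list_distinct[of \<nu> "hd \<nu>"] col_Suc[of "width \<nu>" \<nu>]
    col_eq_0[of \<nu> "Suc (width \<nu>)"]
  by (auto simp: regular2_def)

lemma upt_split_rev: "v \<le> W \<Longrightarrow> rev [1..<Suc W] = rev [Suc v..<Suc W] @ rev [1..<Suc v]"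
  using upt_add_eq_append[of 1 "Suc v" "W - v"] by simp

text \<open>The last column of \<open>U\<close> has a single box, of colour \<open>i\<close>, and
  all columns further right start below the cut with the other colour. So the rightmost
  \<open>i\<close>-top box ends the row just above the cut.\<close>

lemma trip_up_ledge:
  assumes UM: "regular2 U" "partition M"
  shows "trip_up i (ledge i U M) = rev (color i U)"
proof -
  define W where "W = width (rev U @ M)"
  define P where "P = (\<lambda>b. box_color (ledge i U M) b = i)"
  have f: "filter P (map (\<lambda>c. (length U - col c U, c)) (rev cs)) =
      map (\<lambda>c. (length U - col c U, c)) (rev (filter (\<lambda>c. odd (col c U)) cs))"
    if "set cs \<subseteq> {1..W}" for cs
    using that box_color_top[of _ U M i]
    by (induction cs) (auto simp: P_def W_def)
  show ?thesis
  proof (cases "U = []")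
    case True
    then have "filter P (top_boxes (ledge i U M)) = []"
      unfolding top_boxes_ledge[OF UM] W_def[symmetric] by (subst f) (auto simp del: upt_Suc)
    then show ?thesis using True by (simp add: trip_up_def P_def)
  next
    case False
    define u where "u = width U"
    have u: "1 \<le> u" "u \<le> W" "col u U = 1"
      using regular2_col_width[OF UM(1) False] col_pos_iff[of 1 U] UM False length_eq_col[of U]
      by (auto simp: u_def W_def width_append regular2_def)
    have e: "filter (\<lambda>c. odd (col c U)) [Suc u..<Suc W] = []"
      by (auto simp: filter_empty_conv u_def col_eq_0 simp del: upt_Suc)
    have "[1..<Suc u] = [1..<u] @ [u]" using u by simp
    then have "filter P (top_boxes (ledge i U M)) =
      (length U - 1, u) # map (\<lambda>c. (length U - col c U, c)) (rev (filter (\<lambda>c. odd (col c U)) [1..<u]))"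
      unfolding top_boxes_ledge[OF UM] W_def[symmetric] upt_split_rev[OF u(2)] map_append filter_append
      using u by (subst (1 2) f) (auto simp: e simp del: upt_Suc)
    then have t: "trip_up i (ledge i U M) = map (\<lambda>(d, k). (min d u, k)) (take (length U) (ledge i U M))"
      using False by (simp add: trip_up_def P_def)
    have "map (\<lambda>(d, k). (min d u, k)) (rev (color i U)) = rev (color i U)"
    proof (rule map_idI)
      fix x assume "x \<in> set (rev (color i U))"
      then have "fst x \<in> set U" by (metis forget_color imageI list.set_map set_rev)
      then have "fst x \<le> u" unfolding u_def by (rule le_width)
      then show "(case x of (d, k) \<Rightarrow> (min d u, k)) = x" by (cases x) auto
    qed
    then show ?thesis unfolding t by (simp add: ledge_def)
  qed
qed

text \<open>From right to left, column lengths of a 2-regular partition grow by one exactly where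
  the parity changes, which is the rule of highlighting.\<close>

lemma highlight_col:
  assumes "regular2 \<nu>"
  shows "highlight (if odd (col (Suc m) \<nu>) then i + 1 else i) (col (Suc m) \<nu>)
      (map (\<lambda>c. if odd (col c \<nu>) then i + 1 else i) (rev [1..<Suc m])) = map (\<lambda>c. col c \<nu>) (rev [1..<Suc m])"
proof (induction m)
  case (Suc m)
  have "rev [1..<Suc (Suc m)] = Suc m # rev [1..<Suc m]" by simp
  with Suc regular2_col[OF assms, of "Suc m"] show ?case by (auto simp: Let_def simp del: upt_Suc)
qed simp

lemma highlighted_ledge:
  assumes UM: "regular2 U" "partition M" and \<nu>: "regular2 \<nu>"
    and odd: "\<And>c. 1 \<le> c \<Longrightarrow> odd (col c M) \<longleftrightarrow> odd (col c \<nu>)"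
  shows "highlighted i (ledge i U M) = map (\<lambda>c. col c \<nu>) [1..<Suc (width \<nu>)]"
proof -
  define W where "W = width (rev U @ M)"
  define v where "v = width \<nu>"
  define g where "g = (\<lambda>c. (length U + col c M - 1, c))"
  define k where "k = (\<lambda>c. if odd (col c \<nu>) then i + 1 else i)"
  have gk: "box_color (ledge i U M) (g c) = k c" if "1 \<le> c" "c \<le> W" for c
    using box_color_bottom[of c U M i] that odd[of c] by (simp add: g_def k_def W_def)
  have v: "v \<le> W"
  proof (cases "v = 0")
    case False
    then have "odd (col v \<nu>)" using regular2_col_width[OF \<nu>] by (cases "\<nu> = []") (auto simp: v_def)
    with odd[of v] False have "0 < col v M" by (cases "col v M") auto
    with col_pos_iff[of v M] False show ?thesis by (simp add: W_def width_append)
  qed simp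
  have d: "dropWhile (\<lambda>b. box_color (ledge i U M) b \<noteq> i + 1) (map g (rev [1..<Suc W])) = map g (rev [1..<Suc v])"
  proof -
    have "box_color (ledge i U M) x \<noteq> i + 1" if "x \<in> set (map g (rev [Suc v..<Suc W]))" for x
    proof -
      from that obtain c where c: "x = g c" "Suc v \<le> c" "c \<le> W" by (auto simp: less_Suc_eq_le simp del: upt_Suc)
      then have "k c = i" by (simp add: k_def v_def col_eq_0)
      with c gk[of c] show ?thesis by (cases i) auto
    qed
    moreover have "dropWhile (\<lambda>b. box_color (ledge i U M) b \<noteq> i + 1) (map g (rev [1..<Suc v])) = map g (rev [1..<Suc v])"
    proof (cases v)
      case (Suc w)
      then have "odd (col v \<nu>)" using regular2_col_width[OF \<nu>] by (cases "\<nu> = []") (auto simp: v_def)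
      then have "box_color (ledge i U M) (g v) = i + 1" using gk[of v] v Suc by (simp add: k_def)
      then show ?thesis using Suc by simp
    qed simp
    ultimately show ?thesis
      unfolding upt_split_rev[OF v] map_append by (subst dropWhile_append2) blast+
  qed
  have "map (box_color (ledge i U M)) (map g (rev [1..<Suc v])) = map k (rev [1..<Suc v])"
    unfolding map_map using v by (intro map_cong) (auto simp: gk)
  then have "highlighted i (ledge i U M) = rev (highlight (i + 1) 1 (map k (rev [1..<Suc v])))"
    unfolding highlighted_def bottom_boxes_ledge[OF UM] W_def[symmetric] g_def[symmetric] d by (simp only:)
  also have "highlight (i + 1) 1 (map k (rev [1..<Suc v])) = map (\<lambda>c. col c \<nu>) (rev [1..<Suc v])"
  proof (cases v)
    case (Suc w)
    then have c: "col (Suc w) \<nu> = 1" using regular2_col_width[OF \<nu>] by (cases "\<nu> = []") (auto simp: v_def)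
    then have "k (Suc w) = i + 1" by (simp add: k_def)
    moreover have "rev [1..<Suc v] = Suc w # rev [1..<Suc w]" using Suc by simp
    ultimately show ?thesis
      using highlight_col[OF \<nu>, where m = w and i = i] c by (simp add: k_def Let_def del: upt_Suc)
  qed simp
  finally show ?thesis by (simp add: rev_map v_def del: upt_Suc)
qed

lemma conjugate_cols: "partition \<nu> \<Longrightarrow> conjugate (map (\<lambda>c. col c \<nu>) [1..<Suc (width \<nu>)]) = \<nu>"
proof (rule partition_eqI[OF partition_conjugate])
  fix t :: nat assume t: "1 \<le> t"
  have "col t (conjugate (map (\<lambda>c. col c \<nu>) [1..<Suc (width \<nu>)])) = (if t \<le> width \<nu> then col t \<nu> else 0)"
    using t by (intro col_conjugate_map) (auto simp: col_antimono)
  then show "col t (conjugate (map (\<lambda>c. col c \<nu>) [1..<Suc (width \<nu>)])) = col t \<nu>"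
    by (simp add: col_eq_0 del: upt_Suc)
qed

lemma calY_ledge:
  assumes UM: "regular2 U" "partition M" and \<nu>: "regular2 \<nu>" and \<delta>: "partition \<delta>"
    and M: "\<And>c. 1 \<le> c \<Longrightarrow> col c M = 2 * col c \<delta> + col c \<nu>"
  shows "calY_at i (ledge i U M) =
    \<lparr>part = (\<lambda>j. if j = i then calc U else calc \<nu>), delta_part = \<delta>\<rparr>"
proof -
  have hl: "highlighted i (ledge i U M) = map (\<lambda>c. col c \<nu>) [1..<Suc (width \<nu>)]"
    by (rule highlighted_ledge[OF UM \<nu>]) (simp add: M)
  have up: "trip_up i (ledge i U M) = rev (color i U)" by (rule trip_up_ledge[OF UM])
  have down: "forget (trip_down i (ledge i U M)) = \<nu>"
    using \<nu> conjugate_cols[of \<nu>] unfolding forget_def trip_down_def hl forget_color regular2_def by blast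
  define W where "W = width (rev U @ M)"
  define f where "f = (\<lambda>c. col c (forget (ledge i U M)) - col c (forget (trip_up i (ledge i U M))) -
      (if c \<le> length (highlighted i (ledge i U M)) then highlighted i (ledge i U M) ! (c - 1) else 0))"
  have f: "f c = 2 * col c \<delta>" if "1 \<le> c" for c
  proof -
    have "(if c \<le> length (highlighted i (ledge i U M)) then highlighted i (ledge i U M) ! (c - 1) else 0) = col c \<nu>"
      using that by (auto simp: hl col_eq_0 simp del: upt_Suc)
    then show ?thesis
      using that by (simp add: f_def up forget_def col_append col_rev M flip: rev_map)
  qed
  have dd: "conjugate (map f [1..<Suc W]) = double \<delta>"
  proof (rule partition_eqI)
    fix t :: nat assume t: "1 \<le> t"
    have "col t (conjugate (map f [1..<Suc W])) = (if t \<le> W then f t else 0)"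
      using t by (intro col_conjugate_map) (auto simp: f col_antimono)
    also have "\<dots> = col t (double \<delta>)"
    proof (cases "t \<le> W")
      case False
      then have "col t M = 0" by (intro col_eq_0) (simp add: W_def width_append)
      with False t M[OF t] show ?thesis by (simp add: col_double)
    qed (use t in \<open>simp add: f col_double\<close>)
    finally show "col t (conjugate (map f [1..<Suc W])) = col t (double \<delta>)" .
  qed (auto simp: partition_conjugate partition_double)
  have "length (double \<delta>) \<le> length M"
    using length_eq_col[OF partition_double, of \<delta>] length_eq_col[OF UM(2)] M[of 1] by (simp add: col_double)
  then have "forget (trip_delta i (ledge i U M)) = double \<delta>"
    using dd unfolding trip_delta_def f_def[symmetric]
    by (simp add: up forget_def map_fst_zip_take W_def[symmetric] del: upt_Suc One_nat_def)
  moreover have "forget (flip (trip_up i (ledge i U M))) = U"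
    by (simp add: up flip_def forget_def)
  ultimately show ?thesis unfolding calY_at_def by (simp only: down halve_double[OF \<delta>])
qed

text \<open>The rows of \<open>calX_at i \<pi>\<close> below the cut. As the delta part enters with
  doubled columns, it is invisible to parities.\<close>

definition lower :: "bit \<Rightarrow> root_partition \<Rightarrow> nat list" where
  "lower i \<pi> = conjugate (map (\<lambda>c. col c (double (delta_part \<pi>)) + col c (ord (part \<pi> (i + 1))))
     [1..<Suc (max (width (double (delta_part \<pi>))) (width (ord (part \<pi> (i + 1)))))])"

lemma partition_lower: "partition (lower i \<pi>)"
  by (simp add: lower_def partition_conjugate)

lemma col_lower:
  assumes "1 \<le> c"
  shows "col c (lower i \<pi>) = 2 * col c (delta_part \<pi>) + col c (ord (part \<pi> (i + 1)))"
  unfolding lower_def using assms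
  by (subst col_conjugate_map) (auto simp: col_antimono add_mono col_eq_0 simp flip: col_double)

lemma calX_at_ledge: "calX_at i \<pi> = ledge i (ord (part \<pi> i)) (lower i \<pi>)"
  by (simp add: calX_at_def stack_def flip_def ledge_def lower_def forget_def)

lemma triple_regular2: "triple \<pi> \<Longrightarrow> regular2 (ord (part \<pi> i))"
  by (simp add: triple_def regular2_def partition_ord distinct_ord)

lemma calX_at_UL: "triple \<pi> \<Longrightarrow> calX_at i \<pi> \<in> UL"
  unfolding calX_at_ledge by (intro ledge_UL triple_regular2 partition_lower)

lemma calY_calX_at:
  assumes t: "triple \<pi>"
  shows "calY_at i (calX_at i \<pi>) = \<pi>"
proof -
  have p: "partition (part \<pi> j)" "partition (delta_part \<pi>)" for j using t by (auto simp: triple_def)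
  have "calY_at i (calX_at i \<pi>) =
      \<lparr>part = (\<lambda>j. if j = i then calc (ord (part \<pi> i)) else calc (ord (part \<pi> (i + 1)))), delta_part = delta_part \<pi>\<rparr>"
    unfolding calX_at_ledge by (intro calY_ledge triple_regular2 t partition_lower p col_lower)
  also have "(\<lambda>j. if j = i then calc (ord (part \<pi> i)) else calc (ord (part \<pi> (i + 1)))) = part \<pi>"
    using bit_neq_iff[of _ i] by (auto simp: fun_eq_iff calc_ord p)
  finally show ?thesis by simp
qed

text \<open>\<open>\<nu>\<close> is the 2-regular partition with the column parities of
  \<open>M\<close>. Where a column of \<open>\<nu>\<close> is longer than the next one, it is so by
  one box and the parity changes, so \<open>M\<close> drops there as well. Hence the differences of
  column lengths are even, nonnegative and weakly decreasing.\<close>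

lemma halve_difference:
  assumes M: "partition M"
  obtains \<delta> \<nu> where "regular2 \<nu>" "partition \<delta>" "\<And>c. 1 \<le> c \<Longrightarrow> col c M = 2 * col c \<delta> + col c \<nu>"
proof -
  define \<nu> where "\<nu> = strict_of (odd_word M)"
  have \<nu>: "regular2 \<nu>" by (simp add: \<nu>_def regular2_def partition_strict_of distinct_strict_of)
  have odd: "odd (col c M) \<longleftrightarrow> odd (col c \<nu>)" if "1 \<le> c" for c
    using that by (cases "c \<le> width M")
      (auto simp: \<nu>_def odd_col_strict_of odd_word_def col_eq_0 simp del: upt_Suc)
  have step: "col c \<nu> + col (Suc c) M \<le> col c M + col (Suc c) \<nu>" if "1 \<le> c" for c
    using regular2_col[OF \<nu>, of c] col_antimono[of c "Suc c" M] odd[of c] odd[of "Suc c"] that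
    by (cases "col c M = col (Suc c) M") auto
  have le: "col c \<nu> \<le> col c M" if "1 \<le> c" for c
  proof (cases "c \<le> Suc (width \<nu>)")
    case True
    then show ?thesis using that
    proof (induction c rule: inc_induct)
      case (step c)
      then show ?case using \<open>1 \<le> c\<close> step.IH \<open>\<And>c. 1 \<le> c \<Longrightarrow> col c \<nu> + col (Suc c) M \<le> col c M + col (Suc c) \<nu>\<close>[of c] by simp
    qed (simp add: col_eq_0)
  qed (simp add: col_eq_0)
  define f where "f = (\<lambda>c. (col c M - col c \<nu>) div 2)"
  have anti: "f t \<le> f s" if "1 \<le> s" "s \<le> t" for s t
    using that(2)
  proof (induction t rule: dec_induct)
    case (step t)
    have "1 \<le> t" using step.hyps that by simp
    then have "col (Suc t) M - col (Suc t) \<nu> \<le> col t M - col t \<nu>"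
      using \<open>\<And>c. 1 \<le> c \<Longrightarrow> col c \<nu> + col (Suc c) M \<le> col c M + col (Suc c) \<nu>\<close>[of t] le[of t] le[of "Suc t"] by simp
    then have "f (Suc t) \<le> f t" unfolding f_def by (rule div_le_mono)
    with step.IH show ?case by simp
  qed simp
  define \<delta> where "\<delta> = conjugate (map f [1..<Suc (width M)])"
  have "col c M = 2 * col c \<delta> + col c \<nu>" if "1 \<le> c" for c
  proof -
    have "even (col c M - col c \<nu>)" using odd[OF that] by auto
    then have "col c M = 2 * f c + col c \<nu>" using le[OF that] by (auto simp: f_def)
    moreover have "col c \<delta> = f c"
      unfolding \<delta>_def using that anti by (subst col_conjugate_map) (auto simp: f_def col_eq_0)
    ultimately show ?thesis by simp
  qed
  moreover have "partition \<delta>" by (simp add: \<delta>_def partition_conjugate)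
  ultimately show thesis using that \<nu> by blast
qed

lemma calX_at_surj:
  assumes "D \<in> UL"
  obtains \<pi> where "triple \<pi>" "calX_at i \<pi> = D"
proof -
  from UL_ledge[OF assms, of i] obtain U M where UM: "regular2 U" "partition M" and D: "D = ledge i U M" .
  from halve_difference[OF UM(2)] obtain \<delta> \<nu> where
    d: "regular2 \<nu>" "partition \<delta>" "\<And>c. 1 \<le> c \<Longrightarrow> col c M = 2 * col c \<delta> + col c \<nu>" by blast
  define \<pi> where "\<pi> = \<lparr>part = (\<lambda>j. if j = i then calc U else calc \<nu>), delta_part = \<delta>\<rparr>"
  have t: "triple \<pi>" using d by (simp add: triple_def \<pi>_def partition_calc)
  have o: "ord (calc U) = U" "ord (calc \<nu>) = \<nu>" using UM d by (simp_all add: regular2_def ord_calc)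
  have "i + 1 \<noteq> i" by (cases i) auto
  then have "lower i \<pi> = M"
    using d(3) o by (intro partition_eqI partition_lower UM(2)) (simp add: col_lower \<pi>_def)
  then have "calX_at i \<pi> = D" by (simp add: calX_at_ledge D) (simp add: \<pi>_def o)
  with t show thesis by (rule that)
qed

subsection \<open>Contents\<close>

lemma dg_content_append: "dg_content (D @ E) = dg_content D + dg_content E"
  and dg_content_rev: "dg_content (rev D) = dg_content D"
  by (simp_all add: dg_content_def rev_map[symmetric] sum_list_rev)

lemma dg_content_color:
  "dg_content (color i ds) =
    scale (int (fst (alt_sums ds))) (simple_root i) + scale (int (snd (alt_sums ds))) (simple_root (i + 1))"
  by (induction ds arbitrary: i) (simp_all add: dg_content_def scale_add algebra_simps)

lemma alt_sums_cols:
  assumes "partition ds" "width ds \<le> n"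
  shows "alt_sums ds = (\<Sum>c=1..n. Suc (col c ds) div 2, \<Sum>c=1..n. col c ds div 2)"
  using assms
proof (induction ds)
  case (Cons d ds)
  have d: "width ds \<le> d" "d \<le> n" "partition ds"
    using Cons.prems by (auto simp: partition_Cons width_le)
  have "(\<Sum>c=1..n. of_bool (c \<le> d)) = (\<Sum>c\<in>{1..d}. 1 :: nat)"
    using d by (intro sum.mono_neutral_cong_right) auto
  then have s: "(\<Sum>c=1..n. of_bool (c \<le> d) + col c ds div 2) = d + (\<Sum>c=1..n. col c ds div 2)"
    by (simp add: sum.distrib)
  have "(\<Sum>c=1..n. Suc (col c (d # ds)) div 2) = (\<Sum>c=1..n. of_bool (c \<le> d) + col c ds div 2)"
    using d(1) by (intro sum.cong) (auto simp: col_Cons col_eq_0)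
  moreover have "(\<Sum>c=1..n. col c (d # ds) div 2) = (\<Sum>c=1..n. Suc (col c ds) div 2)"
    using d(1) by (intro sum.cong) (auto simp: col_Cons col_eq_0)
  ultimately show ?case using Cons.IH d s by simp
qed simp

text \<open>Doubled columns contribute equally to both colours.\<close>

lemma alt_sums_lower:
  assumes "triple \<pi>"
  shows "alt_sums (lower i \<pi>) = (sum_list (delta_part \<pi>) + fst (alt_sums (ord (part \<pi> (i + 1)))),
    sum_list (delta_part \<pi>) + snd (alt_sums (ord (part \<pi> (i + 1)))))"
proof -
  define n where "n = max (width (lower i \<pi>)) (max (width (delta_part \<pi>)) (width (ord (part \<pi> (i + 1)))))"
  have n: "width (lower i \<pi>) \<le> n" "width (delta_part \<pi>) \<le> n" "width (ord (part \<pi> (i + 1))) \<le> n"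
    by (auto simp: n_def)
  have "(\<Sum>c=1..n. Suc (col c (lower i \<pi>)) div 2) =
      (\<Sum>c=1..n. col c (delta_part \<pi>)) + (\<Sum>c=1..n. Suc (col c (ord (part \<pi> (i + 1)))) div 2)"
    unfolding sum.distrib[symmetric] by (intro sum.cong) (auto simp: col_lower)
  moreover have "(\<Sum>c=1..n. col c (lower i \<pi>) div 2) =
      (\<Sum>c=1..n. col c (delta_part \<pi>)) + (\<Sum>c=1..n. col c (ord (part \<pi> (i + 1))) div 2)"
    unfolding sum.distrib[symmetric] by (intro sum.cong) (auto simp: col_lower)
  ultimately show ?thesis
    using alt_sums_cols[OF partition_lower n(1)] sum_list_col[OF n(2)]
      alt_sums_cols[OF _ n(3)] triple_regular2[OF assms, of "i + 1"]
    by (simp add: regular2_def)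
qed

lemma dg_content_calX:
  assumes t: "triple \<pi>"
  shows "dg_content (calX_at 1 \<pi>) = rp_content \<pi>"
  unfolding calX_at_ledge ledge_def dg_content_append dg_content_rev dg_content_color alt_sums_lower[OF t]
    rp_content_eq root_sum_def multiplicity_ord[OF t]
  by (simp add: scale_add algebra_simps)

subsection \<open>The two descriptions of a diagram\<close>

lemma lower_leading:
  assumes d: "\<And>c. 1 \<le> c \<Longrightarrow> 2 * col c (delta_part \<phi>) + col c (ord (part \<phi> (j + 1))) =
      of_bool (c \<le> N) + (2 * col c (delta_part \<pi>) + col c (ord (part \<pi> (i + 1))))"
    and N: "0 < N" and w: "width (lower i \<pi>) \<le> N"
  shows "lower j \<phi> = N # lower i \<pi>"
  using d N w by (intro partition_eqI) (auto simp: partition_lower partition_Cons col_lower col_Cons)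

lemma width_lower_le:
  assumes "width (delta_part \<pi>) \<le> N" "width (ord (part \<pi> (i + 1))) \<le> N"
  shows "width (lower i \<pi>) \<le> N"
proof (rule ccontr)
  assume "\<not> width (lower i \<pi>) \<le> N"
  then have "0 < col (width (lower i \<pi>)) (lower i \<pi>)" by (simp add: col_pos_iff)
  with assms \<open>\<not> width (lower i \<pi>) \<le> N\<close> show False by (simp add: col_lower col_eq_0)
qed

lemma related_calX_leading:
  assumes i: "j = i + 1" and m: "mates N (part \<pi> i) (part \<phi> j)" "mates N (part \<pi> j) (part \<phi> i)"
    and w: "width (delta_part \<pi>) \<le> N" and N: "0 < N"
    and l: "leading N (part \<pi> i)"
    and d: "leading N (part \<pi> j) \<Longrightarrow> delta_part \<phi> = N # delta_part \<pi>"
      "\<not> leading N (part \<pi> j) \<Longrightarrow> delta_part \<pi> = delta_part \<phi>"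
  shows "calX_at i \<pi> = calX_at j \<phi>"
proof -
  have e: "i + 1 = j" "j + 1 = i" using i by simp_all
  have o: "ord (part \<pi> i) = N # ord (part \<phi> j)" using mates_leading[OF m(1) N] l by blast
  have "lower j \<phi> = N # lower i \<pi>"
  proof (rule lower_leading[OF _ N])
    show "width (lower i \<pi>) \<le> N" using w mates_ord_width[OF m(2)] by (intro width_lower_le) (auto simp only: e)
    fix c :: nat
    show "2 * col c (delta_part \<phi>) + col c (ord (part \<phi> (j + 1))) =
      of_bool (c \<le> N) + (2 * col c (delta_part \<pi>) + col c (ord (part \<pi> (i + 1))))"
    proof (cases "leading N (part \<pi> j)")
      case True
      then have "ord (part \<pi> j) = N # ord (part \<phi> i)" using mates_leading[OF m(2) N] by blast
      with True show ?thesis using d(1) unfolding e by (simp add: col_Cons)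
    next
      case False
      then have "ord (part \<phi> i) = N # ord (part \<pi> j)" using mates_leading[OF m(2) N] by blast
      with False show ?thesis using d(2) unfolding e by (simp add: col_Cons)
    qed
  qed
  then show ?thesis unfolding calX_at_ledge ledge_def o
    by (simp only: e color.simps rev.simps append_assoc append_Cons append_Nil)
qed

text \<open>For \<open>0 < N\<close> exactly one of the mates \<open>part \<pi> 1\<close> and
  \<open>part \<phi> 0\<close> has the row of length \<open>N\<close>; the argument starts from that
  side and the other case follows by symmetry.\<close>

lemma related_imp_calX:
  assumes r: "mv_related N \<pi> \<phi>"
  shows "calX_at 1 \<pi> = calX_at 0 \<phi>"
proof -
  note m = mv_relatedD[OF r]
  show ?thesis
  proof (cases "N = 0")
    case True
    have e: "part \<pi> i = []" "part \<phi> i = []" for i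
      using mates_0 m(3,4) True by (cases i; auto)+
    have "wpart [] = []" by (simp add: wpart_def conjugate_def)
    then have o: "ord [] = []" using ord_wpart[of "[]"] by (simp add: strict_of_def)
    have "delta_part \<pi> = []" "delta_part \<phi> = []"
      using m True by (auto simp: triple_def intro!: width_0_imp)
    then show ?thesis by (simp add: calX_at_ledge ledge_def lower_def e o double_def conjugate_def)
  next
    case False
    then have N: "0 < N" by simp
    show ?thesis
    proof (cases "leading N (part \<pi> 1)")
      case True
      then show ?thesis
        using mv_related_delta(1,3)[OF r N]
        by (intro related_calX_leading[OF _ m(3,4,5) N]) simp_all
    next
      case False
      have l: "leading N (part \<phi> 0)" "leading N (part \<phi> 1) \<longleftrightarrow> \<not> leading N (part \<pi> 0)"
        using False mates_leading_iff[OF m(3) N] mates_leading_iff[OF m(4) N] by auto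
      show ?thesis
      proof (rule related_calX_leading[OF _ mates_sym[OF m(3)] mates_sym[OF m(4)] m(6) N l(1), symmetric])
        show "delta_part \<pi> = N # delta_part \<phi>" if "leading N (part \<phi> 1)"
          using that l False by (intro mv_related_delta(2)[OF r N]) simp_all
        show "delta_part \<phi> = delta_part \<pi>" if "\<not> leading N (part \<phi> 1)"
          using that l False by (intro mv_related_delta(3)[OF r N, symmetric]) simp
      qed simp
    qed
  qed
qed

section \<open>Crystal operators: filling or emptying one box of a word\<close>

section \<open>Crystal operators\<close>

lemma draw_arcs_snoc:
  "draw_arcs k i us (bs @ [b]) =
    (let us' = draw_arcs k i us bs in
     if us' \<noteq> [] \<and> k (hd us') = i \<and> k b = i + 1 then tl us' else b # us')"
  by (induction bs arbitrary: us) (auto simp: Let_def)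

text \<open>The stack consists of unmatched boxes of colour \<open>i\<close> on top of unmatched boxes of the other
  colour.\<close>

lemma draw_arcs_word:
  "\<exists>ss gs. draw_arcs k i [] (rev xs) = ss @ gs \<and> (\<forall>b\<in>set ss. k b = i) \<and> (\<forall>b\<in>set gs. k b \<noteq> i) \<and>
     length ss = load 0 (map (\<lambda>b. k b = i) xs) \<and>
     (ss \<noteq> [] \<longrightarrow> (\<exists>u v. xs = u @ last ss # v \<and>
        load 0 (map (\<lambda>b. k b = i) v) = 0 \<and> all_matched (map (\<lambda>b. k b = i) u))) \<and>
     (gs \<noteq> [] \<longrightarrow> (\<exists>u v. xs = u @ hd gs # v \<and>
        load 0 (map (\<lambda>b. k b = i) v) = 0 \<and> all_matched (map (\<lambda>b. k b = i) u))) \<and>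
     (gs = [] \<longrightarrow> all_matched (map (\<lambda>b. k b = i) xs))"
proof (induction xs)
  case (Cons b xs)
  let ?w = "map (\<lambda>b. k b = i)"
  from Cons.IH obtain ss gs where IH: "draw_arcs k i [] (rev xs) = ss @ gs"
    "\<forall>b\<in>set ss. k b = i" "\<forall>b\<in>set gs. k b \<noteq> i" "length ss = load 0 (?w xs)"
    and S: "ss \<noteq> [] \<Longrightarrow> \<exists>u v. xs = u @ last ss # v \<and> load 0 (?w v) = 0 \<and> all_matched (?w u)"
    and G: "gs \<noteq> [] \<Longrightarrow> \<exists>u v. xs = u @ hd gs # v \<and> load 0 (?w v) = 0 \<and> all_matched (?w u)"
    and E: "gs = [] \<Longrightarrow> all_matched (?w xs)"
    by blast
  have step: "draw_arcs k i [] (rev (b # xs)) =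
      (if ss @ gs \<noteq> [] \<and> k (hd (ss @ gs)) = i \<and> k b = i + 1 then tl (ss @ gs) else b # ss @ gs)"
    by (simp add: draw_arcs_snoc IH(1) Let_def)
  consider "k b = i" | "k b = i + 1" "ss \<noteq> []" | "k b = i + 1" "ss = []"
    using bit_neq_iff[of "k b" i] by blast
  then show ?case
  proof cases
    case 1
    have b: "i \<noteq> i + 1" by (cases i) auto
    have "\<exists>u v. b # xs = u @ last (b # ss) # v \<and> load 0 (?w v) = 0 \<and> all_matched (?w u)"
    proof (cases "ss = []")
      case True
      then show ?thesis using IH(4) by (intro exI[of _ "[]"] exI[of _ xs]) simp
    next
      case False
      with S obtain u v where "xs = u @ last ss # v" "load 0 (?w v) = 0" "all_matched (?w u)" by blast
      with False 1 show ?thesis by (intro exI[of _ "b # u"] exI[of _ v]) simp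
    qed
    moreover have "\<exists>u v. b # xs = u @ hd gs # v \<and> load 0 (?w v) = 0 \<and> all_matched (?w u)" if "gs \<noteq> []"
    proof -
      from G[OF that] obtain u v where "xs = u @ hd gs # v" "load 0 (?w v) = 0" "all_matched (?w u)" by blast
      with 1 show ?thesis by (intro exI[of _ "b # u"] exI[of _ v]) simp
    qed
    ultimately show ?thesis
      using 1 IH E step b by (intro exI[of _ "b # ss"] exI[of _ gs]) auto
  next
    case 2
    have b: "k b \<noteq> i" using 2 by (cases i) auto
    have pos: "0 < load 0 (?w xs)" using 2 IH(4) by (metis length_greater_0_conv)
    obtain s ss' where ss: "ss = s # ss'" using 2 by (cases ss) auto
    have "\<exists>u v. b # xs = u @ last ss' # v \<and> load 0 (?w v) = 0 \<and> all_matched (?w u)" if "ss' \<noteq> []"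
    proof -
      from S[OF 2(2)] obtain u v where uv: "xs = u @ last ss # v" "load 0 (?w v) = 0" "all_matched (?w u)" by blast
      have "k (last ss) = i" using IH(2) 2(2) by simp
      \<comment> \<open>The load exceeds that of \<open>u\<close> by one and is at least 2, so the
        new empty box still meets a loaded carrier after \<open>u\<close>.\<close>
      then have "load 0 (?w xs) = Suc (load 0 (?w u))"
        using uv by (simp add: load_append all_matched_load)
      moreover have "2 \<le> length ss" using that ss by (cases ss') auto
      ultimately have "0 < load 0 (?w u)" using IH(4) by simp
      with uv that ss show ?thesis by (intro exI[of _ "b # u"] exI[of _ v]) simp
    qed
    moreover have "\<exists>u v. b # xs = u @ hd gs # v \<and> load 0 (?w v) = 0 \<and> all_matched (?w u)" if "gs \<noteq> []"
    proof -
      from G[OF that] obtain u v where uv: "xs = u @ hd gs # v" "load 0 (?w v) = 0" "all_matched (?w u)" by blast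
      have "k (hd gs) \<noteq> i" using IH(3) that by simp
      then have "0 < load 0 (?w u)" using pos uv by (simp add: load_append)
      with uv show ?thesis by (intro exI[of _ "b # u"] exI[of _ v]) simp
    qed
    moreover have "draw_arcs k i [] (rev (b # xs)) = ss' @ gs"
      using step 2 IH(2) ss by simp
    moreover have "\<forall>b\<in>set ss'. k b = i" "length ss' = load 0 (?w (b # xs))"
      using IH(2,4) ss b by simp_all
    moreover have "all_matched (?w (b # xs))" if "gs = []" using E[OF that] pos b by simp
    ultimately show ?thesis using IH(3) by blast
  next
    case 3
    have b: "k b \<noteq> i" using 3 by (cases i) auto
    have z: "load 0 (?w xs) = 0" using 3 IH(4) by simp
    have "draw_arcs k i [] (rev (b # xs)) = b # gs"
      using step 3 IH(3) by (cases gs) auto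
    then show ?thesis
      using 3 b IH z by (intro exI[of _ "[]"] exI[of _ "b # gs"]) (auto intro: exI[of _ "[]"])
  qed
qed simp

text \<open>The last letter is met by the carrier at its start, when it is empty.\<close>

lemma all_matched_last: "all_matched u \<Longrightarrow> u = [] \<or> last u"
  by (induction u) auto

lemma load_0_hd: "load 0 v = 0 \<Longrightarrow> v = [] \<or> \<not> hd v"
  by (cases v) auto

subsection \<open>Adding a row of length 1 to the lower part\<close>

lemma regular2_col_agree:
  assumes "regular2 \<nu>" "regular2 \<nu>'" "odd (col t \<nu>) = odd (col t \<nu>')" "col (Suc t) \<nu> = col (Suc t) \<nu>'"
  shows "col t \<nu> = col t \<nu>'"
  using regular2_col[OF assms(1), of t] regular2_col[OF assms(2), of t] assms(3,4) by simp

lemma regular2_strict_of: "regular2 (strict_of w)"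
  by (simp add: regular2_def partition_strict_of distinct_strict_of)

text \<open>The letter before the box is a ball and the letter after it is empty. Filling the box
  shifts one change of letter by one place: a row grows from length \<open>length u\<close> to
  \<open>Suc (length u)\<close>, or a row of length 1 appears if \<open>u\<close> is empty.\<close>

lemma col_strict_of_fill:
  assumes "u = [] \<or> last u" "v = [] \<or> \<not> hd v" "1 \<le> t"
  shows "col t (strict_of (u @ True # v)) = col t (strict_of (u @ False # v)) + of_bool (t = Suc (length u))"
proof -
  define c where "c = Suc (length u)"
  define \<nu> where "\<nu> = strict_of (u @ False # v)"
  define \<nu>' where "\<nu>' = strict_of (u @ True # v)"
  have r: "regular2 \<nu>" "regular2 \<nu>'" by (simp_all add: \<nu>_def \<nu>'_def regular2_strict_of)
  have agree: "odd (col s \<nu>') = odd (col s \<nu>)" if "1 \<le> s" "s \<noteq> c" for s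
    using that by (auto simp: \<nu>_def \<nu>'_def c_def odd_col_strict_of nth_append nth_Cons')
  have c: "even (col c \<nu>)" "odd (col c \<nu>')"
    using odd_col_strict_of[of c "u @ False # v"] odd_col_strict_of[of c "u @ True # v"]
    by (simp_all add: \<nu>_def \<nu>'_def c_def)
  have c1: "even (col (Suc c) \<nu>)"
    using assms(2) odd_col_strict_of[of "Suc c" "u @ False # v"]
    by (cases v) (auto simp: \<nu>_def c_def nth_append)
  have above: "col s \<nu>' = col s \<nu>" if "c < s" for s
  proof (cases "s \<le> Suc (length u + Suc (length v))")
    case True
    then show ?thesis using that
    proof (induction s rule: inc_induct)
      case base
      have "width \<nu> < Suc (length u + Suc (length v))" "width \<nu>' < Suc (length u + Suc (length v))"
        using width_strict_of[of "u @ False # v"] width_strict_of[of "u @ True # v"]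
        by (simp_all add: \<nu>_def \<nu>'_def)
      then show ?case by (simp add: col_eq_0)
    next
      case (step s)
      have "odd (col s \<nu>') = odd (col s \<nu>)" by (rule agree) (use step.prems in simp_all)
      moreover have "col (Suc s) \<nu>' = col (Suc s) \<nu>" using step.IH step.prems by simp
      ultimately show ?case by (rule regular2_col_agree[OF r(2,1)])
    qed
  next
    case False
    then have "width \<nu> < s" "width \<nu>' < s"
      using width_strict_of[of "u @ False # v"] width_strict_of[of "u @ True # v"]
      by (simp_all add: \<nu>_def \<nu>'_def)
    then show ?thesis by (simp add: col_eq_0)
  qed
  have at: "col c \<nu>' = Suc (col c \<nu>)"
    using regular2_col[OF r(1), of c] regular2_col[OF r(2), of c] above[of "Suc c"] c c1 by auto
  have below: "col s \<nu>' = col s \<nu>" if "1 \<le> s" "s < c" for s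
  proof -
    have "s \<le> length u" using that by (simp add: c_def)
    then show ?thesis using \<open>1 \<le> s\<close>
    proof (induction s rule: inc_induct)
      case base
      then have od: "odd (col (length u) \<nu>)"
        using assms(1) odd_col_strict_of[of "length u" "u @ False # v"]
        by (cases u rule: rev_cases) (simp_all add: \<nu>_def nth_append)
      moreover have "odd (col (length u) \<nu>')"
        using od agree[of "length u"] base by (simp add: c_def)
      moreover have "Suc (length u) = c" by (simp add: c_def)
      ultimately show ?case
        using regular2_col[OF r(1), of "length u"] regular2_col[OF r(2), of "length u"] c at by simp
    next
      case (step s)
      have "odd (col s \<nu>') = odd (col s \<nu>)"
        by (rule agree) (use step.prems step.hyps in \<open>simp_all add: c_def\<close>)
      moreover have "col (Suc s) \<nu>' = col (Suc s) \<nu>" using step.IH by simp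
      ultimately show ?case by (rule regular2_col_agree[OF r(2,1)])
    qed
  qed
  show ?thesis
    using above[of t] at below[of t] assms(3) unfolding c_def[symmetric] \<nu>_def[symmetric] \<nu>'_def[symmetric]
    by (cases "t < c"; cases "t = c") auto
qed

lemma triple_add_row1: "triple \<pi> \<Longrightarrow> triple (add_row1 i \<pi>)"
  by (auto simp: triple_def add_row1_def partition_def sorted_wrt_append Suc_le_eq intro: gr0I)

text \<open>All entries after a first 1 are 1 as well, so \<open>remove1\<close> has the effect of
  deleting the last entry.\<close>

lemma add_row1_del_row1:
  assumes t: "triple \<pi>" and pos: "0 < count_list (part \<pi> i) 1"
  shows "triple (del_row1 i \<pi>)" "add_row1 i (del_row1 i \<pi>) = \<pi>"
proof -
  have p: "partition (part \<pi> j)" for j using t by (simp add: triple_def)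
  have mem: "1 \<in> set (part \<pi> i)" using pos by (metis count_list_0_iff less_irrefl)
  have split: "\<exists>ys. xs = ys @ [1] \<and> remove1 1 xs = ys \<and> partition ys" if "partition xs" "1 \<in> set xs" for xs :: "nat list"
    using that
  proof (induction xs)
    case (Cons x xs)
    show ?case
    proof (cases "1 \<in> set xs")
      case True
      then obtain ys where ys: "xs = ys @ [1]" "remove1 1 xs = ys" "partition ys"
        using Cons by (auto simp: partition_Cons)
      have "partition (x # ys)" using Cons.prems ys by (auto simp: partition_Cons width_le)
      moreover have "remove1 1 (x # xs) = x # ys"
      proof (cases "x = 1")
        case True
        then have "set xs \<subseteq> {1}" using Cons.prems by (auto simp: partition_def le_Suc_eq)
        then have "ys = replicate (length ys) 1" using ys(1) by (intro replicate_eqI) auto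
        then have "xs = 1 # ys" using ys(1) by (metis replicate_append_same)
        with True show ?thesis by simp
      qed (use ys in simp)
      ultimately show ?thesis using ys by auto
    next
      case False
      with Cons.prems have x: "x = 1" by auto
      have "xs = []"
      proof (cases xs)
        case (Cons y zs)
        with Cons.prems x False show ?thesis by (auto simp: partition_def le_Suc_eq)
      qed
      with x show ?thesis by simp
    qed
  qed simp
  from split[OF p mem] obtain ys where ys: "part \<pi> i = ys @ [1]" "remove1 1 (part \<pi> i) = ys" "partition ys" by blast
  show "triple (del_row1 i \<pi>)" using t ys by (auto simp: triple_def del_row1_def)
  show "add_row1 i (del_row1 i \<pi>) = \<pi>"
  proof -
    have "(part \<pi>)(i := remove1 1 (part \<pi> i) @ [1]) = part \<pi>"
      using ys by (metis fun_upd_triv)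
    then show ?thesis unfolding add_row1_def del_row1_def by simp
  qed
qed

lemma col_lower_add_row1:
  assumes t: "triple \<pi>" and p: "part \<pi> (i + 1) = wpart (u @ False # v)"
    and m: "all_matched u" "load 0 v = 0" and "1 \<le> t"
  shows "col t (lower i (add_row1 (i + 1) \<pi>)) = col t (lower i \<pi>) + of_bool (t = Suc (length u))"
proof -
  have "part (add_row1 j \<pi>) j = part \<pi> j @ [1]" for j
    by (simp add: add_row1_def)
  then have "part (add_row1 (i + 1) \<pi>) (i + 1) = wpart (u @ True # v)"
    unfolding p wpart_fill[OF m] by (metis p)
  moreover have d: "delta_part (add_row1 (i + 1) \<pi>) = delta_part \<pi>"
    by (simp add: add_row1_def)
  ultimately show ?thesis
    using col_strict_of_fill[OF all_matched_last[OF m(1)] load_0_hd[OF m(2)] \<open>1 \<le> t\<close>] \<open>1 \<le> t\<close>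
    by (simp only: col_lower p ord_wpart d add.assoc)
qed

lemma odd_col_lower:
  assumes "part \<pi> (i + 1) = wpart w" "1 \<le> t"
  shows "odd (col t (lower i \<pi>)) \<longleftrightarrow> t \<le> length w \<and> w ! (t - 1)"
  using assms by (simp only: col_lower assms(1) ord_wpart) (simp add: odd_col_strict_of)

text \<open>The row at index \<open>col c M\<close>, the first one shorter than \<open>c\<close>, has length \<open>c - 1\<close> by parity,
  and is missing only if \<open>c = 1\<close>.\<close>

lemma fill_row:
  assumes M: "partition M" and M': "partition M'"
    and c: "1 \<le> c" "even (col c M)" "c = 1 \<or> odd (col (c - 1) M)"
    and cols: "\<And>t. 1 \<le> t \<Longrightarrow> col t M' = col t M + of_bool (t = c)"
  obtains "col c M < length M" "M ! col c M = c - 1" "1 < c" "M' = M[col c M := c]"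
  | "col c M = length M" "c = 1" "M' = M @ [c]"
proof -
  let ?k = "col c M"
  have s: "sorted_wrt (\<ge>) M" and pos: "0 \<notin> set M" using M by (auto simp: partition_def)
  show thesis
  proof (cases "c = 1")
    case True
    then have "?k = length M" using length_eq_col[OF M] by simp
    moreover have "M' = M @ [c]"
      using True M cols
      by (intro partition_eqI M') (auto simp: partition_def sorted_wrt_append Suc_le_eq col_append col_Cons intro: gr0I)
    ultimately show ?thesis using that True by blast
  next
    case False
    \<comment> \<open>The two columns have different parities, so their lengths differ.\<close>
    then have "?k < col (c - 1) M"
      using c col_antimono[of "c - 1" c M] by (cases "col (c - 1) M = ?k") auto
    then have k: "?k < length M" using col_le_length[of "c - 1" M] by simp
    have "c - 1 \<le> M ! ?k" using nth_ge_iff_col[OF s k, of "c - 1"] \<open>?k < col (c - 1) M\<close> by simp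
    moreover have "\<not> c \<le> M ! ?k" using nth_ge_iff_col[OF s k, of c] by simp
    ultimately have Mk: "M ! ?k = c - 1" by simp
    have "partition (M[?k := c])"
    proof -
      have "M[?k := c] ! p \<ge> M[?k := c] ! q" if "p < q" "q < length M" for p q
      proof (cases "q = ?k")
        case True
        then show ?thesis using nth_ge_iff_col[OF s, of p c] that by simp
      next
        case False
        have "M ! p \<ge> M ! q" using s that by (simp add: sorted_wrt_iff_nth_less)
        then show ?thesis using False Mk c(1) k by (cases "p = ?k") auto
      qed
      moreover have "0 \<notin> set (M[?k := c])"
        using pos c(1) set_update_subset_insert[of M ?k c] by auto
      ultimately show ?thesis by (simp add: partition_def sorted_wrt_iff_nth_less)
    qed
    moreover have "col t (M[?k := c]) = col t M + of_bool (t = c)" for t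
    proof -
      have "col t M = col t (take ?k M) + of_bool (t \<le> c - 1) + col t (drop (Suc ?k) M)"
        using arg_cong[OF id_take_nth_drop[OF k], of "col t"] Mk by (simp add: col_append col_Cons)
      moreover have "col t (M[?k := c]) = col t (take ?k M) + of_bool (t \<le> c) + col t (drop (Suc ?k) M)"
        using k by (simp add: upd_conv_take_nth_drop col_append col_Cons)
      ultimately show ?thesis using False c(1) by auto
    qed
    ultimately have "M' = M[?k := c]" using cols by (intro partition_eqI M') auto
    then show ?thesis using that k Mk False c(1) by simp
  qed
qed

lemma color_append: "color i (xs @ ys) = color i xs @ color (if even (length xs) then i else i + 1) ys"
  by (induction xs arbitrary: i) auto

lemma color_update: "k < length M \<Longrightarrow> color i (M[k := c]) = (color i M)[k := (c, if even k then i else i + 1)]"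
  by (intro nth_equalityI) (auto simp: nth_color nth_list_update)

lemma ledge_update:
  assumes "k < length M" "even k"
  shows "ledge i U (M[k := c]) = (ledge i U M)[length U + k := (c, i + 1)]"
  using assms by (simp add: ledge_def color_update list_update_append)

lemma ledge_snoc: "even (length M) \<Longrightarrow> ledge i U (M @ [c]) = ledge i U M @ [(c, i + 1)]"
  by (simp add: ledge_def color_append)

text \<open>The added box ends the row \<open>col c M\<close> below the cut. This index is even, so
  the row has colour \<open>i + 1\<close>, and its box in column \<open>c\<close> lies directly
  below the former bottom box of that column, if there is one.\<close>

lemma calX_at_add_row1:
  assumes t: "triple \<pi>" and p: "part \<pi> (i + 1) = wpart (u @ False # v)"
    and m: "all_matched u" "load 0 v = 0"
  defines "U \<equiv> ord (part \<pi> i)" and "M \<equiv> lower i \<pi>" and "c \<equiv> Suc (length u)"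
  obtains "col c M < length M" "even (col c M)" "M ! col c M = c - 1" "1 < c"
      "calX_at i (add_row1 (i + 1) \<pi>) = (ledge i U M)[length U + col c M := (c, i + 1)]"
  | "col c M = length M" "even (col c M)" "c = 1" "calX_at i (add_row1 (i + 1) \<pi>) = ledge i U M @ [(c, i + 1)]"
proof -
  have "i + 1 \<noteq> i" by (cases i) auto
  then have "part (add_row1 (i + 1) \<pi>) i = part \<pi> i"
    by (simp add: add_row1_def)
  then have X: "calX_at i (add_row1 (i + 1) \<pi>) = ledge i U (lower i (add_row1 (i + 1) \<pi>))"
    by (simp only: calX_at_ledge U_def)
  have ev: "even (col c M)"
    using odd_col_lower[OF p, of c] by (simp add: M_def c_def)
  have od: "c = 1 \<or> odd (col (c - 1) M)"
    using all_matched_last[OF m(1)] odd_col_lower[OF p, of "length u"]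
    by (cases u rule: rev_cases) (auto simp: M_def c_def nth_append)
  show thesis
  proof (rule fill_row[of M "lower i (add_row1 (i + 1) \<pi>)" c])
    show "col t (lower i (add_row1 (i + 1) \<pi>)) = col t M + of_bool (t = c)" if "1 \<le> t" for t
      unfolding M_def c_def by (rule col_lower_add_row1[OF t p m that])
  next
    assume "col c M < length M" "M ! col c M = c - 1" "1 < c" "lower i (add_row1 (i + 1) \<pi>) = M[col c M := c]"
    then show thesis using that(1) ev X ledge_update[of "col c M" M i U c] by simp
  next
    assume "col c M = length M" "c = 1" "lower i (add_row1 (i + 1) \<pi>) = M @ [c]"
    then show thesis using that(2) ev X ledge_snoc[of M i U c] by simp
  qed (use ev od in \<open>simp_all add: M_def partition_lower c_def\<close>)
qed

subsection \<open>Words of the two boundaries\<close>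

lemma wpart_parities:
  assumes "regular2 \<nu>" "width \<nu> \<le> W"
  shows "wpart (map (\<lambda>c. odd (col c \<nu>)) [1..<Suc W]) = calc \<nu>"
proof -
  have "map (\<lambda>c. odd (col c \<nu>)) [Suc (width \<nu>)..<Suc W] = replicate (W - width \<nu>) False"
    by (intro replicate_eqI) (auto simp: col_eq_0)
  moreover have "[1..<Suc W] = [1..<Suc (width \<nu>)] @ [Suc (width \<nu>)..<Suc W]"
    using upt_add_eq_append[of 1 "Suc (width \<nu>)" "W - width \<nu>"] assms(2) by simp
  ultimately have "map (\<lambda>c. odd (col c \<nu>)) [1..<Suc W] = odd_word \<nu> @ replicate (W - width \<nu>) False"
    by (simp only: map_append odd_word_def)
  then show ?thesis by (simp only: wpart_append_replicate calc_odd_word)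
qed

definition total_width :: "bit \<Rightarrow> root_partition \<Rightarrow> nat" where
  "total_width i \<pi> = width (rev (ord (part \<pi> i)) @ lower i \<pi>)"

text \<open>Doubled columns do not affect parities, and empty boxes at the end do not affect the
  partition of a word.\<close>

lemma wpart_lower:
  assumes t: "triple \<pi>" and W: "total_width i \<pi> \<le> W"
  shows "wpart (map (\<lambda>c. odd (col c (lower i \<pi>))) [1..<Suc W]) = part \<pi> (i + 1)"
proof -
  let ?\<nu> = "ord (part \<pi> (i + 1))"
  have "width ?\<nu> \<le> W"
  proof (rule ccontr)
    assume "\<not> width ?\<nu> \<le> W"
    then have "0 < col (width ?\<nu>) ?\<nu>" "1 \<le> width ?\<nu>" by (auto simp: col_pos_iff)
    then have "width ?\<nu> \<le> width (lower i \<pi>)" using col_pos_iff[of "width ?\<nu>" "lower i \<pi>"] col_lower[of "width ?\<nu>" i \<pi>] by simp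
    with \<open>\<not> width ?\<nu> \<le> W\<close> W show False by (simp add: total_width_def width_append)
  qed
  then have "wpart (map (\<lambda>c. odd (col c ?\<nu>)) [1..<Suc W]) = part \<pi> (i + 1)"
    using t wpart_parities[OF triple_regular2[OF t]] by (simp add: triple_def calc_ord del: upt_Suc)
  moreover have "map (\<lambda>c. odd (col c (lower i \<pi>))) [1..<Suc W] = map (\<lambda>c. odd (col c ?\<nu>)) [1..<Suc W]"
    by (intro map_cong) (auto simp: col_lower)
  ultimately show ?thesis by (simp only:)
qed

lemma exits_0: "exits w 0 = load 0 w"
  by (simp add: exits_def)

lemma count_list_1_wpart: "count_list (wpart w) 1 = load 0 w"
  using count_wpart[of w 0] by (simp add: exits_0)

lemma filter_unarced:
  assumes "\<forall>b\<in>set ss. k b = (i :: bit)" "\<forall>b\<in>set gs. k b \<noteq> i"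
  shows "filter (\<lambda>b. k b = i) (ss @ gs) = ss" "filter (\<lambda>b. k b = i + 1) (ss @ gs) = gs"
proof -
  have "i + 1 \<noteq> i" by (cases i) auto
  then have *: "k b = i + 1 \<longleftrightarrow> k b \<noteq> i" for b using bit_neq_iff[of "k b" i] by auto
  show "filter (\<lambda>b. k b = i) (ss @ gs) = ss"
    using assms by (auto simp: filter_empty_conv filter_id_conv)
  show "filter (\<lambda>b. k b = i + 1) (ss @ gs) = gs"
    unfolding * using assms by (auto simp: filter_empty_conv filter_id_conv)
qed

text \<open>Boxes are read in the direction in which the carrier walks, so the unarced
  \<open>i\<close>-top boxes correspond to the balls that leave in the first step.\<close>

lemma unarced_top_calX:
  assumes t: "triple \<pi>"
  shows "ul_eps_star i (calX_at i \<pi>) = count_list (part \<pi> i) 1"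
proof -
  let ?U = "ord (part \<pi> i)" and ?M = "lower i \<pi>" and ?D = "calX_at i \<pi>" and ?W = "total_width i \<pi>"
  define g where "g = (\<lambda>c. (length ?U - col c ?U, c))"
  have top: "top_boxes ?D = rev (map g [1..<Suc ?W])"
    unfolding calX_at_ledge g_def total_width_def
    by (simp only: top_boxes_ledge[OF triple_regular2[OF t] partition_lower] rev_map)
  have word: "map (\<lambda>b. box_color ?D b = i) (map g [1..<Suc ?W]) = map (\<lambda>c. odd (col c ?U)) [1..<Suc ?W]"
    unfolding map_map
  proof (intro map_cong refl)
    fix c assume "c \<in> set [1..<Suc ?W]"
    then have "box_color ?D (g c) = (if odd (col c ?U) then i else i + 1)"
      unfolding calX_at_ledge g_def total_width_def by (intro box_color_top) auto
    then show "((\<lambda>b. box_color ?D b = i) \<circ> g) c = odd (col c ?U)" by (cases i) auto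
  qed
  obtain ss gs where "draw_arcs (box_color ?D) i [] (top_boxes ?D) = ss @ gs"
    "\<forall>b\<in>set ss. box_color ?D b = i" "\<forall>b\<in>set gs. box_color ?D b \<noteq> i"
    "length ss = load 0 (map (\<lambda>c. odd (col c ?U)) [1..<Suc ?W])"
    using draw_arcs_word[of "box_color ?D" i "map g [1..<Suc ?W]"] unfolding word top by blast
  then have "ul_eps_star i ?D = load 0 (map (\<lambda>c. odd (col c ?U)) [1..<Suc ?W])"
    unfolding ul_eps_star_def unarced_top_def by (simp only: filter_unarced)
  also have "\<dots> = count_list (calc ?U) 1"
    using wpart_parities[OF triple_regular2[OF t], of i ?W] count_list_1_wpart
    by (metis max.cobounded1 total_width_def width_append)
  finally show ?thesis using t by (simp add: triple_def calc_ord)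
qed

text \<open>Locates the box that \<open>e\<close> deletes and the box below which \<open>f\<close>
  adds one, together with the matching conditions on both sides under which filling a place adds a
  row of length 1.\<close>

lemma unarced_bottom_calX:
  fixes i :: bit and \<pi> :: root_partition
  assumes t: "triple \<pi>"
  defines "g \<equiv> \<lambda>c. (length (ord (part \<pi> i)) + col c (lower i \<pi>) - 1, c)"
    and "w \<equiv> map (\<lambda>c. odd (col c (lower i \<pi>)))" and "W \<equiv> total_width i \<pi>"
  obtains ss gs where "unarced_bottom (i + 1) (i + 1) (calX_at i \<pi>) = ss"
    "unarced_bottom (i + 1) i (calX_at i \<pi>) = gs"
    "length ss = count_list (part \<pi> (i + 1)) 1"
    "ss \<noteq> [] \<Longrightarrow> \<exists>c\<in>{1..W}. last ss = g c \<and> all_matched (w [1..<c]) \<and> odd (col c (lower i \<pi>)) \<and> load 0 (w [Suc c..<Suc W]) = 0"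
    "gs \<noteq> [] \<Longrightarrow> \<exists>c\<in>{1..W}. hd gs = g c \<and> all_matched (w [1..<c]) \<and> even (col c (lower i \<pi>)) \<and> load 0 (w [Suc c..<Suc W]) = 0"
    "gs = [] \<Longrightarrow> all_matched (w [1..<Suc W])"
proof -
  let ?D = "calX_at i \<pi>" and ?U = "ord (part \<pi> i)" and ?M = "lower i \<pi>"
  let ?b = "\<lambda>b. box_color ?D b = i + 1"
  have bot: "bottom_boxes ?D = rev (map g [1..<Suc W])"
    unfolding calX_at_ledge g_def W_def total_width_def
    by (simp only: bottom_boxes_ledge[OF triple_regular2[OF t] partition_lower] rev_map)
  have color: "?b (g c) \<longleftrightarrow> odd (col c ?M)" if "1 \<le> c" "c \<le> W" for c
  proof -
    have "box_color ?D (g c) = (if odd (col c ?M) then i + 1 else i)"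
      using that unfolding calX_at_ledge g_def W_def total_width_def by (intro box_color_bottom) auto
    then show ?thesis by (cases i) auto
  qed
  have word: "map ?b (map g cs) = w cs" if "set cs \<subseteq> {1..W}" for cs
    unfolding map_map w_def using that color by (intro map_cong) auto
  have split: "\<exists>c\<in>{1..W}. x = g c \<and> u = map g [1..<c] \<and> v = map g [Suc c..<Suc W]"
    if "map g [1..<Suc W] = u @ x # v" for u x v
  proof -
    from that obtain us c vs where s: "[1..<Suc W] = us @ c # vs" "u = map g us" "x = g c" "v = map g vs"
      by (auto simp: map_eq_append_conv map_eq_Cons_conv simp del: upt_Suc)
    have l: "length us < W" using arg_cong[OF s(1), of length] by (simp del: upt_Suc)
    have "c = [1..<Suc W] ! length us" using s(1) by (simp add: nth_append del: upt_Suc)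
    then have "c = Suc (length us)" using l by (simp del: upt_Suc)
    moreover have "us = take (length us) [1..<Suc W]" "vs = drop (Suc (length us)) [1..<Suc W]"
      unfolding s(1) by simp_all
    then have "us = [1..<c]" "vs = [Suc c..<Suc W]"
      using l \<open>c = Suc (length us)\<close> by (simp_all only: take_upt drop_upt) simp_all
    ultimately show ?thesis using l s by (intro bexI[of _ c]) auto
  qed
  obtain ss gs where d: "draw_arcs (box_color ?D) (i + 1) [] (bottom_boxes ?D) = ss @ gs"
    "\<forall>b\<in>set ss. ?b b" "\<forall>b\<in>set gs. \<not> ?b b" "length ss = load 0 (map ?b (map g [1..<Suc W]))"
    and S: "ss \<noteq> [] \<Longrightarrow> \<exists>u v. map g [1..<Suc W] = u @ last ss # v \<and> load 0 (map ?b v) = 0 \<and> all_matched (map ?b u)"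
    and G: "gs \<noteq> [] \<Longrightarrow> \<exists>u v. map g [1..<Suc W] = u @ hd gs # v \<and> load 0 (map ?b v) = 0 \<and> all_matched (map ?b u)"
    and E: "gs = [] \<Longrightarrow> all_matched (map ?b (map g [1..<Suc W]))"
    using draw_arcs_word[of "box_color ?D" "i + 1" "map g [1..<Suc W]"] unfolding bot by blast
  show thesis
  proof (rule that[of ss gs])
    show "unarced_bottom (i + 1) (i + 1) ?D = ss" "unarced_bottom (i + 1) i ?D = gs"
      using filter_unarced[OF d(2,3)] unfolding unarced_bottom_def d(1) bit_add_1_1 by (simp_all only:)
    have all: "set [1..<Suc W] \<subseteq> {1..W}" by auto
    have "length ss = load 0 (w [1..<Suc W])" using d(4) unfolding word[OF all] .
    then show "length ss = count_list (part \<pi> (i + 1)) 1"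
      using wpart_lower[OF t, of i W] count_list_1_wpart unfolding w_def W_def by (metis order_refl)
    show "\<exists>c\<in>{1..W}. last ss = g c \<and> all_matched (w [1..<c]) \<and> odd (col c ?M) \<and> load 0 (w [Suc c..<Suc W]) = 0"
      if ne: "ss \<noteq> []"
    proof -
      from S[OF ne] obtain u v where uv: "map g [1..<Suc W] = u @ last ss # v"
        "load 0 (map ?b v) = 0" "all_matched (map ?b u)" by blast
      from split[OF uv(1)] obtain c where c: "c \<in> {1..W}" "last ss = g c" "u = map g [1..<c]" "v = map g [Suc c..<Suc W]"
        by blast
      have "?b (g c)" using d(2) ne unfolding c(2)[symmetric] by simp
      moreover have sub: "set [1..<c] \<subseteq> {1..W}" "set [Suc c..<Suc W] \<subseteq> {1..W}" using c(1) by auto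
      have "map ?b u = w [1..<c]" "map ?b v = w [Suc c..<Suc W]"
        unfolding c(3,4) by (rule word[OF sub(1)], rule word[OF sub(2)])
      ultimately show ?thesis
        using c(1,2) uv(2,3) color[of c] by (intro bexI[of _ c]) simp_all
    qed
    show "\<exists>c\<in>{1..W}. hd gs = g c \<and> all_matched (w [1..<c]) \<and> even (col c ?M) \<and> load 0 (w [Suc c..<Suc W]) = 0"
      if ne: "gs \<noteq> []"
    proof -
      from G[OF ne] obtain u v where uv: "map g [1..<Suc W] = u @ hd gs # v"
        "load 0 (map ?b v) = 0" "all_matched (map ?b u)" by blast
      from split[OF uv(1)] obtain c where c: "c \<in> {1..W}" "hd gs = g c" "u = map g [1..<c]" "v = map g [Suc c..<Suc W]"
        by blast
      have "\<not> ?b (g c)" using d(3) ne unfolding c(2)[symmetric] by simp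
      moreover have sub: "set [1..<c] \<subseteq> {1..W}" "set [Suc c..<Suc W] \<subseteq> {1..W}" using c(1) by auto
      have "map ?b u = w [1..<c]" "map ?b v = w [Suc c..<Suc W]"
        unfolding c(3,4) by (rule word[OF sub(1)], rule word[OF sub(2)])
      ultimately show ?thesis
        using c(1,2) uv(2,3) color[of c] by (intro bexI[of _ c]) simp_all
    qed
    show "all_matched (w [1..<Suc W])" if "gs = []" using E[OF that] unfolding word[OF all] .
  qed
qed

subsection \<open>The operators on ledge diagrams\<close>

lemma upt_split_at: "1 \<le> c \<Longrightarrow> c \<le> W \<Longrightarrow> [1..<Suc W] = [1..<c] @ c # [Suc c..<Suc W]"
  using upt_add_eq_append[of 1 c "Suc W - c"] upt_conv_Cons[of c "Suc W"] by simp

lemma ul_eps_calX: "triple \<pi> \<Longrightarrow> ul_eps (i + 1) (calX_at i \<pi>) = count_list (part \<pi> (i + 1)) 1"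
  unfolding ul_eps_def by (rule unarced_bottom_calX[of \<pi> i]) simp_all

lemma bottom_row_pos:
  assumes "c \<in> {1..total_width i \<pi>}"
  shows "0 < length (ord (part \<pi> i)) + col c (lower i \<pi>)"
  using assms col_pos_ledge[of c "ord (part \<pi> i)" "lower i \<pi>"] col_le_length[of c "ord (part \<pi> i)"]
  by (auto simp: total_width_def)

text \<open>The row just above the cut has colour \<open>i\<close>, and the rows further up are
  strictly shorter, so no row of colour \<open>i + 1\<close> above the cut reaches the full
  width.\<close>

lemma uppermost_peak_row_ledge:
  assumes UM: "regular2 U" "partition M" and M: "M \<noteq> []" "hd M = width (rev U @ M)"
  shows "uppermost_peak_row (i + 1) (ledge i U M) = length U"
  unfolding uppermost_peak_row_def
proof (rule Least_equality)
  let ?D = "ledge i U M" and ?W = "width (rev U @ M)"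
  have b: "i \<noteq> i + 1" by (cases i) auto
  have D: "fst (?D ! length U) = ?W" "snd (?D ! length U) = i + 1"
    using M by (simp_all add: fst_ledge snd_ledge nth_append hd_conv_nth)
  have le: "fst (?D ! s) \<le> ?W" if "s < length ?D" for s
    using that by (intro le_width) (metis forget_ledge length_map nth_map nth_mem)
  show "length U < length ?D \<and> snd (?D ! length U) = i + 1 \<and>
      (\<forall>s<length ?D. snd (?D ! s) = i + 1 \<longrightarrow> fst (?D ! s) \<le> fst (?D ! length U))"
    using D le M by auto
  fix r assume r: "r < length ?D \<and> snd (?D ! r) = i + 1 \<and>
      (\<forall>s<length ?D. snd (?D ! s) = i + 1 \<longrightarrow> fst (?D ! s) \<le> fst (?D ! r))"
  show "length U \<le> r"
  proof (rule ccontr)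
    assume "\<not> length U \<le> r"
    have "length U < length ?D" using M by simp
    with r D have "?W \<le> fst (?D ! r)" by metis
    then have "length U - col ?W U \<le> r"
      using r column_ledge[OF UM, of r ?W i] by simp
    moreover have "col ?W U \<le> 1"
      using regular2_col[OF UM(1), of ?W] col_eq_0[of U "Suc ?W"]
      by (cases "odd (col ?W U)") (simp_all add: width_append)
    ultimately have "length U = Suc r" using \<open>\<not> length U \<le> r\<close> by simp
    then have "snd (?D ! r) = i" using r by (simp add: snd_ledge)
    with r b show False by simp
  qed
qed

text \<open>The leftmost unarced \<open>i\<close>-bottom box marks the empty place of the word whose
  filling adds a row of length 1. If there is none, the word is completely matched, and the place to
  fill is the first one beyond its end.\<close>

lemma ul_f_calX:
  assumes t: "triple \<pi>"
  shows "ul_f (i + 1) (calX_at i \<pi>) = Some (calX_at i (add_row1 (i + 1) \<pi>))"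
proof -
  let ?U = "ord (part \<pi> i)" and ?M = "lower i \<pi>" and ?W = "total_width i \<pi>" and ?D = "calX_at i \<pi>"
  let ?w = "map (\<lambda>c. odd (col c ?M))"
  have UM: "regular2 ?U" "partition ?M" by (simp_all add: triple_regular2[OF t] partition_lower)
  have D: "?D = ledge i ?U ?M" by (rule calX_at_ledge)
  obtain ss gs where "unarced_bottom (i + 1) (i + 1) ?D = ss" and gs: "unarced_bottom (i + 1) i ?D = gs"
    and "length ss = count_list (part \<pi> (i + 1)) 1"
    and "ss \<noteq> [] \<Longrightarrow> \<exists>c\<in>{1..?W}. last ss = (length ?U + col c ?M - 1, c) \<and> all_matched (?w [1..<c]) \<and>
      odd (col c ?M) \<and> load 0 (?w [Suc c..<Suc ?W]) = 0"
    and G: "gs \<noteq> [] \<Longrightarrow> \<exists>c\<in>{1..?W}. hd gs = (length ?U + col c ?M - 1, c) \<and> all_matched (?w [1..<c]) \<and>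
      even (col c ?M) \<and> load 0 (?w [Suc c..<Suc ?W]) = 0"
    and E: "gs = [] \<Longrightarrow> all_matched (?w [1..<Suc ?W])"
    using unarced_bottom_calX[OF t, of i] by metis
  have f: "ul_f (i + 1) ?D = Some (if gs \<noteq> [] then add_below (i + 1) (hd gs) ?D else if ?D = [] then [(1, i + 1)]
      else ?D[uppermost_peak_row (i + 1) ?D := (Suc (fst (?D ! uppermost_peak_row (i + 1) ?D)), i + 1)])"
    by (simp only: ul_f_def Let_def bit_add_1_1 gs)
  show ?thesis
  proof (cases "gs = []")
    case False
    with G obtain c where c: "1 \<le> c" "c \<le> ?W" "hd gs = (length ?U + col c ?M - 1, c)"
      "all_matched (?w [1..<c])" "even (col c ?M)" "load 0 (?w [Suc c..<Suc ?W]) = 0"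
      by auto
    have "?w [1..<Suc ?W] = ?w [1..<c] @ False # ?w [Suc c..<Suc ?W]"
      unfolding upt_split_at[OF c(1,2)] using c(5) by simp
    then have p: "part \<pi> (i + 1) = wpart (?w [1..<c] @ False # ?w [Suc c..<Suc ?W])"
      using wpart_lower[OF t, of i ?W] by simp
    have l: "Suc (length (?w [1..<c])) = c" using c(1) by simp
    have pos: "0 < length ?U + col c ?M" using c by (intro bottom_row_pos) simp
    have "add_below (i + 1) (hd gs) ?D = calX_at i (add_row1 (i + 1) \<pi>)"
      by (rule calX_at_add_row1[OF t p c(4,6)]; unfold l; use pos in \<open>simp add: add_below_def c(3) D\<close>)
    then show ?thesis using False by (simp only: f if_True not_False_eq_True)
  next
    case True
    \<comment> \<open>One empty box is appended to the word; filling it opens the column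
      \<open>Suc ?W\<close>.\<close>
    have p: "part \<pi> (i + 1) = wpart (?w [1..<Suc ?W] @ False # [])"
      using wpart_append_replicate[of "?w [1..<Suc ?W]" 1] wpart_lower[OF t, of i ?W] by simp
    have l: "Suc (length (?w [1..<Suc ?W])) = Suc ?W" by (simp del: upt_Suc)
    have z: "col (Suc ?W) ?M = 0" by (simp add: col_eq_0 total_width_def width_append)
    show ?thesis
    proof (rule calX_at_add_row1[OF t p E[OF True] load.simps(1)]; unfold l z)
      assume *: "0 < length ?M" "?M ! 0 = Suc ?W - 1"
        "calX_at i (add_row1 (i + 1) \<pi>) = (ledge i ?U ?M)[length ?U + 0 := (Suc ?W, i + 1)]"
      have "?M \<noteq> []" "hd ?M = width (rev ?U @ ?M)"
        using * by (simp_all add: hd_conv_nth total_width_def)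
      then have "uppermost_peak_row (i + 1) ?D = length ?U"
        unfolding D by (intro uppermost_peak_row_ledge UM)
      moreover have "fst (?D ! length ?U) = ?W"
        unfolding D using * by (simp add: fst_ledge nth_append)
      moreover have "?D \<noteq> []" using * by (simp add: D ledge_def) (metis length_0_conv length_color less_irrefl)
      ultimately show ?thesis using True * by (simp only: f D[symmetric]) simp
    next
      assume *: "0 = length ?M" "Suc ?W = 1"
        "calX_at i (add_row1 (i + 1) \<pi>) = ledge i ?U ?M @ [(Suc ?W, i + 1)]"
      then have "width ?U = 0" using width_append[of ?U "[]"] by (simp add: total_width_def)
      then have "?U = []" using UM by (auto simp: regular2_def dest: width_0_imp)
      with * have D0: "?D = []" by (simp add: D ledge_def)
      have X: "calX_at i (add_row1 (i + 1) \<pi>) = [(1, i + 1)]"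
        using *(2,3) unfolding D[symmetric] D0 by simp
      show ?thesis unfolding f X using True D0 by simp
    qed
  qed
qed

text \<open>Stated on the result of adding a row, so that the description of the added box is read
  backward: the rightmost unarced box satisfies the matching conditions, and emptying its place
  removes the row of length 1 again.\<close>

lemma ul_e_calX:
  assumes t: "triple \<pi>"
  shows "ul_e (i + 1) (calX_at i (add_row1 (i + 1) \<pi>)) = Some (calX_at i \<pi>)"
proof -
  define \<pi>' where "\<pi>' = add_row1 (i + 1) \<pi>"
  have t': "triple \<pi>'" unfolding \<pi>'_def by (rule triple_add_row1[OF t])
  have p': "part \<pi>' (i + 1) = part \<pi> (i + 1) @ [1]" by (simp add: \<pi>'_def add_row1_def)
  let ?U = "ord (part \<pi> i)" and ?M = "lower i \<pi>" and ?M' = "lower i \<pi>'" and ?W = "total_width i \<pi>'" and ?D = "calX_at i \<pi>'"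
  let ?w = "map (\<lambda>c. odd (col c ?M'))"
  have U': "ord (part \<pi>' i) = ?U"
  proof -
    have "i + 1 \<noteq> i" by (cases i) auto
    then show ?thesis by (simp add: \<pi>'_def add_row1_def)
  qed
  obtain ss where ss: "unarced_bottom (i + 1) (i + 1) ?D = ss"
    and len: "length ss = count_list (part \<pi>' (i + 1)) 1"
    and S: "ss \<noteq> [] \<Longrightarrow> \<exists>c\<in>{1..?W}. last ss = (length ?U + col c ?M' - 1, c) \<and> all_matched (?w [1..<c]) \<and>
      odd (col c ?M') \<and> load 0 (?w [Suc c..<Suc ?W]) = 0"
    using unarced_bottom_calX[OF t', of i, unfolded U'] by metis
  have "ss \<noteq> []" using len unfolding p' by auto
  with S obtain c where c: "1 \<le> c" "c \<le> ?W" "last ss = (length ?U + col c ?M' - 1, c)"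
    "all_matched (?w [1..<c])" "odd (col c ?M')" "load 0 (?w [Suc c..<Suc ?W]) = 0"
    by auto
  have "?w [1..<Suc ?W] = ?w [1..<c] @ True # ?w [Suc c..<Suc ?W]"
    unfolding upt_split_at[OF c(1,2)] using c(5) by simp
  then have "part \<pi>' (i + 1) = wpart (?w [1..<c] @ True # ?w [Suc c..<Suc ?W])"
    using wpart_lower[OF t', of i ?W] by simp
  then have p: "part \<pi> (i + 1) = wpart (?w [1..<c] @ False # ?w [Suc c..<Suc ?W])"
    unfolding p' wpart_fill[OF c(4,6)] by simp
  have l: "Suc (length (?w [1..<c])) = c" using c(1) by simp
  have cM: "col c ?M' = Suc (col c ?M)"
    using col_lower_add_row1[OF t p c(4,6,1), folded \<pi>'_def] unfolding l by simp
  have pos: "\<forall>x\<in>set (ledge i ?U ?M). 0 < fst x"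
    using calX_at_UL[OF t, of i] unfolding calX_at_ledge UL_def upper_ledge_def by blast
  have "delete_box (last ss) ?D = calX_at i \<pi>"
    unfolding c(3) cM
  proof (rule calX_at_add_row1[OF t p c(4,6), folded \<pi>'_def]; unfold l)
    assume *: "col c ?M < length ?M" "?M ! col c ?M = c - 1" "1 < c"
      "?D = (ledge i ?U ?M)[length ?U + col c ?M := (c, i + 1)]" "even (col c ?M)"
    let ?r = "length ?U + col c ?M"
    have r: "?r < length ?U + length ?M" using * by simp
    have "ledge i ?U ?M ! ?r = (c - 1, i + 1)"
      using fst_ledge[OF r, of i] snd_ledge[OF r, of i] * by (simp add: prod_eq_iff nth_append)
    then have "(ledge i ?U ?M)[?r := (c - 1, i + 1)] = ledge i ?U ?M"
      by (metis list_update_id)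
    then show "delete_box (length ?U + Suc (col c ?M) - 1, c) ?D = calX_at i \<pi>"
      using pos r unfolding *(4) by (simp add: delete_box_def calX_at_ledge filter_id_conv)
  next
    assume *: "col c ?M = length ?M" "c = 1" "?D = ledge i ?U ?M @ [(c, i + 1)]"
    have "delete_box (length ?U + length ?M, 1) (ledge i ?U ?M @ [(1, i + 1)]) = ledge i ?U ?M"
      using pos by (simp add: delete_box_def nth_append list_update_append filter_id_conv)
    then show "delete_box (length ?U + Suc (col c ?M) - 1, c) ?D = calX_at i \<pi>"
      using * by (simp add: calX_at_ledge)
  qed
  then show ?thesis
    unfolding \<pi>'_def[symmetric] ul_e_def ss Let_def using \<open>ss \<noteq> []\<close> by simp
qed

section \<open>The bijection, its compatibility with the crystal structure, and the restriction to
  highest weight crystals\<close>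

subsection \<open>The bijection\<close>

lemma MV_related_iff: "(\<pi>, \<phi>) \<in> MV \<longleftrightarrow> (\<exists>N. mv_related N \<pi> \<phi>)"
  using MV_imp_related related_imp_MV by metis

lemma MV_sym: "(\<pi>, \<phi>) \<in> MV \<Longrightarrow> (\<phi>, \<pi>) \<in> MV"
  unfolding MV_related_iff using mv_related_sym by blast

lemma MV_triple: "(\<pi>, \<phi>) \<in> MV \<Longrightarrow> triple \<pi> \<and> triple \<phi>"
  unfolding MV_related_iff using mv_relatedD by blast

lemma MV_calX: "(\<pi>, \<phi>) \<in> MV \<Longrightarrow> calX_at 1 \<pi> = calX_at 0 \<phi>"
  unfolding MV_related_iff using related_imp_calX by blast

text \<open>Both partners have the diagram \<open>calX_at 1 \<pi>\<close>, from which
  \<open>calY_at 0\<close> recovers them.\<close>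

lemma MV_unique:
  assumes "(\<pi>, \<phi>) \<in> MV" "(\<pi>, \<psi>) \<in> MV"
  shows "\<phi> = \<psi>"
proof -
  have "calX_at 0 \<phi> = calX_at 0 \<psi>" using assms MV_calX by metis
  moreover have "triple \<phi>" "triple \<psi>" using assms MV_triple by blast+
  ultimately show ?thesis using calY_calX_at[of \<phi> 0] calY_calX_at[of \<psi> 0] by metis
qed

lemma MV_lozenge:
  assumes "triple \<pi>"
  shows "(\<pi>, lozenge \<pi>) \<in> MV" "(lozenge \<pi>, \<pi>) \<in> MV"
proof -
  obtain N \<phi> where "mv_related N \<pi> \<phi>" using related_exists[OF assms] .
  then have "(\<pi>, \<phi>) \<in> MV" by (rule related_imp_MV)
  moreover from this have "lozenge \<pi> = \<phi>"
    unfolding lozenge_def using MV_unique by (intro the_equality) auto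
  ultimately show "(\<pi>, lozenge \<pi>) \<in> MV" by simp
  then show "(lozenge \<pi>, \<pi>) \<in> MV" by (rule MV_sym)
qed

lemma mutually_inverse_MV_UL: "mutually_inverse_on MV UL calX calY"
proof -
  have 1: "calX (\<pi>, \<phi>) \<in> UL \<and> calY (calX (\<pi>, \<phi>)) = (\<pi>, \<phi>)" if "(\<pi>, \<phi>) \<in> MV" for \<pi> \<phi>
    using MV_triple[OF that] MV_calX[OF that] calX_at_UL[of \<pi> 1] calY_calX_at[of \<pi> 1] calY_calX_at[of \<phi> 0]
    by (simp add: calX_def calY_def)
  have 2: "calY D \<in> MV \<and> calX (calY D) = D" if D: "D \<in> UL" for D
  proof -
    obtain \<pi> where \<pi>: "triple \<pi>" "calX_at 1 \<pi> = D" using calX_at_surj[OF D] .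
    have "calX (\<pi>, lozenge \<pi>) = D" using \<pi> by (simp add: calX_def)
    with 1[OF MV_lozenge(1)[OF \<pi>(1)]] MV_lozenge(1)[OF \<pi>(1)] show ?thesis by auto
  qed
  show ?thesis
    unfolding mutually_inverse_on_def using 1 2 by (auto simp: image_subset_iff)
qed

text \<open>Colour 1 is treated on the second component and colour 0 on the first one: there the row
  is added to the partition that forms the lower part of the diagram.\<close>

lemma mv_f_calX:
  assumes "P \<in> MV"
  obtains Q where "Q \<in> MV" "mv_f i P = Some Q" "ul_f i (calX P) = Some (calX Q)"
proof -
  obtain \<pi> \<phi> where P: "P = (\<pi>, \<phi>)" by (cases P)
  have t: "triple \<pi>" "triple \<phi>" and X: "calX_at 1 \<pi> = calX_at 0 \<phi>"
    using assms MV_triple MV_calX unfolding P by blast+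
  show thesis
  proof (cases "i = 1")
    case True
    let ?\<psi> = "add_row1 1 \<phi>"
    have "(lozenge ?\<psi>, ?\<psi>) \<in> MV" by (intro MV_lozenge triple_add_row1 t)
    moreover from MV_calX[OF this] have "ul_f i (calX P) = Some (calX (lozenge ?\<psi>, ?\<psi>))"
      using ul_f_calX[OF t(2), of 0] X True by (simp add: P calX_def)
    ultimately show thesis using that[of "(lozenge ?\<psi>, ?\<psi>)"] True by (simp add: mv_f_def P)
  next
    case False
    then have i: "i = 0" by (cases i) auto
    let ?\<psi> = "add_row1 0 \<pi>"
    have "(?\<psi>, lozenge ?\<psi>) \<in> MV" by (intro MV_lozenge triple_add_row1 t)
    moreover have "ul_f i (calX P) = Some (calX (?\<psi>, lozenge ?\<psi>))"
      using ul_f_calX[OF t(1), of 1] i by (simp add: P calX_def)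
    ultimately show thesis using that[of "(?\<psi>, lozenge ?\<psi>)"] i by (simp add: mv_f_def P)
  qed
qed

lemma ul_eps_calX_MV:
  assumes "P \<in> MV"
  shows "ul_eps i (calX P) = mv_eps i P" "ul_eps_star i (calX P) = mv_eps_star i P"
proof -
  obtain \<pi> \<phi> where P: "P = (\<pi>, \<phi>)" by (cases P)
  have t: "triple \<pi>" "triple \<phi>" and X: "calX_at 1 \<pi> = calX_at 0 \<phi>"
    using assms MV_triple MV_calX unfolding P by blast+
  show "ul_eps i (calX P) = mv_eps i P"
    using ul_eps_calX[OF t(1), of 1] ul_eps_calX[OF t(2), of 0] X
    by (cases i) (simp_all add: P calX_def mv_eps_def)
  show "ul_eps_star i (calX P) = mv_eps_star i P"
    using unarced_top_calX[OF t(1), of 1] unarced_top_calX[OF t(2), of 0] X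
    by (cases i) (simp_all add: P calX_def mv_eps_star_def)
qed

lemma ul_e_None: "ul_eps i D = 0 \<Longrightarrow> ul_e i D = None"
  by (simp add: ul_eps_def ul_e_def)

lemma mv_e_calX:
  assumes PM: "P \<in> MV"
  shows "mv_e i P = None \<and> ul_e i (calX P) = None \<or>
    (\<exists>Q\<in>MV. mv_e i P = Some Q \<and> ul_e i (calX P) = Some (calX Q))"
proof (cases "mv_eps i P = 0")
  case True
  then show ?thesis using ul_e_None[of i "calX P"] ul_eps_calX_MV[OF PM] by (simp add: mv_e_def)
next
  case nz: False
  obtain \<pi> \<phi> where P: "P = (\<pi>, \<phi>)" by (cases P)
  have t: "triple \<pi>" "triple \<phi>" and X: "calX_at 1 \<pi> = calX_at 0 \<phi>"
    using PM MV_triple MV_calX unfolding P by blast+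
  show ?thesis
  proof (cases "i = 1")
    case True
    let ?\<psi> = "del_row1 1 \<phi>"
    have "0 < count_list (part \<phi> 1) 1" using nz True by (simp add: P mv_eps_def)
    note a = add_row1_del_row1[OF t(2) this]
    have "(lozenge ?\<psi>, ?\<psi>) \<in> MV" by (intro MV_lozenge a)
    moreover from MV_calX[OF this] have "ul_e i (calX P) = Some (calX (lozenge ?\<psi>, ?\<psi>))"
      using ul_e_calX[OF a(1), of 0] a(2) X True by (simp add: P calX_def)
    moreover have "mv_e i P = Some (lozenge ?\<psi>, ?\<psi>)" using nz True by (simp add: mv_e_def P)
    ultimately show ?thesis by blast
  next
    case False
    then have i: "i = 0" by (cases i) auto
    let ?\<psi> = "del_row1 0 \<pi>"
    have "0 < count_list (part \<pi> 0) 1" using nz i by (simp add: P mv_eps_def)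
    note a = add_row1_del_row1[OF t(1) this]
    have "(?\<psi>, lozenge ?\<psi>) \<in> MV" by (intro MV_lozenge a)
    moreover have "ul_e i (calX P) = Some (calX (?\<psi>, lozenge ?\<psi>))"
      using ul_e_calX[OF a(1), of 1] a(2) i by (simp add: P calX_def)
    moreover have "mv_e i P = Some (?\<psi>, lozenge ?\<psi>)" using nz i by (simp add: mv_e_def P)
    ultimately show ?thesis by blast
  qed
qed

lemma ul_wt_calX: "P \<in> MV \<Longrightarrow> ul_wt (calX P) = mv_wt P"
  by (cases P) (auto simp: ul_wt_def mv_wt_def calX_def dg_content_calX dest: MV_triple)

text \<open>\<open>G\<close> undoes \<open>F\<close> on \<open>elems B\<close>, so the values of the
  operators have to lie there.\<close>

lemma crystal_iso_inverse:
  assumes iso: "crystal_iso B C F" and inv: "mutually_inverse_on (elems B) (elems C) F G"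
    and closed: "\<And>b i b'. e_op B i b = Some b' \<or> f_op B i b = Some b' \<Longrightarrow> b' \<in> elems B"
  shows "crystal_iso C B G"
proof -
  have G: "G c \<in> elems B" "F (G c) = c" if "c \<in> elems C" for c
    using inv that by (auto simp: mutually_inverse_on_def)
  have GF: "G (F b) = b" if "b \<in> elems B" for b
    using inv that by (auto simp: mutually_inverse_on_def)
  have "bij_betw G (elems C) (elems B)"
    using inv by (intro bij_betw_byWitness[of _ F]) (auto simp: mutually_inverse_on_def)
  moreover have m: "map_option G (map_option F x) = x" if "\<And>b. x = Some b \<Longrightarrow> b \<in> elems B" for x
    using that GF by (cases x) auto
  have "e_op B i (G c) = map_option G (e_op C i c)" "f_op B i (G c) = map_option G (f_op C i c)"
    if "c \<in> elems C" for c i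
  proof -
    have "e_op C i c = map_option F (e_op B i (G c))" "f_op C i c = map_option F (f_op B i (G c))"
      using iso G[OF that] unfolding crystal_iso_def by metis+
    then show "e_op B i (G c) = map_option G (e_op C i c)" "f_op B i (G c) = map_option G (f_op C i c)"
      using m closed by metis+
  qed
  ultimately show ?thesis
    using iso G unfolding crystal_iso_def by metis
qed

lemma restrict_to_Some: "restrict_to S x = Some y \<Longrightarrow> y \<in> S"
  by (auto simp: restrict_to_def split: option.splits if_splits)

theorem corollaryF:
  fixes t :: "bit \<Rightarrow> nat"
  shows "(\<forall>(\<pi>, \<phi>)\<in>MV. calX (\<pi>, \<phi>) = calX_at 1 \<pi> \<and> calX (\<pi>, \<phi>) = calX_at 0 \<phi>) \<and>
    mutually_inverse_on MV UL calX calY \<and>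
    mutually_inverse_on (elems (MV_hw t)) (elems (UL_hw t)) calX calY \<and>
    crystal_iso (MV_hw t) (UL_hw t) calX \<and>
    crystal_iso (UL_hw t) (MV_hw t) calY"
proof -
  note inv = mutually_inverse_MV_UL
  have MVe: "elems (MV_hw t) = {P \<in> MV. \<forall>i. mv_eps_star i P \<le> t i}"
    by (simp add: MV_hw_def hw_crystal_def hw_elems_def MV_crystal_def)
  have ULe: "elems (UL_hw t) = {D \<in> UL. \<forall>i. ul_eps_star i D \<le> t i}"
    by (simp add: UL_hw_def hw_crystal_def hw_elems_def UL_crystal_def)
  \<comment> \<open>As the starred statistics agree, a value of an operator is replaced by 0 on one
    side iff it is on the other.\<close>
  have mem: "calX P \<in> elems (UL_hw t) \<longleftrightarrow> P \<in> elems (MV_hw t)" if "P \<in> MV" for P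
    using that inv ul_eps_calX_MV(2)[OF that] by (auto simp: MVe ULe mutually_inverse_on_def)
  have inv_hw: "mutually_inverse_on (elems (MV_hw t)) (elems (UL_hw t)) calX calY"
  proof -
    have "calX P \<in> elems (UL_hw t) \<and> calY (calX P) = P" if "P \<in> elems (MV_hw t)" for P
      using that mem[of P] inv by (auto simp: MVe mutually_inverse_on_def)
    moreover have "calY D \<in> elems (MV_hw t) \<and> calX (calY D) = D" if "D \<in> elems (UL_hw t)" for D
    proof -
      have "D \<in> UL" using that by (simp add: ULe)
      then have "calY D \<in> MV" "calX (calY D) = D" using inv by (auto simp: mutually_inverse_on_def)
      with that mem[of "calY D"] show ?thesis by simp
    qed
    ultimately show ?thesis unfolding mutually_inverse_on_def by blast
  qed
  have restrict: "restrict_to (elems (UL_hw t)) (Some (calX Q)) = map_option calX (restrict_to (elems (MV_hw t)) (Some Q))"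
    if "Q \<in> MV" for Q
    using mem[OF that] by (simp add: restrict_to_def)
  have ops: "e_op (UL_hw t) i D = restrict_to (elems (UL_hw t)) (ul_e i D)"
    "f_op (UL_hw t) i D = restrict_to (elems (UL_hw t)) (ul_f i D)"
    "e_op (MV_hw t) i P = restrict_to (elems (MV_hw t)) (mv_e i P)"
    "f_op (MV_hw t) i P = restrict_to (elems (MV_hw t)) (mv_f i P)" for i D P
    by (simp_all add: MV_hw_def UL_hw_def hw_crystal_def MV_crystal_def UL_crystal_def)
  have iso: "crystal_iso (MV_hw t) (UL_hw t) calX"
    unfolding crystal_iso_def
  proof (intro conjI ballI allI)
    show "bij_betw calX (elems (MV_hw t)) (elems (UL_hw t))"
      using inv_hw by (intro bij_betw_byWitness[of _ calY]) (auto simp: mutually_inverse_on_def)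
    fix P assume "P \<in> elems (MV_hw t)"
    then have P: "P \<in> MV" by (simp add: MVe)
    show "wt (UL_hw t) (calX P) = wt (MV_hw t) P"
      using ul_wt_calX[OF P] by (simp add: MV_hw_def UL_hw_def hw_crystal_def MV_crystal_def UL_crystal_def)
    fix i
    show "eps (UL_hw t) i (calX P) = eps (MV_hw t) i P" "phi (UL_hw t) i (calX P) = phi (MV_hw t) i P"
      using ul_wt_calX[OF P] ul_eps_calX_MV(1)[OF P]
      by (simp_all add: MV_hw_def UL_hw_def hw_crystal_def MV_crystal_def UL_crystal_def)
    show "e_op (UL_hw t) i (calX P) = map_option calX (e_op (MV_hw t) i P)"
      using mv_e_calX[OF P, of i] restrict unfolding ops by (auto simp: restrict_to_def)
    obtain Q where "Q \<in> MV" "mv_f i P = Some Q" "ul_f i (calX P) = Some (calX Q)"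
      by (rule mv_f_calX[OF P])
    then show "f_op (UL_hw t) i (calX P) = map_option calX (f_op (MV_hw t) i P)"
      using restrict unfolding ops by simp
  qed
  have "crystal_iso (UL_hw t) (MV_hw t) calY"
    by (rule crystal_iso_inverse[OF iso inv_hw]) (auto simp: ops dest: restrict_to_Some)
  with iso inv inv_hw MV_calX show ?thesis by (auto simp: calX_def)
qed

end
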